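(* Let $n\ge2$. For any $s\in(\frac12,1]$ and $\mathbf z\in\mathbb R^n$, the open set $H^{1+s}_{\mathrm r}(\mathbb R/\mathbb Z,\mathbb R^n)\subset H^{1+s}(\mathbb R/\mathbb Z,\mathbb R^n)$ strongly deformation retracts onto the submanifold $\mathcal N^{1+s}$ and onto the submanifold $\mathcal N^{1+s}_{\mathbf z}$, whereas $H^{1+s}_{\mathrm{ir}}(\mathbb R/\mathbb Z,\mathbb R^n)$ strongly deformation retracts onto $\mathcal A^{1+s}$ and onto $\mathcal A^{1+s}_{\mathbf z}$.
   Context: $\mathbb R/\mathbb Z$ is the circle of length $1$. $H^{1+s}(\mathbb R/\mathbb Z,\mathbb R^n)=W^{1+s,2}(\mathbb R/\mathbb Z,\mathbb R^n)$ is the (for $s<1$ fractional) Sobolev Hilbert space of $1$-periodic functions, which embeds compactly into $C^1$ for $s>\frac12$. $H^{1+s}_{\mathrm r}$ is the open subset of regular curves ($|\gamma'|>0$ everywhere), $H^{1+s}_{\mathrm{ir}}$ the open subset of regular curves that are injective on $[0,1)$. Further, $\mathcal N^{1+s}=\{\gamma\in H^{1+s}:|\gamma'|=1\}$, $\mathcal N^{1+s}_{\mathbf z}=\{\gamma\in\mathcal N^{1+s}:\gamma(0)=\mathbf z\}$, $\mathcal A^{1+s}=\{\gamma\in\mathcal N^{1+s}:\gamma|_{[0,1)}\text{ injective}\}$, $\mathcal A^{1+s}_{\mathbf z}=\{\gamma\in\mathcal A^{1+s}:\gamma(0)=\mathbf z\}$. All sets carry the $H^{1+s}$-topology. A space $X$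 strongly deformation retracts onto a subset $Y\subset X$ if there is a continuous map $F:X\times[0,1]\to X$ with $F(x,0)=x$ and $F(x,1)\in Y$ for all $x\in X$, and $F(y,\sigma)=y$ for all $y\in Y$, $\sigma\in[0,1]$. *)

theory Defs
  imports "HOL-Analysis.Analysis" "HOL-Library.Periodic_Fun"
begin

text \<open>
  Functions on the circle of length 1 are represented by 1-periodic functions on the real line.
\<close>

abbreviation periodic1 :: "(real \<Rightarrow> 'a) \<Rightarrow> bool" where
  "periodic1 f \<equiv> periodic_fun_simple' f"

text \<open>Members are functions, not classes; every class has a Borel measurable 1-periodic member.\<close>

definition L2_circle :: "(real \<Rightarrow> 'a::euclidean_space) set" where
  "L2_circle = {f. periodic1 f \<and> f \<in> borel_measurable borel \<and>
                   set_integrable lborel {0..1} (\<lambda>u. (norm (f u))\<^sup>2)}"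

definition test_function :: "(real \<Rightarrow> real) \<Rightarrow> bool" where
  "test_function \<phi> \<longleftrightarrow>
     periodic1 \<phi> \<and> (\<forall>k u. (deriv ^^ k) \<phi> field_differentiable (at u))"

definition has_weak_derivative ::
    "(real \<Rightarrow> 'a::euclidean_space) \<Rightarrow> (real \<Rightarrow> 'a) \<Rightarrow> bool" where
  "has_weak_derivative f g \<longleftrightarrow> f \<in> L2_circle \<and> g \<in> L2_circle \<and>
     (\<forall>\<phi>. test_function \<phi> \<longrightarrow>
        (LBINT u:{0..1}. deriv \<phi> u *\<^sub>R f u) = - (LBINT u:{0..1}. \<phi> u *\<^sub>R g u))"

text \<open>
  A weak derivative is unique up to null sets, and the quantities below in which
  \<open>weak_derivative\<close> occurs do not depend on the representative that is chosen here.
\<close>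

definition weak_derivative ::
    "(real \<Rightarrow> 'a::euclidean_space) \<Rightarrow> (real \<Rightarrow> 'a)" where
  "weak_derivative f = (SOME g. has_weak_derivative f g)"

definition L2_norm_sq :: "(real \<Rightarrow> 'a::euclidean_space) \<Rightarrow> ennreal" where
  "L2_norm_sq f = (\<integral>\<^sup>+ u\<in>{0..1}. ennreal ((norm (f u))\<^sup>2) \<partial>lborel)"

text \<open>
  The squared Gagliardo (Sobolev-Slobodeckij) seminorm of order \<open>s\<close> on the circle. The points
  \<open>u\<close> and \<open>u + w\<close> with \<open>\<bar>w\<bar> \<le> 1/2\<close> have distance \<open>\<bar>w\<bar>\<close> on the circle.
\<close>

definition gagliardo_sq :: "real \<Rightarrow> (real \<Rightarrow> 'a::euclidean_space) \<Rightarrow> ennreal" where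
  "gagliardo_sq s f =
     (\<integral>\<^sup>+ u\<in>{0..1}. (\<integral>\<^sup>+ w\<in>{-1/2..1/2}.
        ennreal ((norm (f (u + w) - f u))\<^sup>2 / \<bar>w\<bar> powr (1 + 2 * s)) \<partial>lborel) \<partial>lborel)"

text \<open>
  The space \<open>H\<^bsup>1+s\<^esup> = W\<^bsup>1+s,2\<^esup>\<close>, for \<open>0 < s \<le> 1\<close>. Each class is represented by its unique
  continuous member, so that pointwise statements (values, injectivity, classical derivatives)
  make sense.
\<close>

definition sobolev :: "real \<Rightarrow> (real \<Rightarrow> 'a::euclidean_space) set" where
  "sobolev s = {\<gamma>. continuous_on UNIV \<gamma> \<and> (\<exists>g. has_weak_derivative \<gamma> g \<and>
      (if s < 1 then gagliardo_sq s g < \<infinity> else (\<exists>h. has_weak_derivative g h)))}"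

definition sobolev_norm :: "real \<Rightarrow> (real \<Rightarrow> 'a::euclidean_space) \<Rightarrow> real" where
  "sobolev_norm s \<gamma> = sqrt (enn2real
     (L2_norm_sq \<gamma> + L2_norm_sq (weak_derivative \<gamma>) +
      (if s < 1 then gagliardo_sq s (weak_derivative \<gamma>)
       else L2_norm_sq (weak_derivative (weak_derivative \<gamma>)))))"

definition sobolev_topology :: "real \<Rightarrow> (real \<Rightarrow> 'a::euclidean_space) topology" where
  "sobolev_topology s =
     Metric_space.mtopology (sobolev s) (\<lambda>\<gamma> \<eta>. sobolev_norm s (\<lambda>u. \<gamma> u - \<eta> u))"

text \<open>
  For \<open>s > 1/2\<close> the members of \<open>sobolev s\<close> are continuously differentiable by the Sobolev
  embedding, so \<open>vector_derivative\<close> below is the classical derivative.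
\<close>

definition sobolev_regular :: "real \<Rightarrow> (real \<Rightarrow> 'a::euclidean_space) set" where
  "sobolev_regular s =
     {\<gamma> \<in> sobolev s. \<forall>u. norm (vector_derivative \<gamma> (at u)) > 0}"

definition sobolev_inj_regular :: "real \<Rightarrow> (real \<Rightarrow> 'a::euclidean_space) set" where
  "sobolev_inj_regular s = {\<gamma> \<in> sobolev_regular s. inj_on \<gamma> {0..<1}}"

definition arclength_curves :: "real \<Rightarrow> (real \<Rightarrow> 'a::euclidean_space) set" where
  "arclength_curves s =
     {\<gamma> \<in> sobolev s. \<forall>u. norm (vector_derivative \<gamma> (at u)) = 1}"

definition arclength_curves_at ::
    "real \<Rightarrow> 'a::euclidean_space \<Rightarrow> (real \<Rightarrow> 'a) set" where
  "arclength_curves_at s z = {\<gamma> \<in> arclength_curves s. \<gamma> 0 = z}"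

definition inj_arclength_curves :: "real \<Rightarrow> (real \<Rightarrow> 'a::euclidean_space) set" where
  "inj_arclength_curves s = {\<gamma> \<in> arclength_curves s. inj_on \<gamma> {0..<1}}"

definition inj_arclength_curves_at ::
    "real \<Rightarrow> 'a::euclidean_space \<Rightarrow> (real \<Rightarrow> 'a) set" where
  "inj_arclength_curves_at s z = {\<gamma> \<in> inj_arclength_curves s. \<gamma> 0 = z}"

definition strongly_deformation_retracts_onto :: "'a topology \<Rightarrow> 'a set \<Rightarrow> bool" where
  "strongly_deformation_retracts_onto X Y \<longleftrightarrow> Y \<subseteq> topspace X \<and>
     (\<exists>F. continuous_map (prod_topology X (top_of_set {0..1::real})) X F \<and>
          (\<forall>x\<in>topspace X. F (x, 0) = x \<and> F (x, 1) \<in> Y) \<and>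
          (\<forall>y\<in>Y. \<forall>\<sigma>\<in>{0..1}. F (y, \<sigma>) = y))"

end

theory Submission
  imports Defs
begin

text \<open>
  The deformation consists of reparametrizations. Let \<open>\<gamma>\<close> be a regular curve with velocity \<open>g\<close>, length \<open>L\<close>
  and arc length function \<open>A t = \<integral>\<^sub>0\<^sup>t \<bar>g\<bar>\<close>. For \<open>\<sigma>\<close> between 0 and 1 the map \<open>\<theta> t = (1 - \<sigma>) * t + \<sigma> * A t / L\<close> is
  a diffeomorphism of the circle, and the curve \<open>\<gamma> \<circ> \<theta>\<^sup>-\<^sup>1\<close> divided by \<open>(1 - \<sigma>) + \<sigma> * L\<close> is \<open>\<gamma>\<close> at \<open>\<sigma> = 0\<close> and
  has unit speed at \<open>\<sigma> = 1\<close>. If \<open>\<gamma>\<close> has unit speed, then \<open>\<theta>\<close> is the identity and nothing moves.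
  Regularity and injectivity are preserved. Adding \<open>\<sigma>\<close> times the difference of \<open>z\<close> and the base
  point yields the retractions onto the curves that start at \<open>z\<close>. All four assertions are instances of
  \<open>strong_deformation_retraction\<close>.
  
  The substance is the continuity of this homotopy in the Sobolev topology, jointly in \<open>\<gamma>\<close> and \<open>\<sigma>\<close>
  (\<open>based_homotopy_dist_tendsto\<close>), because composition with a diffeomorphism is not continuous in the
  operator norm. The velocity of the deformed curve is \<open>\<Phi> g \<circ> \<theta>\<^sup>-\<^sup>1\<close> with
  \<open>\<Phi> v = v / (((1 - \<sigma>) + \<sigma> * L) * ((1 - \<sigma>) + \<sigma> * \<bar>v\<bar> / L))\<close>, an elementary Lipschitz function. For \<open>s < 1\<close> the
  Gagliardo integral is written over the unit square with a periodic kernel and transformed back to the original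
  parameter, where the difference quotients of the velocities converge; two applications of dominated
  convergence with varying dominating functions finish the proof
  (\<open>gagliardo_sq_lipschitz_compose_tendsto\<close>). For \<open>s = 1\<close> the second derivative is composed with \<open>\<theta>\<^sup>-\<^sup>1\<close>, and
  the density of the continuous functions in \<open>L\<^sup>2\<close> gives convergence (\<open>L2_compose_tendsto\<close>).
  
  Beforehand the spaces, which are defined by weak derivatives, are described by classical ones: a curve belongs to
  \<open>sobolev s\<close> if and only if it is continuously differentiable and its derivative has a finite seminorm
  or, for \<open>s = 1\<close>, is the primitive of a square integrable function (\<open>sobolev_iff_jet\<close>). This rests on
  the du Bois-Reymond lemma (\<open>weak_derivative_imp_primitive_of\<close>) and on the embedding into continuously
  differentiable functions for \<open>s > 1/2\<close> (\<open>gagliardo_embedding\<close>), which also bounds the supremum norms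
  and thereby makes speed, length and \<open>\<theta>\<close> depend continuously on the curve.
\<close>

section \<open>Square integrable functions on the circle\<close>

lemma L2_circle_iff:
  "f \<in> L2_circle \<longleftrightarrow> periodic1 f \<and> f \<in> borel_measurable borel \<and> L2_norm_sq f < \<infinity>"
proof -
  have "set_integrable lborel {0..1} (\<lambda>u. (norm (f u))\<^sup>2) \<longleftrightarrow> L2_norm_sq f < \<infinity>"
    if [measurable]: "f \<in> borel_measurable borel"
  proof -
    have "(\<integral>\<^sup>+ u. ennreal (norm (indicator {0..1} u *\<^sub>R (norm (f u))\<^sup>2)) \<partial>lborel) = L2_norm_sq f"
      unfolding L2_norm_sq_def
      by (intro nn_integral_cong) (auto split: split_indicator)
    then show ?thesis
      unfolding set_integrable_def integrable_iff_bounded by simp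
  qed
  then show ?thesis
    unfolding L2_circle_def by auto
qed

lemma periodic1D: "periodic1 f \<Longrightarrow> f (x + 1) = f x"
  using periodic_fun_simple'.plus_period .

lemma periodic1I: "(\<And>x. f (x + 1) = f x) \<Longrightarrow> periodic1 f"
  by (rule periodic_fun_simple'.intro) auto

lemma nn_integral_shift:
  fixes h :: "real \<Rightarrow> ennreal"
  assumes [measurable]: "h \<in> borel_measurable borel"
  shows "(\<integral>\<^sup>+ u\<in>{a + c..b + c}. h u \<partial>lborel) = (\<integral>\<^sup>+ u\<in>{a..b}. h (u + c) \<partial>lborel)"
proof -
  have "(\<integral>\<^sup>+ u\<in>{a + c..b + c}. h u \<partial>lborel)
      = (\<integral>\<^sup>+ u. h (c + 1 * u) * indicator {a + c..b + c} (c + 1 * u) \<partial>lborel)"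
    by (subst nn_integral_real_affine[where c = 1 and t = c]) auto
  also have "\<dots> = (\<integral>\<^sup>+ u\<in>{a..b}. h (u + c) \<partial>lborel)"
    by (intro nn_integral_cong) (auto split: split_indicator simp: add.commute)
  finally show ?thesis .
qed

lemma nn_integral_Icc_combine:
  fixes h :: "real \<Rightarrow> ennreal"
  assumes [measurable]: "h \<in> borel_measurable borel" and "a \<le> b" "b \<le> c"
  shows "(\<integral>\<^sup>+ u\<in>{a..c}. h u \<partial>lborel)
       = (\<integral>\<^sup>+ u\<in>{a..b}. h u \<partial>lborel) + (\<integral>\<^sup>+ u\<in>{b..c}. h u \<partial>lborel)"
proof -
  have "AE u in lborel. u \<noteq> b"
    by (rule AE_lborel_singleton)
  then have "AE u in lborel. h u * indicator {a..c} u
      = h u * indicator {a..b} u + h u * indicator {b..c} u"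
    by eventually_elim (use assms in \<open>auto split: split_indicator\<close>)
  then have "(\<integral>\<^sup>+ u\<in>{a..c}. h u \<partial>lborel)
      = (\<integral>\<^sup>+ u. h u * indicator {a..b} u + h u * indicator {b..c} u \<partial>lborel)"
    by (rule nn_integral_cong_AE)
  then show ?thesis
    by (simp add: nn_integral_add)
qed

text \<open>
  Over a full period the integral does not see the starting point. This is what allows the Gagliardo
  double integral to be moved to windows adapted to a point or to a change of parameter.
\<close>
lemma nn_integral_periodic_shift:
  fixes h :: "real \<Rightarrow> ennreal"
  assumes [measurable]: "h \<in> borel_measurable borel" and per: "\<And>x. h (x + 1) = h x"
  shows "(\<integral>\<^sup>+ u\<in>{a..a + 1}. h u \<partial>lborel) = (\<integral>\<^sup>+ u\<in>{0..1}. h u \<partial>lborel)"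
proof -
  interpret periodic_fun_simple' h
    by (rule periodic1I) (rule per)
  define r where "r = frac a"
  have r: "0 \<le> r" "r \<le> 1" "a = r + of_int \<lfloor>a\<rfloor>"
    using frac_ge_0[of a] frac_lt_1[of a] unfolding r_def by (auto simp: frac_def)
  have "(\<integral>\<^sup>+ u\<in>{a..a + 1}. h u \<partial>lborel) = (\<integral>\<^sup>+ u\<in>{r..r + 1}. h (u + of_int \<lfloor>a\<rfloor>) \<partial>lborel)"
    using nn_integral_shift[of h r "of_int \<lfloor>a\<rfloor>" "r + 1"] r(3)
    by (simp add: algebra_simps)
  also have "\<dots> = (\<integral>\<^sup>+ u\<in>{r..r + 1}. h u \<partial>lborel)"
    by (simp add: plus_of_int)
  also have "\<dots> = (\<integral>\<^sup>+ u\<in>{r..1}. h u \<partial>lborel) + (\<integral>\<^sup>+ u\<in>{1..r + 1}. h u \<partial>lborel)"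
    using r by (intro nn_integral_Icc_combine) auto
  also have "(\<integral>\<^sup>+ u\<in>{1..r + 1}. h u \<partial>lborel) = (\<integral>\<^sup>+ u\<in>{0..r}. h u \<partial>lborel)"
    using nn_integral_shift[of h 0 1 r] by (simp add: per)
  also have "(\<integral>\<^sup>+ u\<in>{r..1}. h u \<partial>lborel) + (\<integral>\<^sup>+ u\<in>{0..r}. h u \<partial>lborel)
      = (\<integral>\<^sup>+ u\<in>{0..1}. h u \<partial>lborel)"
    using r by (subst nn_integral_Icc_combine[of h 0 r 1]) (auto simp: add.commute)
  finally show ?thesis .
qed

lemma L2_norm_sq_shift:
  assumes "periodic1 f" and [measurable]: "f \<in> borel_measurable borel"
  shows "(\<integral>\<^sup>+ u\<in>{a..a + 1}. ennreal ((norm (f u))\<^sup>2) \<partial>lborel) = L2_norm_sq f"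
  unfolding L2_norm_sq_def
  by (rule nn_integral_periodic_shift) (auto simp: periodic1D[OF assms(1)])

lemma L2_circle_Icc_finite:
  assumes f: "f \<in> L2_circle"
  shows "(\<integral>\<^sup>+ u\<in>{a..b}. ennreal ((norm (f u))\<^sup>2) \<partial>lborel) < \<infinity>"
proof -
  have [measurable]: "f \<in> borel_measurable borel" and fin: "L2_norm_sq f < \<infinity>" and per: "periodic1 f"
    using f by (auto simp: L2_circle_iff)
  have *: "(\<integral>\<^sup>+ u\<in>{a..a + real n}. ennreal ((norm (f u))\<^sup>2) \<partial>lborel) < \<infinity>" for n
  proof (induction n)
    case 0
    have "AE u in lborel. ennreal ((norm (f u))\<^sup>2) * indicator {a..a + real 0} u = 0"
      using AE_lborel_singleton[of a] by eventually_elim (auto split: split_indicator)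
    then have "(\<integral>\<^sup>+ u\<in>{a..a + real 0}. ennreal ((norm (f u))\<^sup>2) \<partial>lborel) = 0"
      by (subst nn_integral_0_iff_AE) auto
    then show ?case by simp
  next
    case (Suc n)
    have "(\<integral>\<^sup>+ u\<in>{a..a + real (Suc n)}. ennreal ((norm (f u))\<^sup>2) \<partial>lborel)
        = (\<integral>\<^sup>+ u\<in>{a..a + real n}. ennreal ((norm (f u))\<^sup>2) \<partial>lborel)
        + (\<integral>\<^sup>+ u\<in>{a + real n..a + real n + 1}. ennreal ((norm (f u))\<^sup>2) \<partial>lborel)"
      by (subst nn_integral_Icc_combine[of _ a "a + real n" "a + real (Suc n)"])
        (auto simp: algebra_simps)
    then show ?case
      using Suc fin by (simp add: L2_norm_sq_shift[OF per])
  qed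
  obtain n :: nat where "b - a \<le> real n"
    using real_arch_simple by blast
  then have "(\<integral>\<^sup>+ u\<in>{a..b}. ennreal ((norm (f u))\<^sup>2) \<partial>lborel)
      \<le> (\<integral>\<^sup>+ u\<in>{a..a + real n}. ennreal ((norm (f u))\<^sup>2) \<partial>lborel)"
    by (intro nn_integral_mono) (auto split: split_indicator)
  then show ?thesis
    using *[of n] by (rule le_less_trans)
qed

lemma L2_circle_set_integrable:
  assumes f: "f \<in> L2_circle"
  shows "set_integrable lborel {a..b} f"
proof -
  have [measurable]: "f \<in> borel_measurable borel"
    using f by (auto simp: L2_circle_iff)
  have "(\<integral>\<^sup>+ u. ennreal (norm (indicator {a..b} u *\<^sub>R f u)) \<partial>lborel)
     \<le> (\<integral>\<^sup>+ u. indicator {a..b} u + ennreal ((norm (f u))\<^sup>2) * indicator {a..b} u \<partial>lborel)"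
  proof (intro nn_integral_mono)
    fix u
    have "norm (f u) \<le> 1 + (norm (f u))\<^sup>2"
      using zero_le_power2[of "norm (f u) - 1/2"] by (auto simp: power2_eq_square algebra_simps)
    then have "ennreal (norm (f u)) \<le> 1 + ennreal ((norm (f u))\<^sup>2)"
      by (metis ennreal_1 ennreal_leI ennreal_plus zero_le_one zero_le_power2)
    then show "ennreal (norm (indicator {a..b} u *\<^sub>R f u))
        \<le> indicator {a..b} u + ennreal ((norm (f u))\<^sup>2) * indicator {a..b} u"
      by (auto split: split_indicator)
  qed
  also have "\<dots> = emeasure lborel {a..b} + (\<integral>\<^sup>+ u\<in>{a..b}. ennreal ((norm (f u))\<^sup>2) \<partial>lborel)"
    by (subst nn_integral_add) auto
  also have "\<dots> < \<infinity>"
    using L2_circle_Icc_finite[OF f, of a b] by (simp add: emeasure_lborel_Icc_eq)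
  finally show ?thesis
    unfolding set_integrable_def integrable_iff_bounded by simp
qed

text \<open>
  The Cauchy-Schwarz inequality for \<open>f = f * 1\<close>. It is stated with values in \<open>ennreal\<close>, so that the
  right-hand side may be infinite, and also holds without integrability because the integral is then 0.
\<close>
lemma set_integral_norm_sq_le:
  fixes f :: "real \<Rightarrow> 'a::euclidean_space"
  assumes [measurable]: "f \<in> borel_measurable borel" and "a \<le> b"
  shows "ennreal ((norm (LBINT u:{a..b}. f u))\<^sup>2)
     \<le> ennreal (b - a) * (\<integral>\<^sup>+ u\<in>{a..b}. ennreal ((norm (f u))\<^sup>2) \<partial>lborel)"
proof (cases "set_integrable lborel {a..b} f")
  case True
  let ?I = "indicator {a..b} :: real \<Rightarrow> ennreal"
  have "ennreal (norm (LBINT u:{a..b}. f u)) \<le> (\<integral>\<^sup>+ u. ennreal (norm (indicator {a..b} u *\<^sub>R f u)) \<partial>lborel)"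
    unfolding set_lebesgue_integral_def
    by (rule integral_norm_bound_ennreal) (use True in \<open>simp add: set_integrable_def\<close>)
  also have "\<dots> = (\<integral>\<^sup>+ u. (ennreal (norm (f u)) * ?I u) * ?I u \<partial>lborel)"
    by (intro nn_integral_cong) (auto split: split_indicator)
  finally have "(ennreal (norm (LBINT u:{a..b}. f u)))\<^sup>2
     \<le> (\<integral>\<^sup>+ u. (ennreal (norm (f u)) * ?I u) * ?I u \<partial>lborel)\<^sup>2"
    by (rule power_mono) simp
  also have "\<dots> \<le> (\<integral>\<^sup>+ u. (ennreal (norm (f u)) * ?I u)\<^sup>2 \<partial>lborel) * (\<integral>\<^sup>+ u. (?I u)\<^sup>2 \<partial>lborel)"
    by (rule Cauchy_Schwarz_nn_integral) auto
  also have "(\<integral>\<^sup>+ u. (ennreal (norm (f u)) * ?I u)\<^sup>2 \<partial>lborel)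
      = (\<integral>\<^sup>+ u\<in>{a..b}. ennreal ((norm (f u))\<^sup>2) \<partial>lborel)"
    by (intro nn_integral_cong) (auto split: split_indicator simp: ennreal_power)
  also have "(\<integral>\<^sup>+ u. (?I u)\<^sup>2 \<partial>lborel) = (\<integral>\<^sup>+ u. ?I u \<partial>lborel)"
    by (intro nn_integral_cong) (auto split: split_indicator)
  also have "\<dots> = ennreal (b - a)"
    using assms by simp
  finally show ?thesis
    by (simp add: ennreal_power mult.commute)
next
  case False
  then show ?thesis
    by (simp add: set_lebesgue_integral_def set_integrable_def not_integrable_integral_eq)
qed

section \<open>Primitives of integrable functions\<close>

text \<open>
  Absolutely continuous functions, described by a density of their increments. The density is an
  arbitrary representative, and no differentiability at any point is asserted.
\<close>
definition primitive_of :: "(real \<Rightarrow> 'a::euclidean_space) \<Rightarrow> (real \<Rightarrow> 'a) \<Rightarrow> bool" where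
  "primitive_of f h \<longleftrightarrow> (\<forall>a b. a \<le> b \<longrightarrow> set_integrable lborel {a..b} h \<and>
     (LBINT u:{a..b}. h u) = f b - f a)"

lemma primitive_ofD:
  assumes "primitive_of f h" "a \<le> b"
  shows "set_integrable lborel {a..b} h" "(LBINT u:{a..b}. h u) = f b - f a"
  using assms by (auto simp: primitive_of_def)

lemma primitive_of_norm_le:
  assumes "primitive_of f h" "a \<le> b"
  shows "norm (f b - f a) \<le> (LBINT u:{a..b}. norm (h u))"
  using primitive_ofD[OF assms] set_integral_norm_bound by metis

lemma primitive_of_has_integral:
  assumes "primitive_of f h" "a \<le> b"
  shows "(h has_integral (f b - f a)) {a..b}"
  using primitive_ofD[OF assms] has_integral_set_lebesgue[of "{a..b}" h]
  by (metis set_borel_integral_eq_integral(1,2) has_integral_integral)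

lemma primitive_of_continuous:
  assumes "primitive_of f h"
  shows "continuous_on UNIV f"
proof -
  have "isCont f x" for x
  proof -
    have I: "h integrable_on {x - 1..x + 1}"
      using primitive_of_has_integral[OF assms, of "x - 1" "x + 1"] by auto
    have "continuous_on {x - 1..x + 1} (\<lambda>t. integral {x - 1..t} h)"
      using I by (rule indefinite_integral_continuous_1)
    then have "continuous_on {x - 1..x + 1} (\<lambda>t. integral {x - 1..t} h + f (x - 1))"
      by (intro continuous_intros)
    moreover have "integral {x - 1..t} h + f (x - 1) = f t" if "t \<in> {x - 1..x + 1}" for t
      using primitive_of_has_integral[OF assms, of "x - 1" t] that by (simp add: integral_unique)
    ultimately have "continuous_on {x - 1..x + 1} f"
      by (subst (asm) continuous_on_cong) auto
    then show ?thesis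
      by (rule continuous_on_interior) auto
  qed
  then show ?thesis
    by (simp add: continuous_at_imp_continuous_on)
qed

lemma primitive_of_ext:
  assumes "\<And>a b. a \<le> b \<Longrightarrow> set_integrable lborel {a..b} h" "\<And>x. f x = c + (LBINT u=0..x. h u)"
  shows "primitive_of f h"
  unfolding primitive_of_def
proof (intro allI impI conjI)
  fix a b :: real assume "a \<le> b"
  show "set_integrable lborel {a..b} h" using \<open>a \<le> b\<close> by (rule assms(1))
  have "interval_lebesgue_integrable lborel (ereal x) (ereal y) h" for x y
    using assms(1)[of x y] assms(1)[of y x]
    by (auto simp: interval_lebesgue_integrable_def intro: set_integrable_subset)
  then have "(LBINT u=0..a. h u) + (LBINT u=a..b. h u) = (LBINT u=0..b. h u)"
    by (intro interval_integral_sum)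
      (simp add: min_def max_def zero_ereal_def)
  then show "(LBINT u:{a..b}. h u) = f b - f a"
    using \<open>a \<le> b\<close> by (simp add: assms(2) interval_integral_Icc algebra_simps)
qed

lemma L2_circle_has_primitive:
  assumes "g \<in> L2_circle"
  obtains f where "primitive_of f g" "f 0 = 0"
proof
  show "primitive_of (\<lambda>x. 0 + (LBINT u=ereal 0..ereal x. g u)) g"
    by (rule primitive_of_ext) (auto intro: L2_circle_set_integrable assms simp: zero_ereal_def)
  show "0 + (LBINT u=ereal 0..ereal 0. g u) = 0"
    by (simp add: interval_integral_endpoints_same)
qed

lemma primitive_of_eq_iff:
  assumes "primitive_of f h" "primitive_of g h"
  shows "f x - f 0 = g x - g 0"
proof (cases "0 \<le> x")
  case True
  then show ?thesis
    using primitive_ofD(2)[OF assms(1), of 0 x] primitive_ofD(2)[OF assms(2), of 0 x] by simp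
next
  case False
  then have "f 0 - f x = g 0 - g x"
    using primitive_ofD(2)[OF assms(1), of x 0] primitive_ofD(2)[OF assms(2), of x 0] by simp
  then show ?thesis by (simp add: algebra_simps)
qed

lemma primitive_of_add:
  assumes "primitive_of f h" "primitive_of g k"
  shows "primitive_of (\<lambda>x. f x + g x) (\<lambda>x. h x + k x)"
  using assms unfolding primitive_of_def by (auto simp: set_integral_add)

lemma primitive_of_diff:
  assumes "primitive_of f h" "primitive_of g k"
  shows "primitive_of (\<lambda>x. f x - g x) (\<lambda>x. h x - k x)"
  using assms unfolding primitive_of_def by (auto simp: set_integral_diff)

lemma primitive_of_scaleR:
  assumes "primitive_of f h"
  shows "primitive_of (\<lambda>x. c *\<^sub>R f x) (\<lambda>x. c *\<^sub>R h x)"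
  using assms unfolding primitive_of_def
  by (auto simp: set_integral_scaleR_right scaleR_diff_right)

lemma primitive_of_const: "primitive_of (\<lambda>x. c) (\<lambda>x. 0)"
  unfolding primitive_of_def by (simp add: set_integrable_def set_lebesgue_integral_def)

lemma primitive_of_derivative:
  assumes "\<And>u. (f has_vector_derivative g u) (at u)" "continuous_on UNIV g"
  shows "primitive_of f g"
  unfolding primitive_of_def
proof (intro allI impI conjI)
  fix a b :: real assume "a \<le> b"
  have c: "continuous_on {a..b} g"
    using assms(2) continuous_on_subset by blast
  then show I: "set_integrable lborel {a..b} g"
    by (rule borel_integrable_atLeastAtMost')
  have "(g has_integral (f b - f a)) {a..b}"
    using \<open>a \<le> b\<close> assms(1) by (intro fundamental_theorem_of_calculus)
      (auto intro: has_vector_derivative_at_within)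
  then show "(LBINT u:{a..b}. g u) = f b - f a"
    using set_borel_integral_eq_integral(2)[OF I] by (simp add: integral_unique)
qed

lemma primitive_of_continuous_derivative:
  assumes "primitive_of f g" "continuous_on UNIV g"
  shows "(f has_vector_derivative g u) (at u)"
proof -
  have "((\<lambda>t. integral {u - 1..t} g) has_vector_derivative g u) (at u within {u - 1..u + 1})"
    using assms(2) by (intro integral_has_vector_derivative) (auto intro: continuous_on_subset)
  then have "((\<lambda>t. integral {u - 1..t} g + f (u - 1)) has_vector_derivative g u) (at u within {u - 1..u + 1})"
    by (auto intro!: derivative_eq_intros)
  then have "(f has_vector_derivative g u) (at u within {u - 1..u + 1})"
  proof (rule has_vector_derivative_transform[rotated 2])
    fix t assume "t \<in> {u - 1..u + 1}"
    then show "f t = integral {u - 1..t} g + f (u - 1)"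
      using primitive_of_has_integral[OF assms(1), of "u - 1" t] by (simp add: integral_unique)
  qed auto
  then have "(f has_vector_derivative g u) (at u within {u - 1<..<u + 1})"
    by (rule has_vector_derivative_within_subset) auto
  then show ?thesis
    by (simp add: at_within_open[of u "{u - 1<..<u + 1}"])
qed

text \<open>
  The value at \<open>x\<close> differs from the value at any \<open>y\<close> in the next period by an integral of \<open>h\<close>, which is
  at most the \<open>L\<^sup>2\<close> norm of \<open>h\<close>; averaging over \<open>y\<close> gives the one-dimensional Sobolev inequality.
\<close>
lemma sup_le_L2_norm_sq:
  assumes prim: "primitive_of f h" and h: "h \<in> L2_circle" and per: "periodic1 f"
  shows "ennreal ((norm (f x))\<^sup>2) \<le> 2 * (L2_norm_sq f + L2_norm_sq h)"
proof -
  have [measurable]: "h \<in> borel_measurable borel" using h by (simp add: L2_circle_iff)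
  have [measurable]: "f \<in> borel_measurable borel"
    using primitive_of_continuous[OF prim] by (rule borel_measurable_continuous_onI)
  have per_h: "periodic1 h" using h by (simp add: L2_circle_iff)
  have *: "ennreal ((norm (f x))\<^sup>2) \<le> 2 * ennreal ((norm (f y))\<^sup>2) + 2 * L2_norm_sq h"
    if y: "y \<in> {x..x + 1}" for y
  proof -
    have "ennreal ((norm (f y - f x))\<^sup>2) = ennreal ((norm (LBINT u:{x..y}. h u))\<^sup>2)"
      using primitive_ofD(2)[OF prim, of x y] y by simp
    also have "\<dots> \<le> ennreal (y - x) * (\<integral>\<^sup>+ u\<in>{x..y}. ennreal ((norm (h u))\<^sup>2) \<partial>lborel)"
      by (rule set_integral_norm_sq_le) (use y in auto)
    also have "\<dots> \<le> 1 * (\<integral>\<^sup>+ u\<in>{x..x + 1}. ennreal ((norm (h u))\<^sup>2) \<partial>lborel)"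
      by (intro mult_mono nn_integral_mono) (use y in \<open>auto split: split_indicator simp: ennreal_le_1\<close>)
    also have "\<dots> = L2_norm_sq h"
      by (simp add: L2_norm_sq_shift[OF per_h])
    finally have 1: "ennreal ((norm (f y - f x))\<^sup>2) \<le> L2_norm_sq h" .
    have "norm (f x) \<le> norm (f y) + norm (f y - f x)"
      by (metis norm_minus_commute norm_triangle_sub)
    then have "(norm (f x))\<^sup>2 \<le> (norm (f y) + norm (f y - f x))\<^sup>2"
      by (intro power_mono) auto
    also have "\<dots> \<le> 2 * (norm (f y))\<^sup>2 + 2 * (norm (f y - f x))\<^sup>2"
      using zero_le_power2[of "norm (f y) - norm (f y - f x)"]
      by (simp add: power2_eq_square algebra_simps)
    finally have "ennreal ((norm (f x))\<^sup>2) \<le> ennreal (2 * (norm (f y))\<^sup>2 + 2 * (norm (f y - f x))\<^sup>2)"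
      by (rule ennreal_leI)
    also have "\<dots> = 2 * ennreal ((norm (f y))\<^sup>2) + 2 * ennreal ((norm (f y - f x))\<^sup>2)"
      by (simp add: ennreal_plus ennreal_mult)
    also have "\<dots> \<le> 2 * ennreal ((norm (f y))\<^sup>2) + 2 * L2_norm_sq h"
      by (intro add_mono mult_mono 1) auto
    finally show ?thesis .
  qed
  have "ennreal ((norm (f x))\<^sup>2) = (\<integral>\<^sup>+ y\<in>{x..x + 1}. ennreal ((norm (f x))\<^sup>2) \<partial>lborel)"
    by (simp add: nn_integral_cmult)
  also have "\<dots> \<le> (\<integral>\<^sup>+ y. 2 * (ennreal ((norm (f y))\<^sup>2) * indicator {x..x + 1} y)
      + 2 * L2_norm_sq h * indicator {x..x + 1} y \<partial>lborel)"
    by (intro nn_integral_mono) (use * in \<open>auto split: split_indicator\<close>)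
  also have "\<dots> = 2 * L2_norm_sq f + 2 * L2_norm_sq h"
    by (simp add: nn_integral_add nn_integral_cmult L2_norm_sq_shift[OF per] mult.assoc)
  finally show ?thesis
    by (simp add: distrib_left)
qed

section \<open>Calculus rules for primitives\<close>

lemma set_integral_Icc_combine:
  fixes h :: "real \<Rightarrow> 'a::euclidean_space"
  assumes "set_integrable lborel {a..c} h" "a \<le> b" "b \<le> c"
  shows "(LBINT u:{a..c}. h u) = (LBINT u:{a..b}. h u) + (LBINT u:{b..c}. h u)"
proof -
  have "(LBINT u:{a..b} \<union> {b..c}. h u) = (LBINT u:{a..b}. h u) + (LBINT u:{b..c}. h u)"
  proof (rule set_integral_Un_AE)
    show "AE u in lborel. \<not> (u \<in> {a..b} \<and> u \<in> {b..c})"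
      using AE_lborel_singleton[of b] by eventually_elim auto
    show "set_integrable lborel {a..b} h" "set_integrable lborel {b..c} h"
      using assms by (auto intro: set_integrable_subset)
  qed auto
  then show ?thesis
    using assms by (simp add: ivl_disj_un_two_touch)
qed

text \<open>
  The error \<open>G b - G a - \<integral> k\<close> is additive in the interval, and so is the integral of \<open>A\<close>. If the error is
  locally below \<open>e\<close> times that integral, a bisection argument makes this global, and \<open>e\<close> may tend to 0.
  All rules for primitives are derived in this way, without differentiation almost everywhere.
\<close>
lemma primitive_of_local:
  fixes G k :: "real \<Rightarrow> 'a::euclidean_space" and A :: "real \<Rightarrow> real"
  assumes k: "\<And>a b. a \<le> b \<Longrightarrow> set_integrable lborel {a..b} k"
    and A: "\<And>a b. a \<le> b \<Longrightarrow> set_integrable lborel {a..b} A"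
    and loc: "\<And>x e. e > 0 \<Longrightarrow> \<exists>d>0. \<forall>a b. a \<le> x \<longrightarrow> x \<le> b \<longrightarrow> b - a < d \<longrightarrow>
        norm (G b - G a - (LBINT u:{a..b}. k u)) \<le> e * (LBINT u:{a..b}. A u)"
  shows "primitive_of G k"
  unfolding primitive_of_def
proof (intro allI impI conjI k)
  fix a b :: real assume "a \<le> b"
  have le: "norm (G b - G a - (LBINT u:{a..b}. k u)) \<le> e * (LBINT u:{a..b}. A u)"
    if "e > 0" for e
  proof -
    have "a \<le> b \<and> norm (G b - G a - (LBINT u:{a..b}. k u)) \<le> e * (LBINT u:{a..b}. A u)"
      using \<open>a \<le> b\<close>
    proof (induction a b rule: Bolzano)
      case (trans a b c)
      have "G c - G a - (LBINT u:{a..c}. k u)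
          = (G b - G a - (LBINT u:{a..b}. k u)) + (G c - G b - (LBINT u:{b..c}. k u))"
        using trans by (subst set_integral_Icc_combine[of a c k b]) (auto intro: k)
      then have "norm (G c - G a - (LBINT u:{a..c}. k u))
          \<le> norm (G b - G a - (LBINT u:{a..b}. k u)) + norm (G c - G b - (LBINT u:{b..c}. k u))"
        by (metis norm_triangle_ineq)
      also have "\<dots> \<le> e * (LBINT u:{a..b}. A u) + e * (LBINT u:{b..c}. A u)"
        using trans by auto
      also have "\<dots> = e * (LBINT u:{a..c}. A u)"
        using trans by (subst set_integral_Icc_combine[of a c A b]) (auto intro: A simp: distrib_left)
      finally show ?case using trans by auto
    next
      case (local x)
      then show ?case using loc[OF that, of x] by force
    qed
    then show ?thesis by blast
  qed
  let ?E = "norm (G b - G a - (LBINT u:{a..b}. k u))" and ?I = "LBINT u:{a..b}. A u"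
  have "?E \<le> 0 + e" if "e > 0" for e
  proof -
    have "?E \<le> (e / (\<bar>?I\<bar> + 1)) * ?I"
      by (rule le) (use that in auto)
    also have "\<dots> \<le> (e / (\<bar>?I\<bar> + 1)) * (\<bar>?I\<bar> + 1)"
      by (rule mult_left_mono) (use that in auto)
    finally show ?thesis by simp
  qed
  then have "?E \<le> 0" by (rule field_le_epsilon)
  then show "(LBINT u:{a..b}. k u) = G b - G a" by simp
qed


lemma set_integrable_bilinear:
  fixes prod :: "'c::euclidean_space \<Rightarrow> 'a::euclidean_space \<Rightarrow> 'b::euclidean_space"
    and c :: "real \<Rightarrow> 'c" and h :: "real \<Rightarrow> 'a"
  assumes bil: "bounded_bilinear prod" and c: "continuous_on UNIV c"
    and h: "set_integrable lborel {a..b} h" and [measurable]: "h \<in> borel_measurable borel"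
  shows "set_integrable lborel {a..b} (\<lambda>t. prod (c t) (h t))"
proof -
  interpret bounded_bilinear prod by fact
  obtain K where K: "\<And>a b. norm (prod a b) \<le> norm a * norm b * K" "K > 0"
    using pos_bounded by blast
  have "compact (c ` {a..b})"
    using c by (intro compact_continuous_image compact_Icc) (auto intro: continuous_on_subset)
  then obtain M where M: "\<And>t. t \<in> {a..b} \<Longrightarrow> norm (c t) \<le> M"
    using compact_imp_bounded bounded_iff by (metis imageI)
  have [measurable]: "c \<in> borel_measurable borel"
    using c by (rule borel_measurable_continuous_onI)
  have [measurable]: "(\<lambda>t. prod (c t) (h t)) \<in> borel_measurable borel"
    by (rule borel_measurable_continuous_Pair) (auto intro!: continuous_intros continuous_on)
  have le: "norm (prod (c t) (h t)) \<le> norm ((M * K) * norm (h t))" if "t \<in> {a..b}" for t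
  proof -
    have "norm (prod (c t) (h t)) \<le> norm (c t) * norm (h t) * K" by (rule K)
    also have "\<dots> \<le> M * norm (h t) * K"
      by (intro mult_right_mono M that) (use K in auto)
    finally show ?thesis using abs_ge_self[of "M * K * norm (h t)"] by (simp add: mult_ac)
  qed
  show ?thesis
    unfolding set_integrable_def
  proof (rule Bochner_Integration.integrable_bound)
    show "integrable lborel (\<lambda>t. (M * K) * (norm (indicator {a..b} t *\<^sub>R h t)))"
      using h unfolding set_integrable_def by (intro integrable_mult_right integrable_norm)
    show "AE t in lborel. norm (indicator {a..b} t *\<^sub>R prod (c t) (h t))
        \<le> norm (M * K * norm (indicator {a..b} t *\<^sub>R h t))"
      using le by (auto split: split_indicator)
  qed auto
qed

text \<open>
  Where \<open>S\<close> is close to its value on the diagonal, both the secant expression and the integral are close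
  to the increment of \<open>f\<close> multiplied by that one value.
\<close>
lemma secant_local:
  fixes prod :: "'c::euclidean_space \<Rightarrow> 'a::euclidean_space \<Rightarrow> 'b::euclidean_space"
  assumes bil: "bounded_bilinear prod" and prim: "primitive_of f h"
    and meas: "h \<in> borel_measurable borel"
    and S: "continuous_on UNIV (\<lambda>(x, y). S x y)" and "e > 0"
  shows "\<exists>d>0. \<forall>a b. a \<le> x \<longrightarrow> x \<le> b \<longrightarrow> b - a < d \<longrightarrow>
     norm (prod (S a b) (f b - f a) - (LBINT t:{a..b}. prod (S t t) (h t)))
       \<le> e * (LBINT t:{a..b}. norm (h t))"
proof -
  interpret bounded_bilinear prod by fact
  obtain K where K: "\<And>a b. norm (prod a b) \<le> norm a * norm b * K" "K > 0"
    using pos_bounded by blast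
  have "isCont (\<lambda>(x, y). S x y) (x, x)"
    using S by (simp add: continuous_on_eq_continuous_at)
  moreover have "e / (2 * K) > 0" using \<open>e > 0\<close> K by simp
  ultimately obtain d where d: "d > 0"
    "\<And>p. dist p (x, x) < d \<Longrightarrow> dist (case p of (x, y) \<Rightarrow> S x y) (S x x) < e / (2 * K)"
    unfolding continuous_at_eps_delta by (metis case_prod_conv)
  have S_close: "norm (S y z - S x x) \<le> e / (2 * K)" if "\<bar>y - x\<bar> < d / 2" "\<bar>z - x\<bar> < d / 2" for y z
  proof -
    have "dist (y, z) (x, x) \<le> \<bar>y - x\<bar> + \<bar>z - x\<bar>"
      unfolding dist_prod_def by (simp add: dist_real_def) (rule sqrt_sum_squares_le_sum_abs)
    then show ?thesis using d(2)[of "(y, z)"] that by (simp add: dist_norm)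
  qed
  have cont: "continuous_on UNIV (\<lambda>t. S t t)"
    using continuous_on_compose2[OF S, of UNIV "\<lambda>t. (t, t)"]
      continuous_on_Pair[OF continuous_on_id continuous_on_id, of UNIV] by auto
  show ?thesis
  proof (intro exI[of _ "d / 2"] conjI allI impI)
    show "d / 2 > 0" using d by simp
    fix a b assume ab: "a \<le> x" "x \<le> b" "b - a < d / 2"
    then have h: "set_integrable lborel {a..b} h" "(LBINT u:{a..b}. h u) = f b - f a"
      using primitive_ofD[OF prim, of a b] by auto
    have I1: "set_integrable lborel {a..b} (\<lambda>t. prod (S t t) (h t))"
      by (rule set_integrable_bilinear[OF bil cont h(1) meas])
    have I2: "set_integrable lborel {a..b} (\<lambda>t. prod (S x x) (h t))"
      by (rule set_integrable_bilinear[OF bil _ h(1) meas]) simp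
    have "prod (S x x) (f b - f a) = (LBINT t:{a..b}. prod (S x x) (h t))"
      unfolding h(2)[symmetric] set_lebesgue_integral_def
      using h(1) integral_bounded_linear[OF bounded_linear_right, of lborel "\<lambda>t. indicator {a..b} t *\<^sub>R h t" "S x x"]
      by (simp add: set_integrable_def scaleR_right)
    then have "prod (S a b) (f b - f a) - (LBINT t:{a..b}. prod (S t t) (h t))
       = prod (S a b - S x x) (f b - f a) - (LBINT t:{a..b}. prod (S t t) (h t) - prod (S x x) (h t))"
      by (simp add: set_integral_diff(2)[OF I1 I2] diff_left)
    moreover have "norm (prod (S a b - S x x) (f b - f a)) \<le> e / 2 * (LBINT t:{a..b}. norm (h t))"
    proof -
      have "norm (prod (S a b - S x x) (f b - f a)) \<le> norm (S a b - S x x) * norm (f b - f a) * K"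
        by (rule K)
      also have "\<dots> \<le> e / (2 * K) * (LBINT t:{a..b}. norm (h t)) * K"
        using ab K by (intro mult_right_mono mult_mono S_close primitive_of_norm_le[OF prim])
          (use \<open>e > 0\<close> in auto)
      finally show ?thesis using K by simp
    qed
    moreover have "norm (LBINT t:{a..b}. prod (S t t) (h t) - prod (S x x) (h t))
        \<le> e / 2 * (LBINT t:{a..b}. norm (h t))"
    proof -
      have D: "set_integrable lborel {a..b} (\<lambda>t. prod (S t t) (h t) - prod (S x x) (h t))"
        by (rule set_integral_diff(1)[OF I1 I2])
      have "norm (LBINT t:{a..b}. prod (S t t) (h t) - prod (S x x) (h t))
          \<le> (LBINT t:{a..b}. norm (prod (S t t) (h t) - prod (S x x) (h t)))"
        by (rule set_integral_norm_bound[OF D])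
      also have "\<dots> \<le> (LBINT t:{a..b}. e / 2 * norm (h t))"
      proof (rule set_integral_mono)
        show "set_integrable lborel {a..b} (\<lambda>t. norm (prod (S t t) (h t) - prod (S x x) (h t)))"
          using D by (rule set_integrable_norm)
        show "set_integrable lborel {a..b} (\<lambda>t. e / 2 * norm (h t))"
          using h(1) by (intro set_integrable_mult_right set_integrable_norm) auto
        fix t assume "t \<in> {a..b}"
        then have "norm (S t t - S x x) \<le> e / (2 * K)"
          using ab by (intro S_close) (auto simp: abs_if)
        then have "norm (prod (S t t - S x x) (h t)) \<le> e / (2 * K) * norm (h t) * K"
          by (intro order_trans[OF K(1)] mult_right_mono) (use K in auto)
        then show "norm (prod (S t t) (h t) - prod (S x x) (h t)) \<le> e / 2 * norm (h t)"
          using K by (simp add: diff_left)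
      qed
      finally show ?thesis by simp
    qed
    ultimately show "norm (prod (S a b) (f b - f a) - (LBINT t:{a..b}. prod (S t t) (h t)))
       \<le> e * (LBINT t:{a..b}. norm (h t))"
      using norm_triangle_ineq4[of "prod (S a b - S x x) (f b - f a)"] by (smt (verit) field_sum_of_halves ring_class.ring_distribs(2))
  qed
qed

text \<open>
  A chain rule: an increment of \<open>G\<close> is an increment of \<open>f\<close> times a continuous secant slope, and the slope
  on the diagonal is the derivative. Division and the Euclidean norm have explicit secant slopes.
\<close>
lemma primitive_of_secant:
  fixes prod :: "'c::euclidean_space \<Rightarrow> 'a::euclidean_space \<Rightarrow> 'b::euclidean_space"
  assumes bil: "bounded_bilinear prod" and prim: "primitive_of f h"
    and meas: "h \<in> borel_measurable borel"
    and S: "continuous_on UNIV (\<lambda>(x, y). S x y)"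
    and G: "\<And>x y. G y - G x = prod (S x y) (f y - f x)"
  shows "primitive_of G (\<lambda>t. prod (S t t) (h t))"
proof (rule primitive_of_local[where A = "\<lambda>t. norm (h t)"])
  have "continuous_on UNIV (\<lambda>t. S t t)"
    using continuous_on_compose2[OF S, of UNIV "\<lambda>t. (t, t)"]
      continuous_on_Pair[OF continuous_on_id continuous_on_id, of UNIV] by auto
  then show "set_integrable lborel {a..b} (\<lambda>t. prod (S t t) (h t))" if "a \<le> b" for a b
    using primitive_ofD(1)[OF prim that] meas by (intro set_integrable_bilinear[OF bil])
  show "set_integrable lborel {a..b} (\<lambda>t. norm (h t))" if "a \<le> b" for a b
    using primitive_ofD(1)[OF prim that] by (rule set_integrable_norm)
qed (use secant_local[OF bil prim meas S] G in simp)

text \<open>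
  The product rule, hence integration by parts. The increment of the product splits into
  \<open>p b *\<^sub>R (f b - f a)\<close> and \<open>(p b - p a) *\<^sub>R f a\<close>, and each part is controlled by \<open>secant_local\<close>.
\<close>
lemma primitive_of_mult:
  fixes f h :: "real \<Rightarrow> 'a::euclidean_space" and p k :: "real \<Rightarrow> real"
  assumes f: "primitive_of f h" "h \<in> borel_measurable borel"
    and p: "primitive_of p k" "k \<in> borel_measurable borel"
  shows "primitive_of (\<lambda>t. p t *\<^sub>R f t) (\<lambda>t. p t *\<^sub>R h t + k t *\<^sub>R f t)"
proof (rule primitive_of_local[where A = "\<lambda>t. norm (h t) + norm (k t)"])
  have c: "continuous_on UNIV f" "continuous_on UNIV p"
    using f p by (auto intro: primitive_of_continuous)
  have Sf: "continuous_on UNIV (\<lambda>(x, y). p y)" for x :: real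
    using c(2) by (auto simp: case_prod_beta intro!: continuous_on_compose2[OF c(2)] continuous_intros)
  have Sp: "continuous_on UNIV (\<lambda>(x, y). f x)" for x :: real
    using c(1) by (auto simp: case_prod_beta intro!: continuous_on_compose2[OF c(1)] continuous_intros)
  have bil': "bounded_bilinear (\<lambda>v c. c *\<^sub>R v :: 'a)"
    by (rule bounded_bilinear.flip[OF bounded_bilinear_scaleR])
  have i1: "set_integrable lborel {a..b} (\<lambda>t. p t *\<^sub>R h t)" if "a \<le> b" for a b
    using primitive_ofD(1)[OF f(1) that] f(2) c
    by (intro set_integrable_bilinear[OF bounded_bilinear_scaleR])
  have i2: "set_integrable lborel {a..b} (\<lambda>t. k t *\<^sub>R f t)" if "a \<le> b" for a b
    using primitive_ofD(1)[OF p(1) that] p(2) c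
    by (intro set_integrable_bilinear[OF bil'])
  show "set_integrable lborel {a..b} (\<lambda>t. p t *\<^sub>R h t + k t *\<^sub>R f t)" if "a \<le> b" for a b
    using i1[OF that] i2[OF that] by (rule set_integral_add)
  have n1: "set_integrable lborel {a..b} (\<lambda>t. norm (h t))"
    and n2: "set_integrable lborel {a..b} (\<lambda>t. norm (k t))" if "a \<le> b" for a b
    using primitive_ofD(1)[OF f(1) that] primitive_ofD(1)[OF p(1) that]
    by (blast intro: set_integrable_norm)+
  then show "set_integrable lborel {a..b} (\<lambda>t. norm (h t) + norm (k t))" if "a \<le> b" for a b
    using that by (intro set_integral_add)
  fix x e :: real assume "e > 0"
  obtain d1 where d1: "d1 > 0" "\<And>a b. a \<le> x \<Longrightarrow> x \<le> b \<Longrightarrow> b - a < d1 \<Longrightarrow>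
     norm (p b *\<^sub>R (f b - f a) - (LBINT t:{a..b}. p t *\<^sub>R h t)) \<le> e * (LBINT t:{a..b}. norm (h t))"
    using secant_local[OF bounded_bilinear_scaleR f Sf \<open>e > 0\<close>, of x] by auto
  obtain d2 where d2: "d2 > 0" "\<And>a b. a \<le> x \<Longrightarrow> x \<le> b \<Longrightarrow> b - a < d2 \<Longrightarrow>
     norm ((p b - p a) *\<^sub>R f a - (LBINT t:{a..b}. k t *\<^sub>R f t)) \<le> e * (LBINT t:{a..b}. norm (k t))"
    using secant_local[OF bil' p Sp \<open>e > 0\<close>, of x] by auto
  show "\<exists>d>0. \<forall>a b. a \<le> x \<longrightarrow> x \<le> b \<longrightarrow> b - a < d \<longrightarrow>
    norm (p b *\<^sub>R f b - p a *\<^sub>R f a - (LBINT u:{a..b}. p u *\<^sub>R h u + k u *\<^sub>R f u))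
      \<le> e * (LBINT u:{a..b}. norm (h u) + norm (k u))"
  proof (intro exI[of _ "min d1 d2"] conjI allI impI)
    show "min d1 d2 > 0" using d1 d2 by simp
    fix a b assume ab: "a \<le> x" "x \<le> b" "b - a < min d1 d2"
    then have "a \<le> b" by simp
    have "p b *\<^sub>R f b - p a *\<^sub>R f a - (LBINT u:{a..b}. p u *\<^sub>R h u + k u *\<^sub>R f u)
       = (p b *\<^sub>R (f b - f a) - (LBINT t:{a..b}. p t *\<^sub>R h t))
       + ((p b - p a) *\<^sub>R f a - (LBINT t:{a..b}. k t *\<^sub>R f t))"
      unfolding set_integral_add(2)[OF i1[OF \<open>a \<le> b\<close>] i2[OF \<open>a \<le> b\<close>]] by (simp add: algebra_simps)
    also have "norm \<dots> \<le> e * (LBINT t:{a..b}. norm (h t)) + e * (LBINT t:{a..b}. norm (k t))"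
      using ab by (intro norm_triangle_mono d1 d2) auto
    also have "\<dots> = e * (LBINT u:{a..b}. norm (h u) + norm (k u))"
      unfolding set_integral_add(2)[OF n1[OF \<open>a \<le> b\<close>] n2[OF \<open>a \<le> b\<close>]] by (simp only: distrib_left)
    finally show "norm (p b *\<^sub>R f b - p a *\<^sub>R f a - (LBINT u:{a..b}. p u *\<^sub>R h u + k u *\<^sub>R f u))
      \<le> e * (LBINT u:{a..b}. norm (h u) + norm (k u))" .
  qed
qed

text \<open>
  Two densities with equal integrals over all compact intervals have equal integrals over all Borel sets,
  because the intervals form a generator that is stable under intersection.
\<close>
lemma primitive_of_unique_AE:
  fixes f h k :: "real \<Rightarrow> 'a::euclidean_space"
  assumes "primitive_of f h" "primitive_of f k"
  shows "AE t in lborel. h t = k t"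
proof -
  have *: "AE t in lborel. t \<in> {- real n..real n} \<longrightarrow> h t = k t" for n
  proof -
    let ?J = "{- real n..real n}"
    let ?h = "\<lambda>t. indicator ?J t *\<^sub>R h t" and ?k = "\<lambda>t. indicator ?J t *\<^sub>R k t"
    have I: "integrable lborel ?h" "integrable lborel ?k"
      using assms primitive_ofD(1)[of f _ "- real n" "real n"] by (auto simp: set_integrable_def)
    have gen: "(borel :: real measure) = sigma UNIV (range (\<lambda>(i, j). {i .. j}))"
      by (rule borel_eq_atLeastAtMost)
    have SI: "set_integrable lborel A ?h" "set_integrable lborel A ?k" if "A \<in> sets borel" for A
      unfolding set_integrable_def
      using that I integrable_mult_indicator[of A lborel ?h] integrable_mult_indicator[of A lborel ?k] by auto
    have Int_stable_Icc: "Int_stable (range (\<lambda>(i, j). {i .. j::real}))"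
      by (auto simp: Int_stable_def)
    have Pow_UNIV_Icc: "range (\<lambda>(i, j). {i .. j::real}) \<subseteq> Pow UNIV"
      by simp
    have total: "(LBINT t:UNIV. ?h t) = (LBINT t:UNIV. ?k t)"
      using primitive_ofD(2)[OF assms(1), of "- real n" "real n"] primitive_ofD(2)[OF assms(2), of "- real n" "real n"]
      by (simp add: set_lebesgue_integral_def)
    have "(LBINT t:A. ?h t) = (LBINT t:A. ?k t)"
      if "A \<in> sigma_sets UNIV (range (\<lambda>(i, j). {i .. j::real}))" for A
      using Int_stable_Icc Pow_UNIV_Icc that
    proof (induction rule: sigma_sets_induct_disjoint[where \<Omega> = UNIV])
      fix A assume "A \<in> range (\<lambda>(i, j). {i .. j::real})"
      then obtain i j where A: "A = {i..j}" by auto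
      let ?a = "max i (- real n)" and ?b = "min j (real n)"
      have "(LBINT t:A. indicator ?J t *\<^sub>R g t) = (LBINT t:{?a..?b}. g t)" for g :: "real \<Rightarrow> 'a"
        unfolding set_lebesgue_integral_def A
        by (intro Bochner_Integration.integral_cong) (auto split: split_indicator)
      moreover have "(LBINT t:{?a..?b}. h t) = (LBINT t:{?a..?b}. k t)"
      proof (cases "?a \<le> ?b")
        case True
        show ?thesis
          using primitive_ofD(2)[OF assms(1) True] primitive_ofD(2)[OF assms(2) True] by simp
      next
        case False
        then have "{?a..?b} = {}" by auto
        then show ?thesis by (simp only:) (simp add: set_lebesgue_integral_def)
      qed
      ultimately show "(LBINT t:A. ?h t) = (LBINT t:A. ?k t)" by simp
    next
      show "(LBINT t:{}. ?h t) = (LBINT t:{}. ?k t)" by (simp add: set_lebesgue_integral_def)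
    next
      fix A assume A: "A \<in> sigma_sets UNIV (range (\<lambda>(i, j). {i .. j::real}))"
        and IH: "(LBINT t:A. ?h t) = (LBINT t:A. ?k t)"
      have Ab: "A \<in> sets borel" using A by (simp add: gen)
      have "(LBINT t:(A \<union> (UNIV - A)). g t) = (LBINT t:A. g t) + (LBINT t:UNIV - A. g t)"
        if "\<And>A. A \<in> sets borel \<Longrightarrow> set_integrable lborel A g" for g :: "real \<Rightarrow> 'a"
        using Ab by (intro set_integral_Un that) auto
      from this[of ?h] this[of ?k] show "(LBINT t:UNIV - A. ?h t) = (LBINT t:UNIV - A. ?k t)"
        using total IH SI by simp
    next
      fix A :: "nat \<Rightarrow> real set"
      assume dis: "disjoint_family A"
        and A: "range A \<subseteq> sigma_sets UNIV (range (\<lambda>(i, j). {i .. j::real}))"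
        and IH: "\<And>i. (LBINT t:A i. ?h t) = (LBINT t:A i. ?k t)"
      have Ab: "A i \<in> sets borel" for i using A by (auto simp: gen)
      have "(LBINT t:(\<Union>i. A i). g t) = (\<Sum>i. LBINT t:A i. g t)"
        if "\<And>A. A \<in> sets borel \<Longrightarrow> set_integrable lborel A g" for g :: "real \<Rightarrow> 'a"
        using Ab dis by (intro lebesgue_integral_countable_add that) (auto simp: disjoint_family_on_def)
      from this[of ?h] this[of ?k] show "(LBINT t:(\<Union>i. A i). ?h t) = (LBINT t:(\<Union>i. A i). ?k t)"
        using IH SI by simp
    qed
    then have "AE t in lborel. ?h t = ?k t"
      by (intro sigma_finite_measure.density_unique_banach[OF sigma_finite_lborel] I) (simp add: gen)
    then show ?thesis by eventually_elim (auto split: if_splits simp: indicator_def)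
  qed
  have "AE t in lborel. \<forall>n. t \<in> {- real n..real n} \<longrightarrow> h t = k t"
    unfolding AE_all_countable using * by blast
  then show ?thesis
  proof eventually_elim
    fix t assume "\<forall>n. t \<in> {- real n..real n} \<longrightarrow> h t = k t"
    moreover obtain n :: nat where "\<bar>t\<bar> \<le> real n" using real_arch_simple by blast
    ultimately show "h t = k t" by (meson abs_le_iff atLeastAtMost_iff minus_le_iff)
  qed
qed

section \<open>Weak derivatives\<close>

lemma continuous_periodic_L2_circle:
  fixes f :: "real \<Rightarrow> 'a::euclidean_space"
  assumes "continuous_on UNIV f" "periodic1 f"
  shows "f \<in> L2_circle"
proof -
  have [measurable]: "f \<in> borel_measurable borel"
    using assms(1) by (rule borel_measurable_continuous_onI)
  have "set_integrable lborel {0..1} (\<lambda>u. (norm (f u))\<^sup>2)"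
    by (rule borel_integrable_atLeastAtMost')
      (auto intro!: continuous_intros continuous_on_subset[OF assms(1)])
  then show ?thesis using assms by (simp add: L2_circle_def)
qed

lemma periodic_bounded:
  fixes f :: "real \<Rightarrow> 'a::euclidean_space"
  assumes "continuous_on UNIV f" "periodic1 f"
  obtains B where "B > 0" "\<And>u. norm (f u) \<le> B"
proof -
  interpret periodic_fun_simple' f by fact
  have "compact (f ` {0..1})"
    by (intro compact_continuous_image compact_Icc continuous_on_subset[OF assms(1)]) auto
  then obtain B where B: "\<And>t. t \<in> {0..1} \<Longrightarrow> norm (f t) \<le> B"
    using compact_imp_bounded bounded_iff by (metis imageI)
  have "norm (f u) \<le> max B 1" for u
  proof -
    have "f u = f (frac u)"
      using plus_of_int[of "frac u" "\<lfloor>u\<rfloor>"] by (simp add: frac_def)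
    moreover have "frac u \<in> {0..1}" by (simp add: less_imp_le frac_lt_1)
    ultimately show ?thesis using B[of "frac u"] by simp
  qed
  then show ?thesis using that[of "max B 1"] by auto
qed

lemma norm_add_sq_le:
  fixes x y :: "'a::real_normed_vector"
  assumes "t > 0"
  shows "(norm (x + y))\<^sup>2 \<le> (1 + t) * (norm x)\<^sup>2 + (1 + 1 / t) * (norm y)\<^sup>2"
proof -
  have "(norm (x + y))\<^sup>2 \<le> (norm x + norm y)\<^sup>2"
    by (intro power_mono norm_triangle_ineq) auto
  also have "\<dots> \<le> (1 + t) * (norm x)\<^sup>2 + (1 + 1 / t) * (norm y)\<^sup>2"
  proof -
    have "0 \<le> (t * norm x - norm y)\<^sup>2 / t" using assms by simp
    also have "\<dots> = t * (norm x)\<^sup>2 + (1 / t) * (norm y)\<^sup>2 - 2 * norm x * norm y"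
      using assms by (simp add: power2_eq_square field_simps)
    finally show ?thesis by (simp add: power2_eq_square algebra_simps)
  qed
  finally show ?thesis .
qed

lemma L2_norm_sq_add_le:
  fixes f g :: "real \<Rightarrow> 'a::euclidean_space"
  assumes [measurable]: "f \<in> borel_measurable borel" "g \<in> borel_measurable borel" and "t > 0"
  shows "L2_norm_sq (\<lambda>u. f u + g u) \<le> ennreal (1 + t) * L2_norm_sq f + ennreal (1 + 1 / t) * L2_norm_sq g"
proof -
  have "L2_norm_sq (\<lambda>u. f u + g u) \<le>
      (\<integral>\<^sup>+ u. ennreal (1 + t) * (ennreal ((norm (f u))\<^sup>2) * indicator {0..1} u)
           + ennreal (1 + 1 / t) * (ennreal ((norm (g u))\<^sup>2) * indicator {0..1} u) \<partial>lborel)"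
    unfolding L2_norm_sq_def
  proof (intro nn_integral_mono)
    fix u
    have "ennreal ((norm (f u + g u))\<^sup>2)
        \<le> ennreal ((1 + t) * (norm (f u))\<^sup>2 + (1 + 1 / t) * (norm (g u))\<^sup>2)"
      by (intro ennreal_leI norm_add_sq_le \<open>t > 0\<close>)
    then show "ennreal ((norm (f u + g u))\<^sup>2) * indicator {0..1} u
      \<le> ennreal (1 + t) * (ennreal ((norm (f u))\<^sup>2) * indicator {0..1} u)
           + ennreal (1 + 1 / t) * (ennreal ((norm (g u))\<^sup>2) * indicator {0..1} u)"
      using \<open>t > 0\<close> by (auto split: split_indicator simp: ennreal_mult[symmetric] ennreal_plus[symmetric] simp del: ennreal_plus)
  qed
  also have "\<dots> = ennreal (1 + t) * L2_norm_sq f + ennreal (1 + 1 / t) * L2_norm_sq g"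
    unfolding L2_norm_sq_def by (simp add: nn_integral_add nn_integral_cmult)
  finally show ?thesis .
qed

lemma L2_norm_sq_scaleR:
  assumes [measurable]: "f \<in> borel_measurable borel"
  shows "L2_norm_sq (\<lambda>u. c *\<^sub>R f u) = ennreal (c\<^sup>2) * L2_norm_sq f"
  unfolding L2_norm_sq_def
  by (subst nn_integral_cmult[symmetric])
    (auto intro!: nn_integral_cong simp: power_mult_distrib ennreal_mult mult_ac)

lemma L2_circle_add:
  assumes "f \<in> L2_circle" "g \<in> L2_circle"
  shows "(\<lambda>u. f u + g u) \<in> L2_circle"
proof -
  have "L2_norm_sq (\<lambda>u. f u + g u) \<le> ennreal (1 + 1) * L2_norm_sq f + ennreal (1 + 1 / 1) * L2_norm_sq g"
    using assms by (intro L2_norm_sq_add_le) (auto simp: L2_circle_iff)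
  also have "\<dots> < \<infinity>"
    using assms by (auto simp: L2_circle_iff ennreal_mult_less_top)
  finally show ?thesis
    using assms by (auto simp: L2_circle_iff periodic1D intro!: periodic1I)
qed

lemma L2_circle_scaleR:
  assumes "f \<in> L2_circle"
  shows "(\<lambda>u. c *\<^sub>R f u) \<in> L2_circle"
  using assms
  by (auto simp: L2_circle_iff L2_norm_sq_scaleR ennreal_mult_less_top periodic1D intro!: periodic1I)

lemma L2_circle_diff:
  assumes "f \<in> L2_circle" "g \<in> L2_circle"
  shows "(\<lambda>u. f u - g u) \<in> L2_circle"
  using L2_circle_add[OF assms(1) L2_circle_scaleR[OF assms(2), of "-1"]] by simp

lemma test_function_derivative:
  assumes "test_function \<phi>"
  shows "(\<phi> has_real_derivative deriv \<phi> u) (at u)" "continuous_on UNIV (deriv \<phi>)"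
proof -
  have d: "(deriv ^^ k) \<phi> field_differentiable (at u)" for k u
    using assms by (auto simp: test_function_def)
  show "(\<phi> has_real_derivative deriv \<phi> u) (at u)"
    using d[of 0 u] by (simp add: field_differentiable_derivI)
  have "isCont (deriv \<phi>) u" for u
    using d[of 1 u] by (simp add: field_differentiable_imp_continuous_at)
  then show "continuous_on UNIV (deriv \<phi>)"
    by (simp add: continuous_at_imp_continuous_on)
qed

lemma has_weak_derivative_primitive_of:
  assumes prim: "primitive_of f g" and per: "periodic1 f" and g: "g \<in> L2_circle"
  shows "has_weak_derivative f g"
  unfolding has_weak_derivative_def
proof (intro conjI allI impI g)
  have contf: "continuous_on UNIV f" by (rule primitive_of_continuous[OF prim])
  then show "f \<in> L2_circle" by (rule continuous_periodic_L2_circle[OF _ per])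
  fix \<phi> assume \<phi>: "test_function \<phi>"
  note d = test_function_derivative[OF \<phi>]
  have [measurable]: "g \<in> borel_measurable borel" using g by (simp add: L2_circle_iff)
  have [measurable]: "deriv \<phi> \<in> borel_measurable borel"
    using d(2) by (rule borel_measurable_continuous_onI)
  have p\<phi>: "primitive_of \<phi> (deriv \<phi>)"
    using d by (intro primitive_of_derivative) (auto simp: has_real_derivative_iff_has_vector_derivative)
  have c\<phi>: "continuous_on UNIV \<phi>" by (rule primitive_of_continuous[OF p\<phi>])
  have "primitive_of (\<lambda>t. \<phi> t *\<^sub>R f t) (\<lambda>t. \<phi> t *\<^sub>R g t + deriv \<phi> t *\<^sub>R f t)"
    by (rule primitive_of_mult[OF prim _ p\<phi>]) auto
  from primitive_ofD(2)[OF this, of 0 1]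
  have "(LBINT t:{0..1}. \<phi> t *\<^sub>R g t + deriv \<phi> t *\<^sub>R f t) = 0"
    using periodic1D[OF per, of 0] \<phi> periodic1D[of \<phi> 0] by (simp add: test_function_def)
  moreover have "set_integrable lborel {0..1::real} (\<lambda>t. \<phi> t *\<^sub>R g t)"
    by (rule set_integrable_bilinear[OF bounded_bilinear_scaleR c\<phi> L2_circle_set_integrable[OF g]]) auto
  moreover have "set_integrable lborel {0..1::real} (\<lambda>t. deriv \<phi> t *\<^sub>R f t)"
    by (rule borel_integrable_atLeastAtMost')
      (auto intro!: continuous_intros continuous_on_subset[OF contf] continuous_on_subset[OF d(2)])
  ultimately show "(LBINT u:{0..1}. deriv \<phi> u *\<^sub>R f u) = - (LBINT u:{0..1}. \<phi> u *\<^sub>R g u)"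
    by (simp add: set_integral_add(2) eq_neg_iff_add_eq_0 add.commute)
qed

lemma has_weak_derivative_diff:
  assumes "has_weak_derivative f g" "has_weak_derivative f' g'"
  shows "has_weak_derivative (\<lambda>u. f u - f' u) (\<lambda>u. g u - g' u)"
  unfolding has_weak_derivative_def
proof (intro conjI allI impI)
  have L: "f \<in> L2_circle" "g \<in> L2_circle" "f' \<in> L2_circle" "g' \<in> L2_circle"
    using assms by (auto simp: has_weak_derivative_def)
  then show "(\<lambda>u. f u - f' u) \<in> L2_circle" "(\<lambda>u. g u - g' u) \<in> L2_circle"
    by (auto intro: L2_circle_diff)
  fix \<phi> assume \<phi>: "test_function \<phi>"
  note d = test_function_derivative[OF \<phi>]
  have c: "continuous_on UNIV \<phi>"
    using d(1) by (meson DERIV_isCont continuous_at_imp_continuous_on)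
  have I: "set_integrable lborel {0..1::real} (\<lambda>t. q t *\<^sub>R p t)"
    if "continuous_on UNIV q" "p \<in> L2_circle" for q and p :: "real \<Rightarrow> 'a"
    using that by (intro set_integrable_bilinear[OF bounded_bilinear_scaleR that(1)] L2_circle_set_integrable)
      (auto simp: L2_circle_iff)
  have "(LBINT u:{0..1}. deriv \<phi> u *\<^sub>R f u) = - (LBINT u:{0..1}. \<phi> u *\<^sub>R g u)"
    "(LBINT u:{0..1}. deriv \<phi> u *\<^sub>R f' u) = - (LBINT u:{0..1}. \<phi> u *\<^sub>R g' u)"
    using assms \<phi> by (auto simp: has_weak_derivative_def)
  then show "(LBINT u:{0..1}. deriv \<phi> u *\<^sub>R (f u - f' u)) = - (LBINT u:{0..1}. \<phi> u *\<^sub>R (g u - g' u))"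
    by (simp add: scaleR_diff_right set_integral_diff(2) I c d L)
qed

text \<open>
  Trigonometric polynomials supply all test functions that the fundamental lemma requires. They are
  closed under derivatives, so that their smoothness follows by induction, and they contain kernels that
  concentrate at a given point.
\<close>
inductive_set trig_poly :: "(real \<Rightarrow> real) set" where
  const: "(\<lambda>u. c) \<in> trig_poly"
| cos: "(\<lambda>u. cos (2 * pi * u)) \<in> trig_poly"
| sin: "(\<lambda>u. sin (2 * pi * u)) \<in> trig_poly"
| add: "f \<in> trig_poly \<Longrightarrow> g \<in> trig_poly \<Longrightarrow> (\<lambda>u. f u + g u) \<in> trig_poly"
| mult: "f \<in> trig_poly \<Longrightarrow> g \<in> trig_poly \<Longrightarrow> (\<lambda>u. f u * g u) \<in> trig_poly"

lemma trig_poly_derivative: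
  assumes "f \<in> trig_poly"
  shows "\<exists>f'\<in>trig_poly. \<forall>u. (f has_real_derivative f' u) (at u)"
  using assms
proof induction
  case (const c)
  show ?case by (intro bexI[of _ "\<lambda>u. 0"]) (auto intro: trig_poly.const)
next
  case cos
  have "(\<lambda>u. (- 2 * pi) * sin (2 * pi * u)) \<in> trig_poly"
    by (intro trig_poly.intros)
  then show ?case by (rule bexI[rotated]) (auto intro!: derivative_eq_intros)
next
  case sin
  have "(\<lambda>u. (2 * pi) * cos (2 * pi * u)) \<in> trig_poly"
    by (intro trig_poly.intros)
  then show ?case by (rule bexI[rotated]) (auto intro!: derivative_eq_intros)
next
  case (add f g)
  then obtain f' g' where "f' \<in> trig_poly" "g' \<in> trig_poly"
    "\<forall>u. (f has_real_derivative f' u) (at u)" "\<forall>u. (g has_real_derivative g' u) (at u)" by blast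
  then show ?case by (intro bexI[of _ "\<lambda>u. f' u + g' u"]) (auto intro: trig_poly.add DERIV_add)
next
  case (mult f g)
  then obtain f' g' where "f' \<in> trig_poly" "g' \<in> trig_poly"
    "\<forall>u. (f has_real_derivative f' u) (at u)" "\<forall>u. (g has_real_derivative g' u) (at u)" by blast
  then show ?case using mult.hyps
    by (intro bexI[of _ "\<lambda>u. f' u * g u + g' u * f u"]) (auto intro: trig_poly.intros DERIV_mult)
qed

lemma trig_poly_deriv: "f \<in> trig_poly \<Longrightarrow> deriv f \<in> trig_poly"
  using trig_poly_derivative[of f] DERIV_imp_deriv by (metis ext)

lemma trig_poly_deriv_iter: "f \<in> trig_poly \<Longrightarrow> (deriv ^^ k) f \<in> trig_poly"
  by (induction k) (auto intro: trig_poly_deriv)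

lemma trig_poly_differentiable: "f \<in> trig_poly \<Longrightarrow> f field_differentiable (at u)"
  using trig_poly_derivative[of f] by (auto simp: field_differentiable_def)

lemma trig_poly_continuous: "f \<in> trig_poly \<Longrightarrow> continuous_on A f"
  using trig_poly_differentiable[of f]
  by (meson continuous_at_imp_continuous_on field_differentiable_imp_continuous_at)

lemma trig_poly_periodic: "f \<in> trig_poly \<Longrightarrow> f (u + 1) = f u"
  by (induction rule: trig_poly.induct) (auto simp: distrib_left)

lemma trig_poly_power: "f \<in> trig_poly \<Longrightarrow> (\<lambda>u. f u ^ n) \<in> trig_poly"
  by (induction n) (auto intro: trig_poly.intros)

lemma trig_poly_cos_shift: "(\<lambda>u. c + cos (2 * pi * (u - a))) \<in> trig_poly"
proof -
  have "(\<lambda>u. c + (cos (2 * pi * a) * cos (2 * pi * u) + sin (2 * pi * a) * sin (2 * pi * u))) \<in> trig_poly"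
    by (intro trig_poly.intros)
  moreover have "cos (2 * pi * a) * cos (2 * pi * u) + sin (2 * pi * a) * sin (2 * pi * u)
      = cos (2 * pi * (u - a))" for u
    unfolding right_diff_distrib cos_diff by (rule arg_cong2[where f = "(+)"]; rule mult.commute)
  ultimately show ?thesis by simp
qed

lemma trig_poly_test_function: "f \<in> trig_poly \<Longrightarrow> test_function f"
  unfolding test_function_def
  by (auto intro: periodic1I trig_poly_differentiable trig_poly_deriv_iter trig_poly_periodic)

lemma test_function_diff_const:
  assumes "test_function \<psi>"
  shows "test_function (\<lambda>u. \<psi> u - c)"
proof -
  have D: "((\<lambda>u. \<psi> u - c) has_real_derivative deriv \<psi> u) (at u)" for u
    using DERIV_diff[OF test_function_derivative(1)[OF assms] DERIV_const] by simp
  then have eq: "deriv (\<lambda>u. \<psi> u - c) = deriv \<psi>"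
    by (auto intro: DERIV_imp_deriv)
  have "(deriv ^^ k) (\<lambda>u. \<psi> u - c) field_differentiable (at u)" for k u
  proof (cases k)
    case 0
    then show ?thesis using D[of u] by (auto simp: field_differentiable_def)
  next
    case (Suc n)
    have "(deriv ^^ k) (\<lambda>u. \<psi> u - c) = (deriv ^^ k) \<psi>"
      unfolding Suc funpow_Suc_right by (simp add: eq)
    then show ?thesis using assms by (simp add: test_function_def)
  qed
  then show ?thesis
    using assms by (auto simp: test_function_def periodic1D intro: periodic1I)
qed

lemma test_function_antiderivative:
  assumes \<psi>: "test_function \<psi>" and prim: "primitive_of \<phi> \<psi>" and "\<phi> 1 = \<phi> 0"
  shows "test_function \<phi>" "deriv \<phi> = \<psi>"
proof -
  have "continuous_on UNIV \<psi>"
    using test_function_derivative(1)[OF \<psi>] by (meson DERIV_isCont continuous_at_imp_continuous_on)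
  then have D: "(\<phi> has_real_derivative \<psi> u) (at u)" for u
    using primitive_of_continuous_derivative[OF prim]
    by (simp add: has_real_derivative_iff_has_vector_derivative)
  then show deriv: "deriv \<phi> = \<psi>"
    by (auto intro: DERIV_imp_deriv)
  have "(deriv ^^ k) \<phi> field_differentiable (at u)" for k u
  proof (cases k)
    case 0
    then show ?thesis using D[of u] by (auto simp: field_differentiable_def)
  next
    case (Suc n)
    have "(deriv ^^ k) \<phi> = (deriv ^^ n) \<psi>"
      unfolding Suc funpow_Suc_right by (simp add: deriv)
    then show ?thesis using \<psi> by (simp add: test_function_def)
  qed
  moreover have "\<phi> (u + 1) = \<phi> u" for u
  proof -
    have per: "\<psi> (x + 1) = \<psi> x" for x
      using \<psi> by (simp add: test_function_def periodic1D)
    have "((\<lambda>u. \<phi> (u + 1) - \<phi> u) has_real_derivative 0) (at x)" for x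
    proof -
      have "((\<lambda>u. \<phi> (u + 1)) has_real_derivative \<psi> x) (at x)"
        using D[of "x + 1"] DERIV_shift[of \<phi> "\<psi> x" x 1] by (simp add: per)
      from DERIV_diff[OF this D[of x]] show ?thesis by simp
    qed
    then show ?thesis
      using DERIV_isconst_all[of "\<lambda>u. \<phi> (u + 1) - \<phi> u" u 0] \<open>\<phi> 1 = \<phi> 0\<close> by simp
  qed
  ultimately show "test_function \<phi>"
    by (auto simp: test_function_def intro: periodic1I)
qed

lemma cos_2pi_antimono:
  assumes "0 \<le> x" "x \<le> y" "y \<le> 1 / 2"
  shows "cos (2 * pi * y) \<le> cos (2 * pi * x)"
proof (rule cos_monotone_0_pi_le)
  show "2 * pi * y \<le> pi"
    using mult_left_mono[OF assms(3), of "2 * pi"] by simp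
qed (use assms in auto)

lemma cos_2pi_abs: "cos (2 * pi * \<bar>x\<bar>) = cos (2 * pi * x)"
  by (cases "x \<ge> 0") auto

text \<open>
  If \<open>q a > 0\<close>, then \<open>q\<close> is bounded below by some \<open>m > 0\<close> on the interval of radius \<open>d\<close> around \<open>a\<close>.
  The kernel \<open>k u = 1 - cos (2 * pi * d) + cos (2 * pi * (u - a))\<close> is at least 1 there, at least a constant
  \<open>\<kappa> > 1\<close> on the interval of radius \<open>d / 2\<close>, and is at most 1 in absolute value elsewhere. Hence the
  integrals of \<open>k ^ n * q\<close> tend to infinity, which contradicts orthogonality.
\<close>
lemma orthogonal_trig_poly_nonpos:
  fixes q :: "real \<Rightarrow> real"
  assumes cont: "continuous_on UNIV q" and orth: "\<And>\<psi>. \<psi> \<in> trig_poly \<Longrightarrow> (LBINT u:{0..1}. \<psi> u * q u) = 0"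
    and a: "0 < a" "a < 1"
  shows "q a \<le> 0"
proof (rule ccontr)
  assume "\<not> q a \<le> 0"
  define m where "m = q a / 2"
  have m: "m > 0" using \<open>\<not> q a \<le> 0\<close> by (simp add: m_def)
  have "isCont q a" using cont by (simp add: continuous_on_eq_continuous_at)
  then obtain d0 where d0: "d0 > 0" "\<And>u. \<bar>u - a\<bar> < d0 \<Longrightarrow> \<bar>q u - q a\<bar> < m"
    unfolding continuous_at_eps_delta dist_real_def using m by metis
  \<comment> \<open>The bound by \<open>1/4\<close> keeps \<open>2 * pi * d\<close> in the range where the cosine is decreasing.\<close>
  define d where "d = Min {d0 / 2, a / 2, (1 - a) / 2, 1 / 4}"
  have d: "d > 0" "d < d0" "d < a" "d < 1 - a" "d \<le> 1 / 4"
  proof -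
    have "d \<le> d0 / 2" "d \<le> a / 2" "d \<le> (1 - a) / 2" "d \<le> 1 / 4"
      unfolding d_def by (rule Min_le; simp)+
    moreover have "d > 0" using d0(1) a by (auto simp: d_def)
    ultimately show "d > 0" "d < d0" "d < a" "d < 1 - a" "d \<le> 1 / 4"
      using d0(1) a by auto
  qed
  define k where "k u = 1 - cos (2 * pi * d) + cos (2 * pi * (u - a))" for u
  define \<kappa> where "\<kappa> = 1 - cos (2 * pi * d) + cos (pi * d)"
  have k_in: "k u \<ge> 1" if "\<bar>u - a\<bar> \<le> d" for u
    using cos_2pi_antimono[of "\<bar>u - a\<bar>" d] that d unfolding cos_2pi_abs k_def by simp
  have k_in2: "k u \<ge> \<kappa>" if "\<bar>u - a\<bar> \<le> d / 2" for u
    using cos_2pi_antimono[of "\<bar>u - a\<bar>" "d / 2"] that d unfolding cos_2pi_abs k_def \<kappa>_def by simp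
  have \<kappa>: "\<kappa> > 1"
  proof -
    have "2 * pi * d \<le> pi"
      using mult_left_mono[of d "1 / 2" "2 * pi"] d by simp
    then have "cos (2 * pi * d) < cos (pi * d)"
      using d by (intro cos_monotone_0_pi) auto
    then show ?thesis by (simp add: \<kappa>_def)
  qed
  have k_out: "\<bar>k u\<bar> \<le> 1" if u: "u \<in> {0..1}" "\<not> \<bar>u - a\<bar> \<le> d" for u
  proof -
    have le: "cos (2 * pi * \<bar>u - a\<bar>) \<le> cos (2 * pi * d)"
    proof (cases "\<bar>u - a\<bar> \<le> 1 / 2")
      case True
      then show ?thesis using u d by (intro cos_2pi_antimono) auto
    next
      case False
      have "\<bar>u - a\<bar> \<le> 1 - d" using u d a by (auto simp: abs_if)
      then have "cos (2 * pi * (1 - \<bar>u - a\<bar>)) \<le> cos (2 * pi * d)"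
        using d False by (intro cos_2pi_antimono) auto
      moreover have "cos (2 * pi * (1 - \<bar>u - a\<bar>)) = cos (2 * pi * \<bar>u - a\<bar>)"
        unfolding right_diff_distrib cos_diff by simp
      ultimately show ?thesis by simp
    qed
    then have "cos (2 * pi * (u - a)) \<le> cos (2 * pi * d)" unfolding cos_2pi_abs .
    moreover have "cos (2 * pi * d) \<le> 1" "- 1 \<le> cos (2 * pi * (u - a))" by auto
    ultimately show ?thesis
      unfolding k_def abs_le_iff by linarith
  qed
  obtain B where B: "B \<ge> 0" "\<And>u. u \<in> {0..1} \<Longrightarrow> \<bar>q u\<bar> \<le> B"
  proof -
    have "compact (q ` {0..1})"
      by (intro compact_continuous_image compact_Icc continuous_on_subset[OF cont]) auto
    then obtain B where "\<And>t. t \<in> {0..1} \<Longrightarrow> norm (q t) \<le> B"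
      using compact_imp_bounded bounded_iff by (metis imageI)
    then show ?thesis using that[of "max B 0"] by (auto simp: le_max_iff_disj)
  qed
  have kT: "k \<in> trig_poly" unfolding k_def by (rule trig_poly_cos_shift)
  have bound: "\<kappa> ^ n * m * d - B \<le> 0" for n
  proof -
    have T: "(\<lambda>u. k u ^ n) \<in> trig_poly" by (rule trig_poly_power[OF kT])
    let ?l = "\<lambda>u. \<kappa> ^ n * m * indicator {a - d / 2..a + d / 2} u - B * indicator {0..1} u :: real"
    have "integrable lborel ?l" by (intro Bochner_Integration.integrable_diff integrable_mult_right integrable_real_indicator)
        (auto simp: emeasure_lborel_Icc_eq)
    have "\<kappa> ^ n * m * d - B = integral\<^sup>L lborel ?l"
      using d by (subst Bochner_Integration.integral_diff) auto
    also have "\<dots> \<le> (LBINT u:{0..1}. k u ^ n * q u)"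
      unfolding set_lebesgue_integral_def
    proof (rule integral_mono)
      show "integrable lborel (\<lambda>u. indicat_real {0..1} u *\<^sub>R (k u ^ n * q u))"
        using borel_integrable_atLeastAtMost'[of 0 1 "\<lambda>u. k u ^ n * q u"]
        by (simp add: set_integrable_def continuous_intros trig_poly_continuous[OF T] continuous_on_subset[OF cont])
      fix u :: real
      consider "u \<notin> {0..1}" | "u \<in> {0..1}" "\<bar>u - a\<bar> \<le> d / 2"
        | "u \<in> {0..1}" "\<bar>u - a\<bar> \<le> d" "\<not> \<bar>u - a\<bar> \<le> d / 2" | "u \<in> {0..1}" "\<not> \<bar>u - a\<bar> \<le> d" by blast
      then show "?l u \<le> indicat_real {0..1} u *\<^sub>R (k u ^ n * q u)"
      proof cases
        case 1
        then have "u \<notin> {a - d / 2..a + d / 2}" using d by auto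
        then show ?thesis using 1 by simp
      next
        case 2
        then have "u \<in> {a - d / 2..a + d / 2}" unfolding atLeastAtMost_iff by linarith
        moreover have "q u \<ge> m"
          using d0(2)[of u] 2 d unfolding m_def by linarith
        then have "\<kappa> ^ n * m \<le> k u ^ n * q u"
          using k_in2[OF 2(2)] \<kappa> m by (intro mult_mono power_mono) auto
        ultimately show ?thesis using 2 B by simp
      next
        case 3
        then have "u \<notin> {a - d / 2..a + d / 2}" unfolding atLeastAtMost_iff by linarith
        moreover have "q u \<ge> m"
          using d0(2)[of u] 3 d unfolding m_def by linarith
        then have "0 \<le> k u ^ n * q u"
          using k_in[OF 3(2)] m by (intro mult_nonneg_nonneg) auto
        ultimately show ?thesis using 3 B by simp
      next
        case 4
        then have "u \<notin> {a - d / 2..a + d / 2}" using d unfolding atLeastAtMost_iff by linarith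
        moreover have "\<bar>k u ^ n * q u\<bar> \<le> 1 * B"
          unfolding abs_mult power_abs using k_out[OF 4] B(2)[OF 4(1)]
          by (intro mult_mono power_le_one) auto
        ultimately show ?thesis using 4 by (simp add: abs_le_iff)
      qed
    qed fact
    also have "\<dots> = 0" by (rule orth[OF T])
    finally show ?thesis .
  qed
  obtain n where "\<kappa> ^ n > B / (m * d)"
    using real_arch_pow[OF \<kappa>] by blast
  then have "\<kappa> ^ n * m * d > B" using m d by (simp add: field_simps)
  then show False using bound[of n] by simp
qed

lemma set_integral_scaleR_const:
  assumes "set_integrable M A f"
  shows "(LINT t:A|M. f t *\<^sub>R c) = (LINT t:A|M. f t) *\<^sub>R c"
  using assms integral_scaleR_left[of c M "\<lambda>t. indicator A t *\<^sub>R f t"]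
  unfolding set_lebesgue_integral_def set_integrable_def by simp

text \<open>
  A test function minus its mean value is the derivative of a periodic test function, and against that one
  the weak derivative 0 can be inserted.
\<close>
lemma weak_derivative_zero_orthogonal:
  fixes p :: "real \<Rightarrow> 'a::euclidean_space"
  assumes w: "has_weak_derivative p (\<lambda>u. 0)" and \<psi>: "test_function \<psi>"
  shows "(LBINT t:{0..1}. \<psi> t *\<^sub>R (p t - (LBINT u:{0..1}. p u))) = 0"
proof -
  define c where "c = (LBINT u:{0..1}. p u)"
  have L: "p \<in> L2_circle" using w by (simp add: has_weak_derivative_def)
  have c\<psi>: "continuous_on UNIV \<psi>"
    using test_function_derivative(1)[OF \<psi>] by (meson DERIV_isCont continuous_at_imp_continuous_on)
  have Ip: "set_integrable lborel {0..1::real} (\<lambda>t. \<psi> t *\<^sub>R p t)" if "continuous_on UNIV \<psi>" for \<psi>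
    using L by (intro set_integrable_bilinear[OF bounded_bilinear_scaleR that] L2_circle_set_integrable)
      (auto simp: L2_circle_iff)
  define m where "m = (LBINT u:{0..1}. \<psi> u)"
  have I\<psi>: "set_integrable lborel {a..b} \<psi>" for a b :: real
    by (rule borel_integrable_atLeastAtMost') (rule continuous_on_subset[OF c\<psi>], simp)
  have I1: "set_integrable lborel {a..b} (\<lambda>u. \<psi> u - m)" for a b :: real
    by (intro borel_integrable_atLeastAtMost' continuous_intros continuous_on_subset[OF c\<psi>]) simp
  define \<phi> where "\<phi> x = 0 + (LBINT u=ereal 0..ereal x. \<psi> u - m)" for x
  have prim: "primitive_of \<phi> (\<lambda>u. \<psi> u - m)"
    unfolding \<phi>_def by (rule primitive_of_ext[where c = 0]) (auto simp: I1 zero_ereal_def)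
  have "\<phi> 1 - \<phi> 0 = (LBINT u:{0..1}. \<psi> u - m)"
    using primitive_ofD(2)[OF prim, of 0 1] by simp
  also have "\<dots> = m - (LBINT u:{0..1::real}. m)"
    by (subst set_integral_diff) (auto simp: m_def I\<psi> intro: borel_integrable_atLeastAtMost')
  also have "\<dots> = 0" by (simp add: set_lebesgue_integral_def)
  finally have "\<phi> 1 = \<phi> 0" by simp
  note \<phi> = test_function_antiderivative[OF test_function_diff_const[OF \<psi>] prim this]
  have "(LBINT u:{0..1}. (\<psi> u - m) *\<^sub>R p u) = 0"
    using w \<phi> by (auto simp: has_weak_derivative_def set_lebesgue_integral_def)
  then have "(LBINT u:{0..1}. \<psi> u *\<^sub>R p u) - (LBINT u:{0..1}. m *\<^sub>R p u) = 0"
    by (simp add: scaleR_diff_left set_integral_diff(2) Ip c\<psi>)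
  moreover have "(LBINT u:{0..1}. m *\<^sub>R p u) = (LBINT u:{0..1}. \<psi> u *\<^sub>R c)"
    by (simp add: m_def set_integral_scaleR_const I\<psi> flip: c_def)
  moreover have "set_integrable lborel {0..1::real} (\<lambda>u. \<psi> u *\<^sub>R c)"
    by (intro borel_integrable_atLeastAtMost' continuous_intros continuous_on_subset[OF c\<psi>]) simp
  ultimately have "(LBINT t:{0..1}. \<psi> t *\<^sub>R (p t - c)) = 0"
    by (simp add: scaleR_diff_right set_integral_diff(2) Ip c\<psi>)
  then show ?thesis by (simp add: c_def)
qed

lemma weak_derivative_zero_imp_const:
  fixes p :: "real \<Rightarrow> 'a::euclidean_space"
  assumes cont: "continuous_on UNIV p" and w: "has_weak_derivative p (\<lambda>u. 0)"
  shows "p x = p 0"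
proof -
  have per: "periodic1 p" using w by (simp add: has_weak_derivative_def L2_circle_iff)
  interpret periodic_fun_simple' p by fact
  define c where "c = (LBINT u:{0..1}. p u)"
  have orth: "(LBINT u:{0..1}. \<psi> u *\<^sub>R (p u - c)) = 0" if \<psi>: "\<psi> \<in> trig_poly" for \<psi>
    unfolding c_def by (rule weak_derivative_zero_orthogonal[OF w trig_poly_test_function[OF \<psi>]])
  have eq_c: "p a = c" if a: "0 < a" "a < 1" for a
  proof (rule euclidean_eqI)
    fix b :: 'a assume "b \<in> Basis"
    have orth_b: "(LBINT u:{0..1}. \<psi> u * (s * ((p u - c) \<bullet> b))) = 0" if \<psi>: "\<psi> \<in> trig_poly" for \<psi> s
    proof -
      have I: "set_integrable lborel {0..1::real} (\<lambda>u. \<psi> u *\<^sub>R (p u - c))"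
        by (intro borel_integrable_atLeastAtMost' continuous_intros trig_poly_continuous[OF \<psi>]
          continuous_on_subset[OF cont]) auto
      have "(LBINT u:{0..1}. (\<psi> u *\<^sub>R (p u - c)) \<bullet> (s *\<^sub>R b)) = (LBINT u:{0..1}. \<psi> u *\<^sub>R (p u - c)) \<bullet> (s *\<^sub>R b)"
        using I integral_bounded_linear[OF bounded_linear_inner_left, of lborel "\<lambda>t. indicator {0..1} t *\<^sub>R (\<psi> t *\<^sub>R (p t - c))" "s *\<^sub>R b"]
        unfolding set_lebesgue_integral_def set_integrable_def by (simp only: inner_scaleR_left real_scaleR_def)
      then show ?thesis using orth[OF \<psi>] by (simp add: mult_ac)
    qed
    have cont_b: "continuous_on UNIV (\<lambda>u. s * ((p u - c) \<bullet> b))" for s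
      by (intro continuous_intros cont)
    have "1 * ((p a - c) \<bullet> b) \<le> 0" "(-1) * ((p a - c) \<bullet> b) \<le> 0"
      by (rule orthogonal_trig_poly_nonpos[OF cont_b orth_b a]; assumption)+
    then show "p a \<bullet> b = c \<bullet> b" by (simp add: inner_diff_left)
  qed
  have "continuous_on (closure {0<..<1}) p"
    using cont continuous_on_subset by blast
  then have eq_c': "p a = c" if "a \<in> {0..1}" for a
    using continuous_constant_on_closure[of "{0<..<1}" p c a] eq_c that by auto
  have "p y = c" for y
  proof -
    have "frac y \<in> {0..1}" by (simp add: less_imp_le frac_lt_1)
    then have "p (frac y) = c" by (rule eq_c')
    moreover have "p (frac y + of_int \<lfloor>y\<rfloor>) = p (frac y)" by (rule plus_of_int)
    ultimately show ?thesis by (simp add: frac_def)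
  qed
  then show ?thesis by simp
qed

text \<open>
  Testing with the constant 1 shows that \<open>g\<close> has mean 0.
\<close>
lemma weak_derivative_periodic_primitive:
  fixes f g :: "real \<Rightarrow> 'a::euclidean_space"
  assumes w: "has_weak_derivative f g" and F: "primitive_of F g"
  shows "periodic1 F"
proof -
  have g: "g \<in> L2_circle" using w by (simp add: has_weak_derivative_def)
  have mean: "(LBINT u:{0..1}. g u) = 0"
  proof -
    have "test_function (\<lambda>u. 1)"
      by (intro trig_poly_test_function trig_poly.const)
    then have "(LBINT u:{0..1}. deriv (\<lambda>u. 1) u *\<^sub>R f u) = - (LBINT u:{0..1}. 1 *\<^sub>R g u)"
      using w unfolding has_weak_derivative_def by blast
    then show ?thesis by (simp add: set_lebesgue_integral_def)
  qed
  show ?thesis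
  proof (rule periodic1I)
    fix x
    have "primitive_of (\<lambda>x. F (x + 1)) g"
      unfolding primitive_of_def
    proof (intro allI impI conjI)
      fix a b :: real assume "a \<le> b"
      show "set_integrable lborel {a..b} g" by (rule L2_circle_set_integrable[OF g])
      have "(LBINT u:{a + 1..b + 1}. g u) = (LBINT u:{a..b}. g u)"
      proof -
        have "(LBINT u:{a + 1..b + 1}. g u) = (LBINT u. indicator {a + 1..b + 1} (1 + u) *\<^sub>R g (1 + u))"
          unfolding set_lebesgue_integral_def
          using lborel_integral_real_affine[of 1 "\<lambda>u. indicator {a + 1..b + 1} u *\<^sub>R g u" 1] by simp
        also have "\<dots> = (LBINT u:{a..b}. g u)"
          unfolding set_lebesgue_integral_def
        proof (intro Bochner_Integration.integral_cong refl)
          fix u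
          have "g (1 + u) = g u" using g periodic1D[of g u] by (simp add: L2_circle_iff add.commute)
          then show "indicat_real {a + 1..b + 1} (1 + u) *\<^sub>R g (1 + u) = indicat_real {a..b} u *\<^sub>R g u"
            by (auto split: split_indicator)
        qed
        finally show ?thesis .
      qed
      then show "(LBINT u:{a..b}. g u) = F (b + 1) - F (a + 1)"
        using primitive_ofD(2)[OF F, of "a + 1" "b + 1"] \<open>a \<le> b\<close> by simp
    qed
    from primitive_of_eq_iff[OF this F, of x]
    have "F (x + 1) - F x = F 1 - F 0" by (simp add: algebra_simps)
    also have "\<dots> = 0" using primitive_ofD(2)[OF F, of 0 1] mean by simp
    finally show "F (x + 1) = F x" by simp
  qed
qed

text \<open>
  The du Bois-Reymond lemma: \<open>f\<close> and a primitive of \<open>g\<close> differ by a continuous function with weak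
  derivative 0, which is constant. Here \<open>f\<close> is assumed continuous, so that equality holds everywhere.
\<close>
lemma weak_derivative_imp_primitive_of:
  fixes f g :: "real \<Rightarrow> 'a::euclidean_space"
  assumes cont: "continuous_on UNIV f" and w: "has_weak_derivative f g"
  shows "primitive_of f g"
proof -
  have g: "g \<in> L2_circle" using w by (simp add: has_weak_derivative_def)
  obtain F where F: "primitive_of F g" "F 0 = 0" using L2_circle_has_primitive[OF g] by blast
  have perF: "periodic1 F" by (rule weak_derivative_periodic_primitive[OF w F(1)])
  have "has_weak_derivative F g" by (rule has_weak_derivative_primitive_of[OF F(1) perF g])
  from has_weak_derivative_diff[OF w this]
  have "f x - F x = f 0 - F 0" for x
    by (intro weak_derivative_zero_imp_const[of "\<lambda>u. f u - F u"])
      (auto intro!: continuous_intros cont primitive_of_continuous[OF F(1)])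
  then have "F x + f 0 = f x" for x using F(2) by (metis add.commute diff_0_right diff_add_cancel)
  then show ?thesis
    using primitive_of_add[OF F(1) primitive_of_const, of "f 0"] by simp
qed

lemma has_weak_derivative_unique:
  fixes f g g' :: "real \<Rightarrow> 'a::euclidean_space"
  assumes "has_weak_derivative f g" "has_weak_derivative f g'"
  shows "AE u in lborel. g u = g' u"
proof -
  have "has_weak_derivative (\<lambda>u. 0) (\<lambda>u. g u - g' u)"
    using has_weak_derivative_diff[OF assms] by simp
  then have "primitive_of (\<lambda>u. 0) (\<lambda>u. g u - g' u)"
    by (rule weak_derivative_imp_primitive_of[rotated]) auto
  from primitive_of_unique_AE[OF this primitive_of_const] show ?thesis
    by eventually_elim simp
qed

lemma has_weak_derivative_AE_cong:
  assumes w: "has_weak_derivative f g" and f': "f' \<in> L2_circle" and eq: "AE u in lborel. f u = f' u"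
  shows "has_weak_derivative f' g"
  unfolding has_weak_derivative_def
proof (intro conjI allI impI f')
  show "g \<in> L2_circle" using w by (simp add: has_weak_derivative_def)
  fix \<phi> assume \<phi>: "test_function \<phi>"
  have [measurable]: "f \<in> borel_measurable borel" "f' \<in> borel_measurable borel"
    using w f' by (auto simp: has_weak_derivative_def L2_circle_iff)
  have [measurable]: "deriv \<phi> \<in> borel_measurable borel"
    using test_function_derivative(2)[OF \<phi>] by (rule borel_measurable_continuous_onI)
  have "(LBINT u:{0..1}. deriv \<phi> u *\<^sub>R f' u) = (LBINT u:{0..1}. deriv \<phi> u *\<^sub>R f u)"
    unfolding set_lebesgue_integral_def
    by (rule integral_cong_AE) (use eq in auto)
  then show "(LBINT u:{0..1}. deriv \<phi> u *\<^sub>R f' u) = - (LBINT u:{0..1}. \<phi> u *\<^sub>R g u)"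
    using w \<phi> by (simp add: has_weak_derivative_def)
qed


text \<open>
  After subtraction of the mean, \<open>p\<close> itself is a weak derivative of the zero function, so the continuous
  case applies one level down.
\<close>
lemma weak_derivative_zero_imp_AE_const:
  fixes p :: "real \<Rightarrow> 'a::euclidean_space"
  assumes w: "has_weak_derivative p (\<lambda>u. 0)"
  obtains c where "AE u in lborel. p u = c"
proof -
  define c where "c = (LBINT u:{0..1}. p u)"
  have L: "p \<in> L2_circle" using w by (simp add: has_weak_derivative_def)
  have const: "(\<lambda>u. v) \<in> L2_circle" for v :: 'a
    by (rule continuous_periodic_L2_circle) (auto intro: periodic1I)
  have "has_weak_derivative (\<lambda>u. 0) (\<lambda>u. p u - c)"
    unfolding has_weak_derivative_def c_def
    by (auto intro: L2_circle_diff const L weak_derivative_zero_orthogonal[OF w] simp: set_lebesgue_integral_def[of _ _ "\<lambda>u. 0"])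
  then have "primitive_of (\<lambda>u. 0) (\<lambda>u. p u - c)"
    by (rule weak_derivative_imp_primitive_of[rotated]) auto
  from primitive_of_unique_AE[OF this primitive_of_const]
  have "AE u in lborel. p u = c" by eventually_elim simp
  then show ?thesis by (rule that)
qed

lemma primitive_of_AE_cong:
  assumes prim: "primitive_of f g" and eq: "AE u in lborel. g u = g' u"
    and [measurable]: "g \<in> borel_measurable borel" "g' \<in> borel_measurable borel"
  shows "primitive_of f g'"
  unfolding primitive_of_def
proof (intro allI impI conjI)
  fix a b :: real assume "a \<le> b"
  note p = primitive_ofD[OF prim this]
  have eq': "AE u in lborel. indicator {a..b} u *\<^sub>R g u = indicator {a..b} u *\<^sub>R g' u"
    using eq by eventually_elim simp
  show "set_integrable lborel {a..b} g'"
    using p(1) unfolding set_integrable_def by (rule integrable_cong_AE_imp) (use eq' in auto)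
  show "(LBINT u:{a..b}. g' u) = f b - f a"
    using p(2) integral_cong_AE[OF _ _ eq'] unfolding set_lebesgue_integral_def by simp
qed

section \<open>The Gagliardo seminorm and the Sobolev embedding\<close>

text \<open>
  The kernel of the Gagliardo seminorm as a 1-periodic function: \<open>infdist w \<int>\<close> is the distance of \<open>w\<close>
  from 0 on the circle. At integers its value is 0 by the conventions for \<open>powr\<close> and division, where the
  difference of a periodic function vanishes anyway.
\<close>
definition circle_kernel :: "real \<Rightarrow> real \<Rightarrow> real" where
  "circle_kernel s w = 1 / infdist w \<int> powr (1 + 2 * s)"

lemma infdist_Ints_attained:
  obtains m :: int where "infdist w \<int> = \<bar>w - of_int m\<bar>"
proof -
  have "closed (\<int> :: real set)" by (rule closed_Ints)
  moreover have "(\<int> :: real set) \<noteq> {}" by auto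
  ultimately obtain x where "x \<in> \<int>" "infdist w \<int> = dist w x"
    using infdist_attains_inf by blast
  then show ?thesis using that by (auto simp: Ints_def dist_real_def)
qed

lemma infdist_Ints_le: "infdist w \<int> \<le> \<bar>w - of_int m\<bar>" for w :: real
  using infdist_le[of "of_int m" \<int> w] by (simp add: dist_real_def)

lemma infdist_Ints_eq_abs:
  fixes w :: real
  assumes "\<bar>w\<bar> \<le> 1 / 2"
  shows "infdist w \<int> = \<bar>w\<bar>"
proof (rule antisym)
  show "infdist w \<int> \<le> \<bar>w\<bar>" using infdist_Ints_le[of w 0] by simp
  obtain m where m: "infdist w \<int> = \<bar>w - of_int m\<bar>" by (rule infdist_Ints_attained)
  show "\<bar>w\<bar> \<le> infdist w \<int>"
  proof (cases "m = 0")
    case False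
    then have "\<bar>of_int m :: real\<bar> \<ge> 1" by linarith
    then show ?thesis using assms m by linarith
  qed (use m in simp)
qed

lemma infdist_Ints_plus_1: "infdist (w + 1) \<int> = infdist w \<int>" for w :: real
proof (rule antisym)
  obtain m where m: "infdist w \<int> = \<bar>w - of_int m\<bar>" by (rule infdist_Ints_attained)
  then show "infdist (w + 1) \<int> \<le> infdist w \<int>" using infdist_Ints_le[of "w + 1" "m + 1"] by simp
  obtain m where m: "infdist (w + 1) \<int> = \<bar>w + 1 - of_int m\<bar>" by (rule infdist_Ints_attained)
  then show "infdist w \<int> \<le> infdist (w + 1) \<int>" using infdist_Ints_le[of w "m - 1"] by (simp add: algebra_simps)
qed

lemma infdist_Ints_pos: "w \<notin> \<int> \<Longrightarrow> infdist w \<int> > 0" for w :: real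
  using in_closed_iff_infdist_zero[of "\<int> :: real set" w] infdist_nonneg[of w \<int>]
  by (auto simp: order_less_le closed_Ints)

lemma circle_kernel_nonneg [simp]: "circle_kernel s w \<ge> 0"
  by (simp add: circle_kernel_def)

lemma circle_kernel_periodic: "circle_kernel s (w + 1) = circle_kernel s w"
  by (simp add: circle_kernel_def infdist_Ints_plus_1)

lemma circle_kernel_eq:
  assumes "\<bar>w\<bar> \<le> 1 / 2"
  shows "circle_kernel s w = 1 / \<bar>w\<bar> powr (1 + 2 * s)"
  using assms by (simp add: circle_kernel_def infdist_Ints_eq_abs)

lemma borel_measurable_circle_kernel [measurable]: "circle_kernel s \<in> borel_measurable borel"
proof -
  have [measurable]: "(\<lambda>w::real. infdist w \<int>) \<in> borel_measurable borel"
    by (intro borel_measurable_continuous_onI continuous_intros)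
  show ?thesis unfolding circle_kernel_def[abs_def] by measurable
qed

text \<open>
  With the periodic kernel both variables range over a full period, and the domain of integration becomes
  a square that every circle diffeomorphism fixing 0 maps onto itself.
\<close>
lemma gagliardo_sq_kernel:
  fixes f :: "real \<Rightarrow> 'a::euclidean_space"
  assumes per: "periodic1 f" and [measurable]: "f \<in> borel_measurable borel"
  shows "gagliardo_sq s f = (\<integral>\<^sup>+ u\<in>{a..a + 1}. (\<integral>\<^sup>+ v\<in>{a..a + 1}.
     ennreal ((norm (f v - f u))\<^sup>2 * circle_kernel s (v - u)) \<partial>lborel) \<partial>lborel)"
proof -
  define h where "h u v = ennreal ((norm (f v - f u))\<^sup>2 * circle_kernel s (v - u))" for u v
  have [measurable]: "case_prod h \<in> borel_measurable (borel \<Otimes>\<^sub>M borel)"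
    unfolding h_def by measurable
  have [measurable]: "h u \<in> borel_measurable borel" for u
    unfolding h_def by measurable
  have per_v: "h u (v + 1) = h u v" for u v
  proof -
    have "circle_kernel s (v + 1 - u) = circle_kernel s (v - u)"
      using circle_kernel_periodic[of s "v - u"] by (simp add: algebra_simps)
    then show ?thesis by (simp only: h_def periodic1D[OF per])
  qed
  have per_u: "h (u + 1) v = h u v" for u v
  proof -
    have "circle_kernel s (v - (u + 1)) = circle_kernel s (v - u)"
      using circle_kernel_periodic[of s "v - u - 1"] by (simp add: algebra_simps)
    then show ?thesis by (simp only: h_def periodic1D[OF per])
  qed
  have inner: "(\<integral>\<^sup>+ w\<in>{-1/2..1/2}. ennreal ((norm (f (u + w) - f u))\<^sup>2 / \<bar>w\<bar> powr (1 + 2 * s)) \<partial>lborel)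
     = (\<integral>\<^sup>+ v\<in>{a..a + 1}. h u v \<partial>lborel)" for u
  proof -
    have "(\<integral>\<^sup>+ w\<in>{-1/2..1/2}. ennreal ((norm (f (u + w) - f u))\<^sup>2 / \<bar>w\<bar> powr (1 + 2 * s)) \<partial>lborel)
      = (\<integral>\<^sup>+ w\<in>{-1/2..1/2}. h u (w + u) \<partial>lborel)"
      by (intro nn_integral_cong)
        (auto split: split_indicator simp: h_def circle_kernel_eq abs_le_iff add.commute)
    also have "\<dots> = (\<integral>\<^sup>+ v\<in>{-1/2 + u..1/2 + u}. h u v \<partial>lborel)"
      by (rule nn_integral_shift[symmetric]) measurable
    also have "\<dots> = (\<integral>\<^sup>+ v\<in>{-1/2 + u..(-1/2 + u) + 1}. h u v \<partial>lborel)"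
      by (simp add: algebra_simps)
    also have "\<dots> = (\<integral>\<^sup>+ v\<in>{0..1}. h u v \<partial>lborel)"
      by (rule nn_integral_periodic_shift) (measurable, rule per_v)
    also have "\<dots> = (\<integral>\<^sup>+ v\<in>{a..a + 1}. h u v \<partial>lborel)"
      by (rule nn_integral_periodic_shift[symmetric]) (measurable, rule per_v)
    finally show ?thesis .
  qed
  have "gagliardo_sq s f = (\<integral>\<^sup>+ u\<in>{0..1}. (\<integral>\<^sup>+ v\<in>{a..a + 1}. h u v \<partial>lborel) \<partial>lborel)"
    unfolding gagliardo_sq_def inner ..
  also have "\<dots> = (\<integral>\<^sup>+ u\<in>{a..a + 1}. (\<integral>\<^sup>+ v\<in>{a..a + 1}. h u v \<partial>lborel) \<partial>lborel)"
    by (rule nn_integral_periodic_shift[symmetric]) (measurable, simp add: per_u)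
  finally show ?thesis unfolding h_def .
qed

lemma gagliardo_sq_pair:
  fixes f :: "real \<Rightarrow> 'a::euclidean_space"
  assumes per: "periodic1 f" and [measurable]: "f \<in> borel_measurable borel"
  shows "gagliardo_sq s f = (\<integral>\<^sup>+ (u, v). ennreal ((norm (f v - f u))\<^sup>2 * circle_kernel s (v - u))
     * indicator ({0..1} \<times> {0..1}) (u, v) \<partial>(lborel \<Otimes>\<^sub>M lborel))"
proof -
  have "(\<integral>\<^sup>+ (u, v). ennreal ((norm (f v - f u))\<^sup>2 * circle_kernel s (v - u))
     * indicator ({0..1} \<times> {0..1}) (u, v) \<partial>(lborel \<Otimes>\<^sub>M lborel))
    = (\<integral>\<^sup>+ u. \<integral>\<^sup>+ v. ennreal ((norm (f v - f u))\<^sup>2 * circle_kernel s (v - u))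
     * indicator ({0..1} \<times> {0..1}) (u, v) \<partial>lborel \<partial>lborel)"
    by (subst lborel.nn_integral_fst[symmetric]) auto
  also have "\<dots> = (\<integral>\<^sup>+ u\<in>{0..0 + 1}. (\<integral>\<^sup>+ v\<in>{0..0 + 1}.
     ennreal ((norm (f v - f u))\<^sup>2 * circle_kernel s (v - u)) \<partial>lborel) \<partial>lborel)"
  proof (intro nn_integral_cong)
    fix u :: real
    show "(\<integral>\<^sup>+ v. ennreal ((norm (f v - f u))\<^sup>2 * circle_kernel s (v - u))
      * indicator ({0..1} \<times> {0..1}) (u, v) \<partial>lborel)
      = (\<integral>\<^sup>+ v\<in>{0..0 + 1}. ennreal ((norm (f v - f u))\<^sup>2 * circle_kernel s (v - u)) \<partial>lborel) * indicator {0..0 + 1} u"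
      by (cases "u \<in> {0..1}") (auto intro!: nn_integral_cong split: split_indicator)
  qed
  also have "\<dots> = gagliardo_sq s f"
    by (rule gagliardo_sq_kernel[OF assms, symmetric])
  finally show ?thesis ..
qed

lemma gagliardo_sq_cong_AE:
  fixes f g :: "real \<Rightarrow> 'a::euclidean_space"
  assumes "periodic1 f" "periodic1 g" "f \<in> borel_measurable borel" "g \<in> borel_measurable borel"
    and eq: "AE u in lborel. f u = g u"
  shows "gagliardo_sq s f = gagliardo_sq s g"
  unfolding gagliardo_sq_kernel[OF assms(1,3), where a = 0] gagliardo_sq_kernel[OF assms(2,4), where a = 0]
proof (rule nn_integral_cong_AE)
  show "AE u in lborel. (\<integral>\<^sup>+ v\<in>{0..0 + 1}. ennreal ((norm (f v - f u))\<^sup>2 * circle_kernel s (v - u)) \<partial>lborel) * indicator {0..0 + 1} u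
    = (\<integral>\<^sup>+ v\<in>{0..0 + 1}. ennreal ((norm (g v - g u))\<^sup>2 * circle_kernel s (v - u)) \<partial>lborel) * indicator {0..0 + 1} u"
    using eq
  proof eventually_elim
    fix u assume u: "f u = g u"
    have "(\<integral>\<^sup>+ v\<in>{0..0 + 1}. ennreal ((norm (f v - f u))\<^sup>2 * circle_kernel s (v - u)) \<partial>lborel)
      = (\<integral>\<^sup>+ v\<in>{0..0 + 1}. ennreal ((norm (g v - g u))\<^sup>2 * circle_kernel s (v - u)) \<partial>lborel)"
      using eq by (intro nn_integral_cong_AE) (auto simp: u elim: eventually_mono)
    then show "(\<integral>\<^sup>+ v\<in>{0..0 + 1}. ennreal ((norm (f v - f u))\<^sup>2 * circle_kernel s (v - u)) \<partial>lborel) * indicator {0..0 + 1} u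
      = (\<integral>\<^sup>+ v\<in>{0..0 + 1}. ennreal ((norm (g v - g u))\<^sup>2 * circle_kernel s (v - u)) \<partial>lborel) * indicator {0..0 + 1} u"
      by simp
  qed
qed

lemma L2_norm_sq_cong_AE:
  assumes "AE u in lborel. f u = g u"
  shows "L2_norm_sq f = L2_norm_sq g"
  unfolding L2_norm_sq_def
  by (rule nn_integral_cong_AE) (use assms in eventually_elim, simp)

lemma has_vector_derivative_shift:
  fixes f :: "real \<Rightarrow> 'a::real_normed_vector"
  assumes "(f has_vector_derivative d) (at (x + c))"
  shows "((\<lambda>t. f (t + c)) has_vector_derivative d) (at x)"
proof -
  have "((\<lambda>t. t + c) has_real_derivative 1) (at x)"
    by (auto intro!: derivative_eq_intros)
  then have "((\<lambda>t. t + c) has_vector_derivative 1) (at x)"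
    by (simp add: has_real_derivative_iff_has_vector_derivative)
  from vector_diff_chain_at[OF this assms] show ?thesis
    by (simp add: o_def)
qed

definition mean_over :: "(real \<Rightarrow> 'a::euclidean_space) \<Rightarrow> real \<Rightarrow> real \<Rightarrow> 'a" where
  "mean_over g r x = (LBINT u:{x..x + r}. g u) /\<^sub>R r"

lemma mean_over_diff_sq_le:
  fixes g :: "real \<Rightarrow> 'a::euclidean_space"
  assumes g: "g \<in> L2_circle" and "r > 0"
  shows "ennreal ((norm (mean_over g r x - c))\<^sup>2)
    \<le> ennreal (1 / r) * (\<integral>\<^sup>+ u\<in>{x..x + r}. ennreal ((norm (g u - c))\<^sup>2) \<partial>lborel)"
proof -
  have [measurable]: "g \<in> borel_measurable borel" using g by (simp add: L2_circle_iff)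
  have "(LBINT u:{x..x + r}. g u - c) = (LBINT u:{x..x + r}. g u) - (LBINT u:{x..x + r}. c)"
    by (intro set_integral_diff(2) L2_circle_set_integrable[OF g] borel_integrable_atLeastAtMost') auto
  also have "(LBINT u:{x..x + r}. c) = r *\<^sub>R c"
    using \<open>r > 0\<close> by (simp add: set_lebesgue_integral_def)
  finally have "mean_over g r x - c = (LBINT u:{x..x + r}. g u - c) /\<^sub>R r"
    using \<open>r > 0\<close> by (simp add: mean_over_def scaleR_diff_right)
  then have "ennreal ((norm (mean_over g r x - c))\<^sup>2)
      = ennreal (1 / r\<^sup>2) * ennreal ((norm (LBINT u:{x..x + r}. g u - c))\<^sup>2)"
    using \<open>r > 0\<close> by (simp add: ennreal_mult[symmetric] power_mult_distrib power_inverse divide_inverse)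
  also have "\<dots> \<le> ennreal (1 / r\<^sup>2) * (ennreal (x + r - x) * (\<integral>\<^sup>+ u\<in>{x..x + r}. ennreal ((norm (g u - c))\<^sup>2) \<partial>lborel))"
    using \<open>r > 0\<close> by (intro mult_left_mono set_integral_norm_sq_le) auto
  also have "\<dots> = ennreal (1 / r) * (\<integral>\<^sup>+ u\<in>{x..x + r}. ennreal ((norm (g u - c))\<^sup>2) \<partial>lborel)"
    using \<open>r > 0\<close> by (simp add: mult.assoc[symmetric] ennreal_mult[symmetric] power2_eq_square)
  finally show ?thesis .
qed

text \<open>
  The difference of two means is a mean of differences \<open>g u - g v\<close> with \<open>\<bar>u - v\<bar> \<le> r\<close>. For \<open>u \<noteq> v\<close> the
  kernel is then at least \<open>r powr (- (1 + 2 * s))\<close>, so two applications of the Cauchy-Schwarz inequality bound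
  the square of the difference by \<open>r powr (2 * s - 1)\<close> times the seminorm.
\<close>
lemma mean_over_halving:
  fixes g :: "real \<Rightarrow> 'a::euclidean_space"
  assumes g: "g \<in> L2_circle" and r: "0 < r" "r \<le> 1 / 2" and s: "s > 1 / 2"
  shows "ennreal ((norm (mean_over g r x - mean_over g (r / 2) x))\<^sup>2)
    \<le> ennreal (2 * r powr (2 * s - 1)) * gagliardo_sq s g"
proof -
  have [measurable]: "g \<in> borel_measurable borel" and per: "periodic1 g" using g by (auto simp: L2_circle_iff)
  let ?h = "\<lambda>u v. ennreal ((norm (g v - g u))\<^sup>2)"
  let ?k = "\<lambda>u v. ennreal ((norm (g v - g u))\<^sup>2 * circle_kernel s (v - u))"
  have hk: "?h u v \<le> ennreal (r powr (1 + 2 * s)) * ?k u v"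
    if "u \<in> {x..x + r}" "v \<in> {x..x + r}" for u v
  proof (cases "u = v")
    case False
    have le: "\<bar>v - u\<bar> \<le> r" using that by auto
    have "1 \<le> r powr (1 + 2 * s) * circle_kernel s (v - u)"
    proof -
      have "\<bar>v - u\<bar> powr (1 + 2 * s) \<le> r powr (1 + 2 * s)"
        using le s by (intro powr_mono2) auto
      then show ?thesis
        using False le r by (simp add: circle_kernel_eq field_simps)
    qed
    then have "(norm (g v - g u))\<^sup>2 * 1 \<le> (norm (g v - g u))\<^sup>2 * (r powr (1 + 2 * s) * circle_kernel s (v - u))"
      by (intro mult_left_mono) auto
    then show ?thesis by (simp add: ennreal_mult[symmetric] ennreal_leI mult_ac)
  qed simp
  have "ennreal ((norm (mean_over g r x - mean_over g (r / 2) x))\<^sup>2)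
      \<le> ennreal (1 / r) * (\<integral>\<^sup>+ u\<in>{x..x + r}. ennreal ((norm (g u - mean_over g (r / 2) x))\<^sup>2) \<partial>lborel)"
    using r by (intro mean_over_diff_sq_le g)
  also have "\<dots> \<le> ennreal (1 / r) * (\<integral>\<^sup>+ u\<in>{x..x + r}. ennreal (2 / r) *
      (\<integral>\<^sup>+ v\<in>{x..x + r}. ennreal (r powr (1 + 2 * s)) * ?k u v \<partial>lborel) \<partial>lborel)"
  proof (intro mult_left_mono nn_integral_mono)
    fix u
    have "ennreal ((norm (g u - mean_over g (r / 2) x))\<^sup>2)
        \<le> ennreal (2 / r) * (\<integral>\<^sup>+ v\<in>{x..x + r}. ennreal (r powr (1 + 2 * s)) * ?k u v \<partial>lborel)"
      if u: "u \<in> {x..x + r}"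
    proof -
      have "ennreal ((norm (g u - mean_over g (r / 2) x))\<^sup>2)
          \<le> ennreal (1 / (r / 2)) * (\<integral>\<^sup>+ v\<in>{x..x + r / 2}. ?h u v \<partial>lborel)"
        using r mean_over_diff_sq_le[OF g, of "r / 2" x "g u"] by (simp add: norm_minus_commute)
      also have "\<dots> \<le> ennreal (1 / (r / 2)) * (\<integral>\<^sup>+ v\<in>{x..x + r}. ennreal (r powr (1 + 2 * s)) * ?k u v \<partial>lborel)"
        using hk[OF u] r by (intro mult_left_mono nn_integral_mono) (auto split: split_indicator)
      finally show ?thesis by simp
    qed
    then show "ennreal ((norm (g u - mean_over g (r / 2) x))\<^sup>2) * indicator {x..x + r} u
       \<le> ennreal (2 / r) * (\<integral>\<^sup>+ v\<in>{x..x + r}. ennreal (r powr (1 + 2 * s)) * ?k u v \<partial>lborel) * indicator {x..x + r} u"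
      by (auto split: split_indicator)
  qed auto
  also have "\<dots> = ennreal (1 / r) * (\<integral>\<^sup>+ u. ennreal (2 / r) * ennreal (r powr (1 + 2 * s)) *
      ((\<integral>\<^sup>+ v\<in>{x..x + r}. ?k u v \<partial>lborel) * indicator {x..x + r} u) \<partial>lborel)"
    by (simp add: nn_integral_cmult mult.assoc)
  also have "\<dots> = ennreal (1 / r) * (ennreal (2 / r) * ennreal (r powr (1 + 2 * s))) *
      (\<integral>\<^sup>+ u\<in>{x..x + r}. (\<integral>\<^sup>+ v\<in>{x..x + r}. ?k u v \<partial>lborel) \<partial>lborel)"
    by (subst nn_integral_cmult) (auto simp: mult.assoc)
  also have "ennreal (1 / r) * (ennreal (2 / r) * ennreal (r powr (1 + 2 * s))) = ennreal (2 * r powr (2 * s - 1))"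
  proof -
    have "r powr (1 + 2 * s) = r powr (2 * s - 1) * r powr 2"
      by (simp add: powr_add[symmetric])
    also have "r powr 2 = r * r" using r by (simp add: power2_eq_square)
    finally show ?thesis using r by (simp add: ennreal_mult[symmetric])
  qed
  also have "ennreal (2 * r powr (2 * s - 1)) * (\<integral>\<^sup>+ u\<in>{x..x + r}. (\<integral>\<^sup>+ v\<in>{x..x + r}. ?k u v \<partial>lborel) \<partial>lborel)
     \<le> ennreal (2 * r powr (2 * s - 1)) * (\<integral>\<^sup>+ u\<in>{x..x + 1}. (\<integral>\<^sup>+ v\<in>{x..x + 1}. ?k u v \<partial>lborel) \<partial>lborel)"
    using r by (intro mult_left_mono nn_integral_mono mult_mono) (auto split: split_indicator)
  also have "\<dots> = ennreal (2 * r powr (2 * s - 1)) * gagliardo_sq s g"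
    by (subst gagliardo_sq_kernel[OF per, of _ x]) auto
  finally show ?thesis .
qed

text \<open>
  The sum of the geometric series with ratio \<open>(1/2) powr (s - 1/2)\<close>.
\<close>
definition morrey_const :: "real \<Rightarrow> real" where
  "morrey_const s = 1 / (1 - (1/2) powr (s - 1/2))"

text \<open>
  The means of \<open>g\<close> over dyadic intervals are difference quotients of \<open>\<gamma>\<close>. For \<open>s > 1/2\<close> consecutive ones
  differ by the terms of a convergent geometric series, uniformly in the point, so they have a continuous
  uniform limit \<open>g'\<close>. The same difference quotients, applied to a primitive of \<open>\<gamma>\<close>, converge to \<open>\<gamma>\<close> and
  have derivatives that converge uniformly to \<open>g'\<close>; hence \<open>g'\<close> is the derivative of \<open>\<gamma>\<close>.
\<close>
lemma gagliardo_embedding: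
  fixes \<gamma> g :: "real \<Rightarrow> 'a::euclidean_space"
  assumes prim: "primitive_of \<gamma> g" and g: "g \<in> L2_circle" and fin: "gagliardo_sq s g < \<infinity>"
    and s: "s > 1 / 2"
  obtains g' where "continuous_on UNIV g'" "\<And>u. (\<gamma> has_vector_derivative g' u) (at u)"
    "\<And>u. norm (g' u) \<le> sqrt (2 * enn2real (L2_norm_sq g)) + morrey_const s * sqrt (2 * enn2real (gagliardo_sq s g))"
proof -
  have [measurable]: "g \<in> borel_measurable borel" and per: "periodic1 g" using g by (auto simp: L2_circle_iff)
  have contg: "continuous_on UNIV \<gamma>" by (rule primitive_of_continuous[OF prim])
  \<comment> \<open>The sequence starts at \<open>1/2\<close>, the largest distance on the circle.\<close>
  define r where "r j = (1/2::real) ^ Suc j" for j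
  define a where "a j x = mean_over g (r j) x" for j x
  define q where "q = (1/2::real) powr (s - 1/2)"
  define M where "M = sqrt (2 * enn2real (gagliardo_sq s g))"
  have q: "0 < q" "q < 1"
    using s powr_less_mono'[of "1/2::real" 0 "s - 1/2"] by (auto simp: q_def)
  have M0: "M \<ge> 0" by (simp add: M_def)
  have rpos: "r j > 0" "r j \<le> 1/2" for j
    using power_le_one[of "1/2::real" j] by (auto simp: r_def)
  have step: "norm (a (Suc j) x - a j x) \<le> M * q ^ j" for j x
  proof -
    have "ennreal ((norm (a j x - a (Suc j) x))\<^sup>2) \<le> ennreal (2 * r j powr (2 * s - 1)) * gagliardo_sq s g"
      using mean_over_halving[OF g rpos(1)[of j] rpos(2)[of j] s, of x] by (simp add: a_def r_def)
    also have "\<dots> = ennreal (2 * r j powr (2 * s - 1) * enn2real (gagliardo_sq s g))"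
      using fin by (simp add: ennreal_mult ennreal_enn2real_if)
    finally have "(norm (a j x - a (Suc j) x))\<^sup>2 \<le> 2 * r j powr (2 * s - 1) * enn2real (gagliardo_sq s g)"
      by (subst (asm) ennreal_le_iff) auto
    also have "r j powr (2 * s - 1) = (q ^ Suc j)\<^sup>2"
    proof -
      have "r j powr (2 * s - 1) = ((1/2) powr real (Suc j)) powr (2 * s - 1)"
        unfolding r_def by (subst powr_realpow) auto
      also have "\<dots> = (1/2) powr (real (Suc j) * (2 * s - 1))" by (rule powr_powr)
      also have "real (Suc j) * (2 * s - 1) = (s - 1/2) * real (2 * Suc j)" by (simp add: algebra_simps)
      also have "(1/2::real) powr \<dots> = q powr real (2 * Suc j)" unfolding q_def by (rule powr_powr[symmetric])
      also have "\<dots> = (q ^ Suc j)\<^sup>2"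
        by (simp only: powr_realpow[OF q(1)] power_even_eq)
      finally show ?thesis .
    qed
    also have "2 * (q ^ Suc j)\<^sup>2 * enn2real (gagliardo_sq s g) = (M * q ^ Suc j)\<^sup>2"
      by (simp add: M_def power_mult_distrib)
    finally have "norm (a j x - a (Suc j) x) \<le> M * q ^ Suc j"
      by (rule power2_le_imp_le) (use q M0 in simp)
    also have "\<dots> \<le> M * q ^ j"
      using q M0 by (intro mult_left_mono power_decreasing) auto
    finally show ?thesis by (simp add: norm_minus_commute)
  qed
  have summ: "summable (\<lambda>j. M * q ^ j)"
    using q by (intro summable_mult summable_geometric) auto
  define D where "D x = (\<Sum>j. a (Suc j) x - a j x)" for x
  define g' where "g' x = a 0 x + D x" for x
  have unif: "uniform_limit UNIV a g' sequentially"
  proof -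
    have "uniform_limit UNIV (\<lambda>n x. \<Sum>j<n. a (Suc j) x - a j x) D sequentially"
      unfolding D_def by (rule Weierstrass_m_test[OF step summ])
    then have "uniform_limit UNIV (\<lambda>n x. a 0 x + (\<Sum>j<n. a (Suc j) x - a j x)) g' sequentially"
      unfolding g'_def by (intro uniform_limit_intros)
    moreover have "a 0 x + (\<Sum>j<n. a (Suc j) x - a j x) = a n x" for n x
      using sum_lessThan_telescope[of "\<lambda>j. a j x" n] by simp
    ultimately show ?thesis by simp
  qed
  have a_eq: "a j x = (\<gamma> (x + r j) - \<gamma> x) /\<^sub>R r j" for j x
    unfolding a_def mean_over_def using primitive_ofD(2)[OF prim, of x "x + r j"] rpos[of j] by simp
  have cont_a: "continuous_on UNIV (a j)" for j
    unfolding a_eq[abs_def] by (intro continuous_intros continuous_on_compose2[OF contg]) auto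
  have cont: "continuous_on UNIV g'"
    by (rule uniform_limit_theorem[OF _ unif]) (auto simp: cont_a)
  have bound: "norm (g' x) \<le> sqrt (2 * enn2real (L2_norm_sq g)) + morrey_const s * sqrt (2 * enn2real (gagliardo_sq s g))" for x
  proof -
    have "norm (D x) \<le> (\<Sum>j. M * q ^ j)"
      unfolding D_def
      using summable_norm_comparison_test[of "\<lambda>j. a (Suc j) x - a j x" "\<lambda>j. M * q ^ j"] step summ
      by (intro order_trans[OF summable_norm suminf_le])
        (auto intro!: summable_comparison_test'[OF summ, of 0])
    also have "\<dots> = M * (1 / (1 - q))"
      using q by (subst suminf_mult) (auto simp: suminf_geometric summable_geometric)
    finally have 1: "norm (D x) \<le> morrey_const s * M" by (simp add: morrey_const_def q_def mult.commute)
    have "ennreal ((norm (a 0 x))\<^sup>2) \<le> ennreal (1 / r 0) * (\<integral>\<^sup>+ u\<in>{x..x + r 0}. ennreal ((norm (g u))\<^sup>2) \<partial>lborel)"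
      using mean_over_diff_sq_le[OF g rpos(1), of 0 x 0] by (simp add: a_def)
    also have "\<dots> \<le> ennreal 2 * (\<integral>\<^sup>+ u\<in>{x..x + 1}. ennreal ((norm (g u))\<^sup>2) \<partial>lborel)"
      by (intro mult_mono nn_integral_mono) (auto split: split_indicator simp: r_def)
    also have "\<dots> = ennreal (2 * enn2real (L2_norm_sq g))"
      using g by (simp add: L2_norm_sq_shift[OF per] L2_circle_iff ennreal_mult ennreal_enn2real_if less_top)
    finally have "(norm (a 0 x))\<^sup>2 \<le> 2 * enn2real (L2_norm_sq g)"
      by (subst (asm) ennreal_le_iff) auto
    then have "norm (a 0 x) \<le> sqrt (2 * enn2real (L2_norm_sq g))"
      by (rule real_le_rsqrt)
    with 1 show ?thesis unfolding g'_def M_def by (intro norm_triangle_mono) auto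
  qed
  have deriv: "(\<gamma> has_vector_derivative g' u) (at u)" for u
  proof -
    define \<Gamma> where "\<Gamma> x = 0 + (LBINT t=ereal 0..ereal x. \<gamma> t)" for x
    have I: "set_integrable lborel {x..y} \<gamma>" for x y
      by (rule borel_integrable_atLeastAtMost') (rule continuous_on_subset[OF contg], simp)
    have "primitive_of \<Gamma> \<gamma>"
      unfolding \<Gamma>_def by (rule primitive_of_ext[where c = 0]) (auto simp: I zero_ereal_def)
    then have \<Gamma>: "(\<Gamma> has_vector_derivative \<gamma> x) (at x)" for x
      by (rule primitive_of_continuous_derivative[OF _ contg])
    define G where "G j x = (\<Gamma> (x + r j) - \<Gamma> x) /\<^sub>R r j" for j x
    have G: "(G j has_vector_derivative a j x) (at x)" for j x
    proof -
      have "((\<lambda>x. \<Gamma> (x + r j)) has_vector_derivative \<gamma> (x + r j)) (at x)"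
        by (rule has_vector_derivative_shift[OF \<Gamma>])
      from has_vector_derivative_diff[OF this \<Gamma>[of x]]
      show ?thesis
        unfolding G_def a_eq by (rule bounded_linear.has_vector_derivative[OF bounded_linear_scaleR_right])
    qed
    have lim: "(\<lambda>j. G j x) \<longlonglongrightarrow> \<gamma> x" for x
    proof -
      have "((\<lambda>h. norm (\<Gamma> (x + h) - \<Gamma> x - h *\<^sub>R \<gamma> x) / norm h) \<longlongrightarrow> 0) (at 0)"
        using \<Gamma>[of x] by (simp add: has_vector_derivative_def has_derivative_at)
      moreover have "filterlim r (at 0) sequentially"
      proof (rule filterlim_atI)
        show "r \<longlonglongrightarrow> 0" unfolding r_def by (intro LIMSEQ_Suc LIMSEQ_realpow_zero) auto
        show "\<forall>\<^sub>F j in sequentially. r j \<noteq> 0"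
          using rpos(1) by (intro always_eventually allI) (metis less_irrefl)
      qed
      ultimately have "(\<lambda>j. norm (\<Gamma> (x + r j) - \<Gamma> x - r j *\<^sub>R \<gamma> x) / norm (r j)) \<longlonglongrightarrow> 0"
        by (rule filterlim_compose)
      moreover have "norm (\<Gamma> (x + r j) - \<Gamma> x - r j *\<^sub>R \<gamma> x) / norm (r j) = norm (G j x - \<gamma> x)" for j
      proof -
        have "G j x - \<gamma> x = (\<Gamma> (x + r j) - \<Gamma> x - r j *\<^sub>R \<gamma> x) /\<^sub>R r j"
          using rpos(1)[of j] by (simp add: G_def scaleR_diff_right)
        then show ?thesis by (simp add: divide_inverse mult.commute)
      qed
      ultimately have "(\<lambda>j. norm (G j x - \<gamma> x)) \<longlonglongrightarrow> 0" by (simp only:)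
      then show ?thesis by (rule LIM_zero_cancel[OF tendsto_norm_zero_cancel])
    qed
    have "\<exists>f. \<forall>x\<in>UNIV. (\<lambda>n. G n x) \<longlonglongrightarrow> f x \<and> (f has_derivative (\<lambda>h. h *\<^sub>R g' x)) (at x within UNIV)"
    proof (rule has_derivative_sequence)
      show "(G n has_derivative (\<lambda>h. h *\<^sub>R a n x)) (at x within UNIV)" for n x
        using G[of n x] by (simp add: has_vector_derivative_def)
      show "\<forall>\<^sub>F n in sequentially. \<forall>x\<in>UNIV. \<forall>h. norm (h *\<^sub>R a n x - h *\<^sub>R g' x) \<le> e * norm h" if "e > 0" for e
        using uniform_limitD[OF unif that]
      proof eventually_elim
        case (elim n)
        show ?case
        proof (intro ballI allI)
          fix x h
          have "norm (a n x - g' x) \<le> e" using elim by (simp add: dist_norm less_imp_le)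
          then have "\<bar>h\<bar> * norm (a n x - g' x) \<le> \<bar>h\<bar> * e" by (rule mult_left_mono) simp
          then show "norm (h *\<^sub>R a n x - h *\<^sub>R g' x) \<le> e * norm h"
            by (simp add: scaleR_diff_right[symmetric] mult.commute)
        qed
      qed
      show "(\<lambda>n. G n 0) \<longlonglongrightarrow> \<gamma> 0" by (rule lim)
    qed auto
    then obtain f where f: "\<And>x. (\<lambda>n. G n x) \<longlonglongrightarrow> f x" "\<And>x. (f has_vector_derivative g' x) (at x)"
      by (auto simp: has_vector_derivative_def)
    have "f = \<gamma>" using f(1) lim LIMSEQ_unique by blast
    then show ?thesis using f(2) by simp
  qed
  show ?thesis by (rule that[OF cont deriv bound])
qed

section \<open>The metric space of Sobolev curves\<close>

text \<open>
  The triangle inequality for square roots of quadratic quantities, from the weighted inequality alone: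
  the optimal weight is \<open>t = sqrt B / sqrt A\<close>. Adding \<open>e / 2\<close> to both roots covers the case that one vanishes.
\<close>
lemma sqrt_le_sqrt_add_sqrt:
  assumes nonneg: "A \<ge> 0" "B \<ge> 0" and le: "\<And>t. t > 0 \<Longrightarrow> X \<le> (1 + t) * A + (1 + 1 / t) * B"
  shows "sqrt X \<le> sqrt A + sqrt B"
proof (rule field_le_epsilon)
  fix e :: real assume "e > 0"
  define a b where "a = sqrt A + e / 2" and "b = sqrt B + e / 2"
  have ab: "a > 0" "b > 0" using nonneg \<open>e > 0\<close> by (auto simp: a_def b_def add_nonneg_pos)
  have A: "A \<le> a\<^sup>2" and B: "B \<le> b\<^sup>2"
    using nonneg \<open>e > 0\<close> by (auto simp: a_def b_def intro!: real_le_rsqrt sqrt_le_D)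
  have "X \<le> (1 + b / a) * A + (1 + 1 / (b / a)) * B"
    using ab by (intro le) auto
  also have "\<dots> \<le> (1 + b / a) * a\<^sup>2 + (1 + a / b) * b\<^sup>2"
    using ab by (intro add_mono mult_mono A B) (auto simp: nonneg)
  also have "\<dots> = (a + b)\<^sup>2"
    using ab by (simp add: power2_eq_square field_simps)
  finally have "sqrt X \<le> a + b" using ab by (intro real_le_lsqrt) auto
  then show "sqrt X \<le> sqrt A + sqrt B + e" by (simp add: a_def b_def)
qed

lemma gagliardo_sq_add_le:
  fixes f g :: "real \<Rightarrow> 'a::euclidean_space"
  assumes per: "periodic1 f" "periodic1 g"
    and [measurable]: "f \<in> borel_measurable borel" "g \<in> borel_measurable borel" and "t > 0"
  shows "gagliardo_sq s (\<lambda>u. f u + g u) \<le> ennreal (1 + t) * gagliardo_sq s f + ennreal (1 + 1 / t) * gagliardo_sq s g"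
proof -
  have perfg: "periodic1 (\<lambda>u. f u + g u)"
    by (rule periodic1I) (simp add: periodic1D[OF per(1)] periodic1D[OF per(2)])
  have meas: "(\<lambda>u. f u + g u) \<in> borel_measurable borel" by measurable
  let ?F = "\<lambda>f u v. ennreal ((norm (f v - f u :: 'a))\<^sup>2 * circle_kernel s (v - u))
     * indicator ({0..1} \<times> {0..1}) (u, v)"
  have "gagliardo_sq s (\<lambda>u. f u + g u)
     \<le> (\<integral>\<^sup>+ (u, v). ennreal (1 + t) * ?F f u v + ennreal (1 + 1 / t) * ?F g u v \<partial>(lborel \<Otimes>\<^sub>M lborel))"
    unfolding gagliardo_sq_pair[OF perfg meas]
  proof (intro nn_integral_mono, clarify)
    fix u v :: real
    have "(norm ((f v - f u) + (g v - g u)))\<^sup>2 * circle_kernel s (v - u)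
        \<le> ((1 + t) * (norm (f v - f u))\<^sup>2 + (1 + 1 / t) * (norm (g v - g u))\<^sup>2) * circle_kernel s (v - u)"
      by (intro mult_right_mono norm_add_sq_le \<open>t > 0\<close>) simp
    then have "ennreal ((norm ((f v + g v) - (f u + g u)))\<^sup>2 * circle_kernel s (v - u))
        \<le> ennreal ((1 + t) * ((norm (f v - f u))\<^sup>2 * circle_kernel s (v - u))
          + (1 + 1 / t) * ((norm (g v - g u))\<^sup>2 * circle_kernel s (v - u)))"
      by (intro ennreal_leI) (simp add: algebra_simps)
    then show "?F (\<lambda>u. f u + g u) u v \<le> ennreal (1 + t) * ?F f u v + ennreal (1 + 1 / t) * ?F g u v"
      using \<open>t > 0\<close> by (auto split: split_indicator simp: ennreal_mult[symmetric] ennreal_plus[symmetric] simp del: ennreal_plus)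
  qed
  also have "\<dots> = ennreal (1 + t) * gagliardo_sq s f + ennreal (1 + 1 / t) * gagliardo_sq s g"
    unfolding gagliardo_sq_pair[OF per(1) assms(3)] gagliardo_sq_pair[OF per(2) assms(4)] case_prod_beta
    by (subst nn_integral_add, simp, simp, subst nn_integral_cmult, simp, subst nn_integral_cmult) auto
  finally show ?thesis .
qed

lemma gagliardo_sq_scaleR:
  fixes f :: "real \<Rightarrow> 'a::euclidean_space"
  assumes per: "periodic1 f" and [measurable]: "f \<in> borel_measurable borel"
  shows "gagliardo_sq s (\<lambda>u. c *\<^sub>R f u) = ennreal (c\<^sup>2) * gagliardo_sq s f"
proof -
  have per': "periodic1 (\<lambda>u. c *\<^sub>R f u)"
    by (rule periodic1I) (simp add: periodic1D[OF per])
  have meas: "(\<lambda>u. c *\<^sub>R f u) \<in> borel_measurable borel" by measurable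
  show ?thesis
    unfolding gagliardo_sq_pair[OF per' meas] gagliardo_sq_pair[OF assms] case_prod_beta
    by (subst nn_integral_cmult[symmetric])
      (auto intro!: nn_integral_cong split: split_indicator
        simp: scaleR_diff_right[symmetric] power_mult_distrib ennreal_mult[symmetric] mult_ac)
qed

text \<open>
  A curve with the continuous representative \<open>g\<close> of its derivative and, for \<open>s = 1\<close>, a representative \<open>h\<close>
  of its second derivative. Unlike \<open>weak_derivative\<close>, these data can be added, scaled and composed.
\<close>
definition sobolev_jet ::
    "real \<Rightarrow> (real \<Rightarrow> 'a::euclidean_space) \<Rightarrow> (real \<Rightarrow> 'a) \<Rightarrow> (real \<Rightarrow> 'a) \<Rightarrow> bool" where
  "sobolev_jet s \<gamma> g h \<longleftrightarrow> periodic1 \<gamma> \<and> continuous_on UNIV g \<and>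
     (\<forall>u. (\<gamma> has_vector_derivative g u) (at u)) \<and>
     (if s < 1 then gagliardo_sq s g < \<infinity> else h \<in> L2_circle \<and> primitive_of g h)"

definition sobolev_energy ::
    "real \<Rightarrow> (real \<Rightarrow> 'a::euclidean_space) \<Rightarrow> (real \<Rightarrow> 'a) \<Rightarrow> (real \<Rightarrow> 'a) \<Rightarrow> ennreal" where
  "sobolev_energy s \<gamma> g h = L2_norm_sq \<gamma> + L2_norm_sq g +
     (if s < 1 then gagliardo_sq s g else L2_norm_sq h)"

lemma periodic_vector_derivative:
  assumes per: "periodic1 \<gamma>" and d: "\<And>u. (\<gamma> has_vector_derivative g u) (at u)"
  shows "periodic1 g"
proof (rule periodic1I)
  fix x
  have "((\<lambda>t. \<gamma> (t + 1)) has_vector_derivative g (x + 1)) (at x)"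
    by (rule has_vector_derivative_shift[OF d])
  then have "(\<gamma> has_vector_derivative g (x + 1)) (at x)"
    by (simp add: periodic1D[OF per])
  then show "g (x + 1) = g x" using d vector_derivative_unique_at by blast
qed

lemma sobolev_jetD:
  assumes "sobolev_jet s \<gamma> g h"
  shows "periodic1 \<gamma>" "continuous_on UNIV g" "(\<gamma> has_vector_derivative g u) (at u)"
    "periodic1 g" "primitive_of \<gamma> g" "g \<in> L2_circle" "\<gamma> \<in> L2_circle" "continuous_on UNIV \<gamma>"
    "\<gamma> \<in> borel_measurable borel" "g \<in> borel_measurable borel"
    "vector_derivative \<gamma> (at u) = g u"
proof -
  show 1: "periodic1 \<gamma>" "continuous_on UNIV g" and d: "(\<gamma> has_vector_derivative g u) (at u)" for u
    using assms by (auto simp: sobolev_jet_def)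
  then show 2: "periodic1 g" "primitive_of \<gamma> g"
    by (auto intro: periodic_vector_derivative primitive_of_derivative)
  then show "g \<in> L2_circle" using 1 by (intro continuous_periodic_L2_circle)
  show 3: "continuous_on UNIV \<gamma>" by (rule primitive_of_continuous[OF 2(2)])
  then show "\<gamma> \<in> L2_circle" using 1 by (intro continuous_periodic_L2_circle)
  show "\<gamma> \<in> borel_measurable borel" "g \<in> borel_measurable borel"
    using 1 3 by (auto intro: borel_measurable_continuous_onI)
  show "vector_derivative \<gamma> (at u) = g u" by (rule vector_derivative_at[OF d])
qed

lemma sobolev_jet_weak:
  assumes "sobolev_jet s \<gamma> g h"
  shows "has_weak_derivative \<gamma> g" "\<not> s < 1 \<Longrightarrow> has_weak_derivative g h"
  using assms sobolev_jetD[OF assms]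
  by (auto simp: sobolev_jet_def intro: has_weak_derivative_primitive_of)

text \<open>
  Membership of \<open>sobolev s\<close> means that a weak derivative is square integrable with finite seminorm. For
  \<open>s < 1\<close> the embedding replaces it by a continuous derivative; for \<open>s = 1\<close> the weak derivative has a
  weak derivative of its own and is therefore almost everywhere equal to an absolutely continuous function.
\<close>
lemma sobolev_iff_jet:
  assumes s: "1 / 2 < s" "s \<le> 1"
  shows "\<gamma> \<in> sobolev s \<longleftrightarrow> (\<exists>g h. sobolev_jet s \<gamma> g h)"
proof
  assume "\<exists>g h. sobolev_jet s \<gamma> g h"
  then obtain g h where j: "sobolev_jet s \<gamma> g h" by blast
  then show "\<gamma> \<in> sobolev s"
    using sobolev_jetD(8)[OF j] sobolev_jet_weak[OF j] j unfolding sobolev_def sobolev_jet_def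
    by (cases "s < 1") auto
next
  assume "\<gamma> \<in> sobolev s"
  then obtain g where cont: "continuous_on UNIV \<gamma>" and g: "has_weak_derivative \<gamma> g"
    and or: "if s < 1 then gagliardo_sq s g < \<infinity> else (\<exists>h. has_weak_derivative g h)"
    by (auto simp: sobolev_def)
  have prim: "primitive_of \<gamma> g" by (rule weak_derivative_imp_primitive_of[OF cont g])
  have L: "g \<in> L2_circle" and per: "periodic1 \<gamma>" using g by (auto simp: has_weak_derivative_def L2_circle_iff)
  have [measurable]: "g \<in> borel_measurable borel" and perg: "periodic1 g" using L by (auto simp: L2_circle_iff)
  show "\<exists>g h. sobolev_jet s \<gamma> g h"
  proof (cases "s < 1")
    case True
    then have fin: "gagliardo_sq s g < \<infinity>" using or by simp
    obtain g' where g': "continuous_on UNIV g'" "\<And>u. (\<gamma> has_vector_derivative g' u) (at u)"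
      by (rule gagliardo_embedding[OF prim L fin s(1)], rule that)
    have [measurable]: "g' \<in> borel_measurable borel"
      using g'(1) by (rule borel_measurable_continuous_onI)
    have "AE u in lborel. g' u = g u"
      by (rule primitive_of_unique_AE[OF primitive_of_derivative[OF g'(2,1)] prim])
    then have "gagliardo_sq s g' = gagliardo_sq s g"
      using periodic_vector_derivative[OF per g'(2)] perg by (intro gagliardo_sq_cong_AE) auto
    then have "sobolev_jet s \<gamma> g' undefined" using True fin per g' by (simp add: sobolev_jet_def)
    then show ?thesis by blast
  next
    case False
    then obtain h where h: "has_weak_derivative g h" using or by auto
    then have Lh: "h \<in> L2_circle" by (simp add: has_weak_derivative_def)
    \<comment> \<open>A primitive of \<open>h\<close> differs from \<open>g\<close> by a function with vanishing weak derivative.\<close>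
    obtain H where H: "primitive_of H h" "H 0 = 0" using L2_circle_has_primitive[OF Lh] by blast
    have "has_weak_derivative H h"
      by (rule has_weak_derivative_primitive_of[OF H(1) weak_derivative_periodic_primitive[OF h H(1)] Lh])
    from has_weak_derivative_diff[OF h this]
    obtain c where "AE u in lborel. g u - H u = c"
      using weak_derivative_zero_imp_AE_const by auto
    then have "AE u in lborel. g u = H u + c"
      by eventually_elim (auto simp: algebra_simps)
    moreover have contH: "continuous_on UNIV (\<lambda>u. H u + c)"
      by (intro continuous_intros primitive_of_continuous[OF H(1)])
    ultimately have "primitive_of \<gamma> (\<lambda>u. H u + c)"
      by (intro primitive_of_AE_cong[OF prim] borel_measurable_continuous_onI[OF contH]) auto
    then have "(\<gamma> has_vector_derivative H u + c) (at u)" for u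
      by (rule primitive_of_continuous_derivative[OF _ contH])
    moreover have "primitive_of (\<lambda>u. H u + c) h"
      using primitive_of_add[OF H(1) primitive_of_const, of c] by simp
    ultimately have "sobolev_jet s \<gamma> (\<lambda>u. H u + c) h"
      using False per contH Lh by (simp add: sobolev_jet_def)
    then show ?thesis by blast
  qed
qed

lemma sobolev_jet_scaleR:
  assumes j: "sobolev_jet s \<gamma> g h"
  shows "sobolev_jet s (\<lambda>u. c *\<^sub>R \<gamma> u) (\<lambda>u. c *\<^sub>R g u) (\<lambda>u. c *\<^sub>R h u)"
proof -
  note J = sobolev_jetD[OF j]
  have "((\<lambda>u. c *\<^sub>R \<gamma> u) has_vector_derivative c *\<^sub>R g u) (at u)" for u
    by (rule bounded_linear.has_vector_derivative[OF bounded_linear_scaleR_right J(3)])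
  moreover have "periodic1 (\<lambda>u. c *\<^sub>R \<gamma> u)"
    by (rule periodic1I) (simp add: periodic1D[OF J(1)])
  moreover have "continuous_on UNIV (\<lambda>u. c *\<^sub>R g u)"
    by (intro continuous_intros J)
  ultimately show ?thesis
    using j J(4,10) unfolding sobolev_jet_def
    by (auto simp: gagliardo_sq_scaleR ennreal_mult_less_top intro: primitive_of_scaleR L2_circle_scaleR)
qed

lemma sobolev_jet_add:
  assumes j: "sobolev_jet s \<gamma> g h" and j': "sobolev_jet s \<gamma>' g' h'"
  shows "sobolev_jet s (\<lambda>u. \<gamma> u + \<gamma>' u) (\<lambda>u. g u + g' u) (\<lambda>u. h u + h' u)"
proof -
  note J = sobolev_jetD[OF j] and J' = sobolev_jetD[OF j']
  have "((\<lambda>u. \<gamma> u + \<gamma>' u) has_vector_derivative g u + g' u) (at u)" for u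
    by (intro has_vector_derivative_add J(3) J'(3))
  moreover have "periodic1 (\<lambda>u. \<gamma> u + \<gamma>' u)"
    by (rule periodic1I) (simp add: periodic1D[OF J(1)] periodic1D[OF J'(1)])
  moreover have "continuous_on UNIV (\<lambda>u. g u + g' u)"
    by (intro continuous_intros J J')
  moreover have "gagliardo_sq s (\<lambda>u. g u + g' u) < \<infinity>" if "s < 1"
  proof -
    have "gagliardo_sq s (\<lambda>u. g u + g' u) \<le> ennreal (1 + 1) * gagliardo_sq s g + ennreal (1 + 1 / 1) * gagliardo_sq s g'"
      by (rule gagliardo_sq_add_le) (use J J' in auto)
    also have "\<dots> < \<infinity>"
      using j j' that by (auto simp: sobolev_jet_def ennreal_mult_less_top)
    finally show ?thesis .
  qed
  ultimately show ?thesis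
    using j j' unfolding sobolev_jet_def
    by (auto intro: primitive_of_add L2_circle_add)
qed

lemma sobolev_jet_diff:
  assumes j: "sobolev_jet s \<gamma> g h" and j': "sobolev_jet s \<gamma>' g' h'"
  shows "sobolev_jet s (\<lambda>u. \<gamma> u - \<gamma>' u) (\<lambda>u. g u - g' u) (\<lambda>u. h u - h' u)"
  using sobolev_jet_add[OF j sobolev_jet_scaleR[OF j', of "-1"]] by simp

lemma sobolev_jet_const: "sobolev_jet s (\<lambda>u. c) (\<lambda>u. 0) (\<lambda>u. 0)"
proof -
  have "(\<lambda>u. 0) \<in> L2_circle"
    by (rule continuous_periodic_L2_circle) (auto intro: periodic1I)
  then show ?thesis
    unfolding sobolev_jet_def by (auto intro: periodic1I primitive_of_const simp: gagliardo_sq_def)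
qed

lemma sobolev_energy_finite:
  assumes "sobolev_jet s \<gamma> g h"
  shows "sobolev_energy s \<gamma> g h < \<infinity>"
  using sobolev_jetD[OF assms] assms by (auto simp: sobolev_energy_def sobolev_jet_def L2_circle_iff)

lemma sobolev_energy_add_le:
  assumes j: "sobolev_jet s \<gamma> g h" and j': "sobolev_jet s \<gamma>' g' h'" and t: "t > 0"
  shows "sobolev_energy s (\<lambda>u. \<gamma> u + \<gamma>' u) (\<lambda>u. g u + g' u) (\<lambda>u. h u + h' u)
    \<le> ennreal (1 + t) * sobolev_energy s \<gamma> g h + ennreal (1 + 1 / t) * sobolev_energy s \<gamma>' g' h'"
proof -
  note J = sobolev_jetD[OF j] and J' = sobolev_jetD[OF j']
  let ?a = "ennreal (1 + t)" and ?b = "ennreal (1 + 1 / t)"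
  have 1: "L2_norm_sq (\<lambda>u. \<gamma> u + \<gamma>' u) \<le> ?a * L2_norm_sq \<gamma> + ?b * L2_norm_sq \<gamma>'"
    by (intro L2_norm_sq_add_le J J' t)
  have 2: "L2_norm_sq (\<lambda>u. g u + g' u) \<le> ?a * L2_norm_sq g + ?b * L2_norm_sq g'"
    by (intro L2_norm_sq_add_le J J' t)
  have 3: "(if s < 1 then gagliardo_sq s (\<lambda>u. g u + g' u) else L2_norm_sq (\<lambda>u. h u + h' u))
      \<le> ?a * (if s < 1 then gagliardo_sq s g else L2_norm_sq h)
      + ?b * (if s < 1 then gagliardo_sq s g' else L2_norm_sq h')"
    using j j' gagliardo_sq_add_le[OF J(4) J'(4) J(10) J'(10) t, of s]
      L2_norm_sq_add_le[of h h', OF _ _ t]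
    by (auto simp: sobolev_jet_def L2_circle_iff)
  show ?thesis
    unfolding sobolev_energy_def distrib_left
    using add_mono[OF add_mono[OF 1 2] 3] by (simp add: ac_simps)
qed

lemma weak_derivative_works:
  "has_weak_derivative f g \<Longrightarrow> has_weak_derivative f (weak_derivative f)"
  unfolding weak_derivative_def by (rule someI[where P = "has_weak_derivative f"])

lemma sobolev_norm_jet:
  assumes j: "sobolev_jet s \<gamma> g h"
  shows "sobolev_norm s \<gamma> = sqrt (enn2real (sobolev_energy s \<gamma> g h))"
proof -
  note J = sobolev_jetD[OF j]
  let ?w = "weak_derivative \<gamma>"
  note wg = sobolev_jet_weak(1)[OF j]
  have w: "has_weak_derivative \<gamma> ?w" by (rule weak_derivative_works[OF wg])
  then have eq: "AE u in lborel. ?w u = g u" by (rule has_weak_derivative_unique[OF _ wg])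
  have wL: "?w \<in> L2_circle" using w by (simp add: has_weak_derivative_def)
  have "L2_norm_sq (weak_derivative ?w) = L2_norm_sq h" if "\<not> s < 1"
  proof -
    have gh: "has_weak_derivative g h" by (rule sobolev_jet_weak(2)[OF j that])
    have wh: "has_weak_derivative ?w h"
      by (rule has_weak_derivative_AE_cong[OF gh wL]) (use eq in eventually_elim, simp)
    show ?thesis
      by (rule L2_norm_sq_cong_AE[OF has_weak_derivative_unique[OF weak_derivative_works[OF wh] wh]])
  qed
  moreover have "gagliardo_sq s ?w = gagliardo_sq s g"
    using wL J by (intro gagliardo_sq_cong_AE eq) (auto simp: L2_circle_iff)
  ultimately show ?thesis
    unfolding sobolev_norm_def sobolev_energy_def by (simp add: L2_norm_sq_cong_AE[OF eq])
qed

lemma has_weak_derivative_uminus_iff: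
  "has_weak_derivative (\<lambda>u. - f u) g \<longleftrightarrow> has_weak_derivative f (\<lambda>u. - g u)"
proof -
  have zero: "has_weak_derivative (\<lambda>u. 0) (\<lambda>u. 0)"
    using sobolev_jet_weak(1)[OF sobolev_jet_const] .
  show ?thesis
    using has_weak_derivative_diff[OF zero, of "\<lambda>u. - f u" g]
      has_weak_derivative_diff[OF zero, of f "\<lambda>u. - g u"] by auto
qed

text \<open>
  If \<open>f\<close> has no weak derivative, then neither has \<open>f'\<close>, and \<open>weak_derivative\<close> chooses from the same empty
  set of candidates for both.
\<close>
lemma weak_derivative_uminus_cases:
  assumes "\<And>g. has_weak_derivative f' g \<longleftrightarrow> has_weak_derivative f (\<lambda>u. - g u)"
  shows "weak_derivative f' = weak_derivative f \<or>
    (weak_derivative f \<in> L2_circle \<and> weak_derivative f' \<in> L2_circle \<and>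
     (AE u in lborel. weak_derivative f' u = - weak_derivative f u))"
proof (cases "\<exists>g. has_weak_derivative f g")
  case True
  then have w: "has_weak_derivative f (weak_derivative f)" using weak_derivative_works by blast
  then have "has_weak_derivative f' (\<lambda>u. - weak_derivative f u)" by (simp add: assms)
  moreover from this have w': "has_weak_derivative f' (weak_derivative f')" by (rule weak_derivative_works)
  ultimately have "AE u in lborel. weak_derivative f' u = - weak_derivative f u"
    by (rule has_weak_derivative_unique[rotated])
  with w w' show ?thesis by (simp add: has_weak_derivative_def)
next
  case False
  then have "has_weak_derivative f' = has_weak_derivative f" by (auto simp: assms fun_eq_iff)
  then show ?thesis unfolding weak_derivative_def by simp
qed

text \<open>
  A metric must be symmetric on the whole type, also for functions that have no weak derivatives.
\<close>
lemma sobolev_norm_uminus: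
  fixes f :: "real \<Rightarrow> 'a::euclidean_space"
  shows "sobolev_norm s (\<lambda>u. - f u) = sobolev_norm s f"
proof -
  let ?w = "weak_derivative f" and ?w' = "weak_derivative (\<lambda>u. - f u)"
  have L2_minus: "L2_norm_sq g' = L2_norm_sq g"
    if "AE u in lborel. g' u = - g u" for g g' :: "real \<Rightarrow> 'a"
  proof -
    have "L2_norm_sq g' = L2_norm_sq (\<lambda>u. - g u)" by (rule L2_norm_sq_cong_AE[OF that])
    then show ?thesis by (simp add: L2_norm_sq_def)
  qed
  have 0: "L2_norm_sq (\<lambda>u. - f u) = L2_norm_sq f" by (simp add: L2_norm_sq_def)
  from weak_derivative_uminus_cases[OF has_weak_derivative_uminus_iff, of f]
  show ?thesis
  proof
    assume "?w' = ?w"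
    then show ?thesis by (simp add: sobolev_norm_def 0)
  next
    assume A: "?w \<in> L2_circle \<and> ?w' \<in> L2_circle \<and> (AE u in lborel. ?w' u = - ?w u)"
    then have eq: "AE u in lborel. ?w' u = - ?w u" by blast
    have mL: "(\<lambda>u. - ?w u) \<in> L2_circle" using A L2_circle_scaleR[of ?w "-1"] by simp
    have "gagliardo_sq s ?w' = gagliardo_sq s (\<lambda>u. - ?w u)"
      using A mL by (intro gagliardo_sq_cong_AE eq) (auto simp: L2_circle_iff)
    also have "\<dots> = gagliardo_sq s ?w"
      unfolding gagliardo_sq_def by (simp add: norm_minus_commute)
    finally have 1: "gagliardo_sq s ?w' = gagliardo_sq s ?w" .
    have "has_weak_derivative ?w' g \<longleftrightarrow> has_weak_derivative (\<lambda>u. - ?w u) g" for g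
    proof
      show "has_weak_derivative ?w' g \<Longrightarrow> has_weak_derivative (\<lambda>u. - ?w u) g"
        by (erule has_weak_derivative_AE_cong[OF _ mL eq])
      show "has_weak_derivative (\<lambda>u. - ?w u) g \<Longrightarrow> has_weak_derivative ?w' g"
        using A by (elim has_weak_derivative_AE_cong) (auto elim: eventually_mono)
    qed
    then have "has_weak_derivative ?w' g \<longleftrightarrow> has_weak_derivative ?w (\<lambda>u. - g u)" for g
      by (simp add: has_weak_derivative_uminus_iff)
    from weak_derivative_uminus_cases[OF this]
    have 2: "L2_norm_sq (weak_derivative ?w') = L2_norm_sq (weak_derivative ?w)"
      using L2_minus by auto
    show ?thesis by (simp add: sobolev_norm_def 0 1 2 L2_minus[OF eq])
  qed
qed

definition sobolev_const :: "real \<Rightarrow> real" where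
  "sobolev_const s = 2 + 2 * \<bar>morrey_const s\<bar>"

lemma sup_le_sobolev_energy:
  fixes \<gamma> :: "real \<Rightarrow> 'a::euclidean_space"
  assumes s: "1 / 2 < s" and j: "sobolev_jet s \<gamma> g h"
  shows "norm (\<gamma> u) \<le> sobolev_const s * sqrt (enn2real (sobolev_energy s \<gamma> g h))"
    and "norm (g u) \<le> sobolev_const s * sqrt (enn2real (sobolev_energy s \<gamma> g h))"
proof -
  note J = sobolev_jetD[OF j]
  define E where "E = enn2real (sobolev_energy s \<gamma> g h)"
  have E: "sobolev_energy s \<gamma> g h = ennreal E" "E \<ge> 0"
    using sobolev_energy_finite[OF j] by (auto simp: E_def less_top)
  have sq: "norm x \<le> sobolev_const s * sqrt E"
    if "ennreal ((norm x)\<^sup>2) \<le> 2 * (A + B)" "A + B \<le> sobolev_energy s \<gamma> g h" for x :: 'a and A B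
  proof -
    have "ennreal ((norm x)\<^sup>2) \<le> 2 * ennreal E"
      using that E(1) by (metis mult_left_mono order_trans zero_le)
    also have "\<dots> = ennreal (2 * E)" using E by (simp add: ennreal_mult)
    finally have "(norm x)\<^sup>2 \<le> 2 * E" using E by (subst (asm) ennreal_le_iff) auto
    also have "\<dots> \<le> (2 * sqrt E)\<^sup>2" using E by (simp add: power_mult_distrib)
    finally have "norm x \<le> 2 * sqrt E" by (rule power2_le_imp_le) (use E in simp)
    also have "\<dots> \<le> sobolev_const s * sqrt E"
      using E by (intro mult_right_mono) (auto simp: sobolev_const_def)
    finally show ?thesis .
  qed
  have "norm (\<gamma> u) \<le> sobolev_const s * sqrt E"
    by (rule sq[OF sup_le_L2_norm_sq[OF J(5,6,1)]]) (simp add: sobolev_energy_def)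
  then show "norm (\<gamma> u) \<le> sobolev_const s * sqrt (enn2real (sobolev_energy s \<gamma> g h))" by (simp add: E_def)
  have "norm (g u) \<le> sobolev_const s * sqrt E"
  proof (cases "s < 1")
    case True
    then have fin: "gagliardo_sq s g < \<infinity>" using j by (simp add: sobolev_jet_def)
    obtain g' where g': "\<And>u. (\<gamma> has_vector_derivative g' u) (at u)"
      "\<And>u. norm (g' u) \<le> sqrt (2 * enn2real (L2_norm_sq g)) + morrey_const s * sqrt (2 * enn2real (gagliardo_sq s g))"
      by (rule gagliardo_embedding[OF J(5,6) fin s], rule that)
    have "g' u = g u" using g'(1) J(3) vector_derivative_unique_at by blast
    then have le: "norm (g u) \<le> sqrt (2 * enn2real (L2_norm_sq g)) + morrey_const s * sqrt (2 * enn2real (gagliardo_sq s g))"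
      using g'(2)[of u] by simp
    have part: "sqrt (2 * enn2real X) \<le> 2 * sqrt E" if "X \<le> sobolev_energy s \<gamma> g h" for X
    proof -
      have "enn2real X \<le> E"
        unfolding E_def using that sobolev_energy_finite[OF j] by (intro enn2real_mono) auto
      then have "sqrt (2 * enn2real X) \<le> sqrt (4 * E)" using E by simp
      then show ?thesis by (simp add: real_sqrt_mult)
    qed
    have "norm (g u) \<le> 2 * sqrt E + \<bar>morrey_const s\<bar> * (2 * sqrt E)"
    proof (rule order_trans[OF le add_mono])
      show "sqrt (2 * enn2real (L2_norm_sq g)) \<le> 2 * sqrt E"
        by (rule part) (auto simp: sobolev_energy_def intro: add_increasing add_increasing2)
      have "sqrt (2 * enn2real (gagliardo_sq s g)) \<le> 2 * sqrt E"
        by (rule part) (auto simp: sobolev_energy_def True intro: add_increasing)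
      then show "morrey_const s * sqrt (2 * enn2real (gagliardo_sq s g)) \<le> \<bar>morrey_const s\<bar> * (2 * sqrt E)"
        by (intro mult_mono) auto
    qed
    then show ?thesis by (simp add: sobolev_const_def algebra_simps)
  next
    case False
    then have h: "h \<in> L2_circle" "primitive_of g h" using j by (auto simp: sobolev_jet_def)
    show ?thesis
      by (rule sq[OF sup_le_L2_norm_sq[OF h(2,1) J(4)]])
        (auto simp: sobolev_energy_def False add.assoc intro: add_increasing)
  qed
  then show "norm (g u) \<le> sobolev_const s * sqrt (enn2real (sobolev_energy s \<gamma> g h))" by (simp add: E_def)
qed

definition sobolev_dist :: "real \<Rightarrow> (real \<Rightarrow> 'a::euclidean_space) \<Rightarrow> (real \<Rightarrow> 'a) \<Rightarrow> real" where
  "sobolev_dist s \<gamma> \<eta> = sobolev_norm s (\<lambda>u. \<gamma> u - \<eta> u)"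

lemma sobolev_dist_jet:
  assumes "sobolev_jet s \<gamma> g h" "sobolev_jet s \<gamma>' g' h'"
  shows "sobolev_dist s \<gamma> \<gamma>' = sqrt (enn2real (sobolev_energy s (\<lambda>u. \<gamma> u - \<gamma>' u) (\<lambda>u. g u - g' u) (\<lambda>u. h u - h' u)))"
  unfolding sobolev_dist_def by (rule sobolev_norm_jet[OF sobolev_jet_diff[OF assms]])

lemma Metric_space_sobolev:
  assumes s: "1 / 2 < s" "s \<le> 1"
  shows "Metric_space (sobolev s :: (real \<Rightarrow> 'a::euclidean_space) set) (sobolev_dist s)"
proof
  fix x y z :: "real \<Rightarrow> 'a"
  show "0 \<le> sobolev_dist s x y" by (simp add: sobolev_dist_def sobolev_norm_def)
  show "sobolev_dist s x y = sobolev_dist s y x"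
    using sobolev_norm_uminus[of s "\<lambda>u. x u - y u"] by (simp add: sobolev_dist_def)
  assume x: "x \<in> sobolev s" and y: "y \<in> sobolev s"
  then obtain g h g' h' where j: "sobolev_jet s x g h" "sobolev_jet s y g' h'"
    using sobolev_iff_jet[OF s] by blast
  show "sobolev_dist s x y = 0 \<longleftrightarrow> x = y"
  proof
    assume "sobolev_dist s x y = 0"
    then have "norm (x u - y u) \<le> sobolev_const s * 0" for u
      using sup_le_sobolev_energy(1)[OF s(1) sobolev_jet_diff[OF j], of u] sobolev_dist_jet[OF j] by simp
    then show "x = y" by (simp add: fun_eq_iff)
  next
    assume "x = y"
    then show "sobolev_dist s x y = 0"
      unfolding sobolev_dist_def using sobolev_norm_jet[OF sobolev_jet_const, of s "0::'a"]
      by (simp add: sobolev_energy_def L2_norm_sq_def gagliardo_sq_def)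
  qed
  assume z: "z \<in> sobolev s"
  then obtain g'' h'' where j'': "sobolev_jet s z g'' h''"
    using sobolev_iff_jet[OF s] by blast
  let ?A = "sobolev_energy s (\<lambda>u. x u - y u) (\<lambda>u. g u - g' u) (\<lambda>u. h u - h' u)"
  let ?B = "sobolev_energy s (\<lambda>u. y u - z u) (\<lambda>u. g' u - g'' u) (\<lambda>u. h' u - h'' u)"
  let ?C = "sobolev_energy s (\<lambda>u. x u - z u) (\<lambda>u. g u - g'' u) (\<lambda>u. h u - h'' u)"
  have jA: "sobolev_jet s (\<lambda>u. x u - y u) (\<lambda>u. g u - g' u) (\<lambda>u. h u - h' u)"
    by (rule sobolev_jet_diff[OF j])
  have jB: "sobolev_jet s (\<lambda>u. y u - z u) (\<lambda>u. g' u - g'' u) (\<lambda>u. h' u - h'' u)"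
    by (rule sobolev_jet_diff[OF j(2) j''])
  have fin: "?A < \<infinity>" "?B < \<infinity>"
    by (rule sobolev_energy_finite[OF jA], rule sobolev_energy_finite[OF jB])
  have "sqrt (enn2real ?C) \<le> sqrt (enn2real ?A) + sqrt (enn2real ?B)"
  proof (rule sqrt_le_sqrt_add_sqrt)
    fix t :: real assume "t > 0"
    have "?C \<le> ennreal (1 + t) * ?A + ennreal (1 + 1 / t) * ?B"
      using sobolev_energy_add_le[OF jA jB \<open>t > 0\<close>] by simp
    then have "enn2real ?C \<le> enn2real (ennreal (1 + t) * ?A + ennreal (1 + 1 / t) * ?B)"
      using fin by (intro enn2real_mono) (auto simp: ennreal_mult_less_top)
    also have "\<dots> = (1 + t) * enn2real ?A + (1 + 1 / t) * enn2real ?B"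
      using fin \<open>t > 0\<close> by (subst enn2real_plus) (auto simp: ennreal_mult_less_top enn2real_mult simp del: ennreal_plus)
    finally show "enn2real ?C \<le> (1 + t) * enn2real ?A + (1 + 1 / t) * enn2real ?B" .
  qed auto
  then show "sobolev_dist s x z \<le> sobolev_dist s x y + sobolev_dist s y z"
    by (simp add: sobolev_dist_jet[OF j] sobolev_dist_jet[OF j(2) j''] sobolev_dist_jet[OF j(1) j''])
qed

lemma sobolev_topology_eq: "sobolev_topology s = Metric_space.mtopology (sobolev s) (sobolev_dist s)"
  unfolding sobolev_topology_def sobolev_dist_def ..

lemma topspace_sobolev_topology:
  assumes "1 / 2 < s" "s \<le> 1"
  shows "topspace (sobolev_topology s) = sobolev s"
proof -
  interpret Metric_space "sobolev s" "sobolev_dist s" by (rule Metric_space_sobolev[OF assms])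
  show ?thesis by (simp add: sobolev_topology_eq)
qed

lemma sobolev_dist_tendsto_iff:
  assumes "\<And>k. sobolev_jet s (\<gamma> k) (g k) (h k)" "sobolev_jet s \<gamma>' g' h'"
  shows "(\<lambda>k. sobolev_dist s (\<gamma> k) \<gamma>') \<longlonglongrightarrow> 0 \<longleftrightarrow>
    (\<lambda>k. sobolev_energy s (\<lambda>u. \<gamma> k u - \<gamma>' u) (\<lambda>u. g k u - g' u) (\<lambda>u. h k u - h' u)) \<longlonglongrightarrow> 0"
    (is "?l \<longlonglongrightarrow> 0 \<longleftrightarrow> ?E \<longlonglongrightarrow> 0")
proof -
  have E: "?E k = ennreal (enn2real (?E k))" for k
    using sobolev_energy_finite[OF sobolev_jet_diff[OF assms(1) assms(2)], of k] by (simp add: less_top)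
  have "?l \<longlonglongrightarrow> 0 \<longleftrightarrow> (\<lambda>k. sqrt (enn2real (?E k))) \<longlonglongrightarrow> 0"
    by (simp add: sobolev_dist_jet[OF assms(1) assms(2)])
  also have "\<dots> \<longleftrightarrow> (\<lambda>k. enn2real (?E k)) \<longlonglongrightarrow> 0"
  proof
    assume "(\<lambda>k. sqrt (enn2real (?E k))) \<longlonglongrightarrow> 0"
    from tendsto_power[OF this, of 2] show "(\<lambda>k. enn2real (?E k)) \<longlonglongrightarrow> 0" by simp
  next
    assume "(\<lambda>k. enn2real (?E k)) \<longlonglongrightarrow> 0"
    from tendsto_real_sqrt[OF this] show "(\<lambda>k. sqrt (enn2real (?E k))) \<longlonglongrightarrow> 0" by simp
  qed
  also have "\<dots> \<longleftrightarrow> ?E \<longlonglongrightarrow> 0"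
    by (subst (2) E) (simp add: ennreal_tendsto_0_iff)
  finally show ?thesis .
qed

section \<open>The Gagliardo seminorm under circle diffeomorphisms\<close>

text \<open>
  Dominated convergence with convergent dominating functions. Truncating \<open>u i\<close> at \<open>w'\<close> gives a sequence
  with a fixed dominating function; the remainder is at most \<open>w i - min (w i) w'\<close>, whose integral tends to 0.
\<close>
lemma nn_integral_dominated_convergence_Pratt:
  fixes u w :: "nat \<Rightarrow> 'b \<Rightarrow> ennreal"
  assumes [measurable]: "\<And>i. u i \<in> borel_measurable M" "u' \<in> borel_measurable M"
      "\<And>i. w i \<in> borel_measurable M" "w' \<in> borel_measurable M"
    and bound: "\<And>i x. x \<in> space M \<Longrightarrow> u i x \<le> w i x"
    and lim_u: "\<And>x. x \<in> space M \<Longrightarrow> (\<lambda>i. u i x) \<longlonglongrightarrow> u' x"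
    and lim_w: "\<And>x. x \<in> space M \<Longrightarrow> (\<lambda>i. w i x) \<longlonglongrightarrow> w' x"
    and fin: "(\<integral>\<^sup>+ x. w' x \<partial>M) < \<infinity>" and lim_int: "(\<lambda>i. \<integral>\<^sup>+ x. w i x \<partial>M) \<longlonglongrightarrow> (\<integral>\<^sup>+ x. w' x \<partial>M)"
  shows "(\<lambda>i. \<integral>\<^sup>+ x. u i x \<partial>M) \<longlonglongrightarrow> (\<integral>\<^sup>+ x. u' x \<partial>M)"
proof -
  have le: "u' x \<le> w' x" if "x \<in> space M" for x
    using lim_u[OF that] lim_w[OF that] bound[OF that] by (intro LIMSEQ_le) auto
  have u_min: "(\<lambda>i. \<integral>\<^sup>+ x. min (u i x) (w' x) \<partial>M) \<longlonglongrightarrow> (\<integral>\<^sup>+ x. u' x \<partial>M)"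
  proof (rule nn_integral_dominated_convergence[where w = w'])
    show "AE x in M. (\<lambda>i. min (u i x) (w' x)) \<longlonglongrightarrow> u' x"
    proof (rule AE_I2)
      fix x assume x: "x \<in> space M"
      have "(\<lambda>i. min (u i x) (w' x)) \<longlonglongrightarrow> min (u' x) (w' x)"
        by (intro tendsto_min lim_u x tendsto_const)
      then show "(\<lambda>i. min (u i x) (w' x)) \<longlonglongrightarrow> u' x" using le[OF x] by (simp add: min_absorb1)
    qed
  qed (use fin in auto)
  have w_min: "(\<lambda>i. \<integral>\<^sup>+ x. min (w i x) (w' x) \<partial>M) \<longlonglongrightarrow> (\<integral>\<^sup>+ x. w' x \<partial>M)"
  proof (rule nn_integral_dominated_convergence[where w = w'])
    show "AE x in M. (\<lambda>i. min (w i x) (w' x)) \<longlonglongrightarrow> w' x"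
    proof (rule AE_I2)
      fix x assume x: "x \<in> space M"
      have "(\<lambda>i. min (w i x) (w' x)) \<longlonglongrightarrow> min (w' x) (w' x)"
        by (intro tendsto_min lim_w x tendsto_const)
      then show "(\<lambda>i. min (w i x) (w' x)) \<longlonglongrightarrow> w' x" by simp
    qed
  qed (use fin in auto)
  have "(\<lambda>i. (\<integral>\<^sup>+ x. w i x \<partial>M) - (\<integral>\<^sup>+ x. min (w i x) (w' x) \<partial>M)) \<longlonglongrightarrow> (\<integral>\<^sup>+ x. w' x \<partial>M) - (\<integral>\<^sup>+ x. w' x \<partial>M)"
    using fin by (intro tendsto_diff_ennreal_general lim_int w_min) auto
  also have "(\<integral>\<^sup>+ x. w' x \<partial>M) - (\<integral>\<^sup>+ x. w' x \<partial>M) = 0" using fin by (simp add: less_top)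
  finally have "(\<lambda>i. (\<integral>\<^sup>+ x. min (u i x) (w' x) \<partial>M) + ((\<integral>\<^sup>+ x. w i x \<partial>M) - (\<integral>\<^sup>+ x. min (w i x) (w' x) \<partial>M)))
      \<longlonglongrightarrow> (\<integral>\<^sup>+ x. u' x \<partial>M) + 0"
    by (intro tendsto_add u_min)
  then have upper: "(\<lambda>i. (\<integral>\<^sup>+ x. min (u i x) (w' x) \<partial>M) + ((\<integral>\<^sup>+ x. w i x \<partial>M) - (\<integral>\<^sup>+ x. min (w i x) (w' x) \<partial>M)))
      \<longlonglongrightarrow> (\<integral>\<^sup>+ x. u' x \<partial>M)" by simp
  show ?thesis
  proof (rule tendsto_sandwich[OF _ _ u_min upper])
    show "\<forall>\<^sub>F i in sequentially. (\<integral>\<^sup>+ x. min (u i x) (w' x) \<partial>M) \<le> (\<integral>\<^sup>+ x. u i x \<partial>M)"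
      by (intro always_eventually allI nn_integral_mono) simp
    show "\<forall>\<^sub>F i in sequentially. (\<integral>\<^sup>+ x. u i x \<partial>M)
      \<le> (\<integral>\<^sup>+ x. min (u i x) (w' x) \<partial>M) + ((\<integral>\<^sup>+ x. w i x \<partial>M) - (\<integral>\<^sup>+ x. min (w i x) (w' x) \<partial>M))"
    proof (intro always_eventually allI)
      fix i
      have min_fin: "(\<integral>\<^sup>+ x. min (w i x) (w' x) \<partial>M) \<noteq> \<infinity>"
        using fin nn_integral_mono[of M "\<lambda>x. min (w i x) (w' x)" w'] by (auto simp: less_top top_unique)
      have "(\<integral>\<^sup>+ x. u i x \<partial>M) \<le> (\<integral>\<^sup>+ x. min (u i x) (w' x) + (w i x - min (w i x) (w' x)) \<partial>M)"
      proof (rule nn_integral_mono)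
        fix x assume x: "x \<in> space M"
        show "u i x \<le> min (u i x) (w' x) + (w i x - min (w i x) (w' x))"
        proof (cases "u i x \<le> w' x")
          case True then show ?thesis by (simp add: min_def)
        next
          case False
          then have "w' x \<le> u i x" "w' x \<le> w i x" using bound[OF x, of i] by auto
          then have "min (u i x) (w' x) + (w i x - min (w i x) (w' x)) = w i x"
            by (simp add: min_absorb2 add_diff_inverse_ennreal)
          then show ?thesis using bound[OF x] by simp
        qed
      qed
      also have "\<dots> = (\<integral>\<^sup>+ x. min (u i x) (w' x) \<partial>M) + (\<integral>\<^sup>+ x. w i x - min (w i x) (w' x) \<partial>M)"
        by (rule nn_integral_add) auto
      also have "(\<integral>\<^sup>+ x. w i x - min (w i x) (w' x) \<partial>M) = (\<integral>\<^sup>+ x. w i x \<partial>M) - (\<integral>\<^sup>+ x. min (w i x) (w' x) \<partial>M)"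
        by (rule nn_integral_diff) (use min_fin in auto)
      finally show "(\<integral>\<^sup>+ x. u i x \<partial>M)
        \<le> (\<integral>\<^sup>+ x. min (u i x) (w' x) \<partial>M) + ((\<integral>\<^sup>+ x. w i x \<partial>M) - (\<integral>\<^sup>+ x. min (w i x) (w' x) \<partial>M))" .
    qed
  qed
qed

lemma periodic1_of_int: "periodic1 f \<Longrightarrow> f (x + of_int m) = f x"
proof -
  assume "periodic1 f"
  then interpret periodic_fun_simple' f .
  show ?thesis by (rule plus_of_int)
qed

text \<open>
  A lift to the line of an orientation preserving diffeomorphism of the circle that fixes 0. The bounds
  \<open>c\<close> and \<open>C\<close> are parameters so that they can be shared by all members of a sequence.
\<close>
locale circle_diffeo =
  fixes \<theta> \<theta>' :: "real \<Rightarrow> real" and c C :: real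
  assumes deriv: "\<And>t. (\<theta> has_real_derivative \<theta>' t) (at t)"
    and cont': "continuous_on UNIV \<theta>'"
    and c_pos: "c > 0" and lower: "\<And>t. c \<le> \<theta>' t" and upper: "\<And>t. \<theta>' t \<le> C"
    and plus_1: "\<And>t. \<theta> (t + 1) = \<theta> t + 1" and zero: "\<theta> 0 = 0"
begin

abbreviation inverse_map :: "real \<Rightarrow> real" where
  "inverse_map \<equiv> inv \<theta>"

lemma C_pos: "C > 0"
  using c_pos lower[of 0] upper[of 0] by linarith

lemma continuous: "continuous_on A \<theta>"
  by (meson DERIV_isCont continuous_at_imp_continuous_on deriv)

lemma derivative_pos: "\<theta>' t > 0"
  using c_pos lower[of t] by linarith

lemma expands: "x \<le> y \<Longrightarrow> c * (y - x) \<le> \<theta> y - \<theta> x"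
proof (cases "x < y")
  case True
  then obtain z where "\<theta> y - \<theta> x = (y - x) * \<theta>' z" using MVT2[of x y \<theta> \<theta>'] deriv by blast
  then show ?thesis using True lower[of z] by (simp add: mult.commute)
qed auto

lemma abs_expands: "c * \<bar>x - y\<bar> \<le> \<bar>\<theta> x - \<theta> y\<bar>"
  using expands[of x y] expands[of y x] c_pos
  by (cases "x \<le> y") (auto simp: abs_if not_le mult_less_0_iff split: if_splits)

lemma inj: "inj \<theta>"
proof (rule injI)
  fix x y assume "\<theta> x = \<theta> y"
  then show "x = y" using abs_expands[of x y] c_pos by (simp add: mult_le_0_iff)
qed

lemma surj: "surj \<theta>"
proof (unfold surj_def, rule allI)
  fix t
  let ?a = "\<bar>t\<bar> / c"
  have a: "?a \<ge> 0" using c_pos by simp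
  have "\<exists>x. - ?a \<le> x \<and> x \<le> ?a \<and> \<theta> x = t"
  proof (rule IVT')
    show "\<theta> (- ?a) \<le> t" using expands[of "- ?a" 0] a c_pos zero by (simp add: abs_if split: if_splits)
    show "t \<le> \<theta> ?a" using expands[of 0 ?a] a c_pos zero by (simp add: abs_if split: if_splits)
  qed (use a continuous in auto)
  then show "\<exists>x. t = \<theta> x" by blast
qed

lemma inverse_map_left [simp]: "inverse_map (\<theta> x) = x"
  by (simp add: inj)

lemma inverse_map_right [simp]: "\<theta> (inverse_map t) = t"
  by (simp add: surj surj_f_inv_f)

lemma inverse_map_lipschitz: "c * \<bar>inverse_map s - inverse_map t\<bar> \<le> \<bar>s - t\<bar>"
  using abs_expands[of "inverse_map s" "inverse_map t"] by simp

lemma inverse_map_isCont: "isCont inverse_map t"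
  unfolding continuous_at_eps_delta
proof (intro allI impI)
  fix e :: real assume "e > 0"
  show "\<exists>d>0. \<forall>x'. dist x' t < d \<longrightarrow> dist (inverse_map x') (inverse_map t) < e"
  proof (intro exI[of _ "c * e"] conjI allI impI)
    show "c * e > 0" using c_pos \<open>e > 0\<close> by simp
    fix x' assume "dist x' t < c * e"
    then have "c * \<bar>inverse_map x' - inverse_map t\<bar> < c * e"
      using inverse_map_lipschitz[of x' t] by (simp add: dist_real_def)
    then show "dist (inverse_map x') (inverse_map t) < e"
      using c_pos by (simp add: dist_real_def)
  qed
qed

lemma inverse_map_continuous: "continuous_on A inverse_map"
  using inverse_map_isCont by (simp add: continuous_at_imp_continuous_on)

lemma inverse_map_deriv: "(inverse_map has_real_derivative inverse (\<theta>' (inverse_map t))) (at t)"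
  by (rule DERIV_inverse_function[where f = \<theta> and a = "t - 1" and b = "t + 1"])
    (use deriv derivative_pos[of "inverse_map t"] inverse_map_isCont in auto)

lemma inverse_map_plus_1: "inverse_map (t + 1) = inverse_map t + 1"
  by (metis inverse_map_left inverse_map_right plus_1)

lemma inverse_map_zero: "inverse_map 0 = 0"
  by (metis inverse_map_left zero)

lemma one: "\<theta> 1 = 1"
  using plus_1[of 0] zero by simp

lemma plus_of_int: "\<theta> (t + of_int n) = \<theta> t + of_int n"
proof (induction n rule: int_induct[where k = 0])
  case (step1 i)
  then show ?case using plus_1[of "t + of_int i"] by (simp add: add.assoc)
next
  case (step2 i)
  then show ?case using plus_1[of "t + of_int (i - 1)"] by (simp add: add.assoc)
qed simp

lemma mono: "x \<le> y \<Longrightarrow> \<theta> x \<le> \<theta> y"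
  using expands[of x y] c_pos by (smt (verit) mult_nonneg_nonneg)

lemma inverse_map_mono: "s \<le> t \<Longrightarrow> inverse_map s \<le> inverse_map t"
  using mono[of "inverse_map t" "inverse_map s"] by (metis inverse_map_right linear order_antisym)

lemma inverse_map_less_1: "t \<in> {0..<1} \<Longrightarrow> inverse_map t \<in> {0..<1}"
proof -
  assume t: "t \<in> {0..<1}"
  have "0 \<le> inverse_map t" using inverse_map_mono[of 0 t] t inverse_map_zero by simp
  moreover have "inverse_map t < 1"
  proof (rule ccontr)
    assume "\<not> inverse_map t < 1"
    then have "\<theta> 1 \<le> \<theta> (inverse_map t)" by (intro mono) simp
    then show False using t one by simp
  qed
  ultimately show ?thesis by simp
qed

lemma periodic_compose: "periodic1 f \<Longrightarrow> periodic1 (\<lambda>t. f (inverse_map t))"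
  by (rule periodic1I) (simp add: inverse_map_plus_1 periodic1D)

text \<open>
  The nearest integer \<open>m\<close> to \<open>\<theta> u - \<theta> v\<close> can be absorbed: \<open>\<theta> v + m = \<theta> (v + m)\<close>.
\<close>
lemma infdist_expands: "c * infdist (u - v) \<int> \<le> infdist (\<theta> u - \<theta> v) \<int>"
proof -
  obtain m where m: "infdist (\<theta> u - \<theta> v) \<int> = \<bar>(\<theta> u - \<theta> v) - of_int m\<bar>"
    by (rule infdist_Ints_attained)
  have "c * infdist (u - v) \<int> \<le> c * \<bar>u - v - of_int m\<bar>"
    using infdist_Ints_le c_pos by (intro mult_left_mono) auto
  also have "\<dots> \<le> \<bar>\<theta> u - \<theta> (v + of_int m)\<bar>"
    using abs_expands[of u "v + of_int m"] by (simp add: algebra_simps)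
  also have "\<dots> = infdist (\<theta> u - \<theta> v) \<int>" by (simp add: m plus_of_int algebra_simps)
  finally show ?thesis .
qed

lemma circle_kernel_le:
  assumes "s > 0"
  shows "circle_kernel s (\<theta> v - \<theta> u) \<le> c powr (- (1 + 2 * s)) * circle_kernel s (v - u)"
proof (cases "v - u \<in> \<int>")
  case True
  then obtain m where "v = u + of_int m" by (metis Ints_cases add.commute diff_add_cancel)
  then have "\<theta> v - \<theta> u = of_int m" by (simp add: plus_of_int)
  then show ?thesis by (simp add: circle_kernel_def)
next
  case False
  then have pos: "infdist (v - u) \<int> > 0" by (rule infdist_Ints_pos)
  have pos': "infdist (\<theta> v - \<theta> u) \<int> > 0"
    using infdist_expands[of v u] mult_pos_pos[OF c_pos pos] by linarith
  have "(c * infdist (v - u) \<int>) powr (1 + 2 * s) \<le> infdist (\<theta> v - \<theta> u) \<int> powr (1 + 2 * s)"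
    using c_pos pos assms by (intro powr_mono2 infdist_expands) auto
  then have "1 / infdist (\<theta> v - \<theta> u) \<int> powr (1 + 2 * s) \<le> 1 / (c * infdist (v - u) \<int>) powr (1 + 2 * s)"
    using c_pos pos pos' by (intro divide_left_mono) auto
  also have "\<dots> = c powr (- (1 + 2 * s)) * (1 / infdist (v - u) \<int> powr (1 + 2 * s))"
    unfolding powr_minus[of c] using c_pos pos by (subst powr_mult) (auto simp: divide_inverse)
  finally show ?thesis by (simp add: circle_kernel_def)
qed

lemma borel_measurables [measurable]:
  "\<theta> \<in> borel_measurable borel" "\<theta>' \<in> borel_measurable borel" "inverse_map \<in> borel_measurable borel"
  using continuous cont' inverse_map_continuous by (auto intro: borel_measurable_continuous_onI)

lemma nn_integral_change_of_variables:
  assumes [measurable]: "F \<in> borel_measurable borel"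
  shows "(\<integral>\<^sup>+ t\<in>{0..1}. F t \<partial>lborel) = (\<integral>\<^sup>+ u\<in>{0..1}. F (\<theta> u) * ennreal (\<theta>' u) \<partial>lborel)"
  using nn_integral_substitution_aux[of F 0 1 \<theta> \<theta>'] deriv cont' derivative_pos zero one
  by (auto simp: less_imp_le intro: continuous_on_subset)

lemma gagliardo_sq_compose:
  fixes f :: "real \<Rightarrow> 'a::euclidean_space"
  assumes per: "periodic1 f" and [measurable]: "f \<in> borel_measurable borel"
  shows "gagliardo_sq s (\<lambda>t. f (inverse_map t)) = (\<integral>\<^sup>+ (u, v).
     ennreal ((norm (f v - f u))\<^sup>2 * circle_kernel s (\<theta> v - \<theta> u) * (\<theta>' u * \<theta>' v))
     * indicator ({0..1} \<times> {0..1}) (u, v) \<partial>(lborel \<Otimes>\<^sub>M lborel))"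
proof -
  have [measurable]: "(\<lambda>t. f (inverse_map t)) \<in> borel_measurable borel" by measurable
  define P where "P u t = ennreal ((norm (f (inverse_map t) - f u))\<^sup>2 * circle_kernel s (t - \<theta> u))" for u t
  have [measurable]: "case_prod P \<in> borel_measurable (borel \<Otimes>\<^sub>M borel)" "P u \<in> borel_measurable borel" for u
    unfolding P_def by measurable
  have "gagliardo_sq s (\<lambda>t. f (inverse_map t))
    = (\<integral>\<^sup>+ r\<in>{0..1}. (\<integral>\<^sup>+ t\<in>{0..1}. P (inverse_map r) t \<partial>lborel) \<partial>lborel)"
    unfolding P_def using gagliardo_sq_kernel[OF periodic_compose[OF per], of s 0] by simp
  also have "\<dots> = (\<integral>\<^sup>+ u\<in>{0..1}. (\<integral>\<^sup>+ t\<in>{0..1}. P u t \<partial>lborel) * ennreal (\<theta>' u) \<partial>lborel)"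
    by (subst nn_integral_change_of_variables) auto
  also have "\<dots> = (\<integral>\<^sup>+ u\<in>{0..1}. (\<integral>\<^sup>+ v\<in>{0..1}. P u (\<theta> v) * ennreal (\<theta>' v) \<partial>lborel) * ennreal (\<theta>' u) \<partial>lborel)"
    by (subst nn_integral_change_of_variables) auto
  also have "\<dots> = (\<integral>\<^sup>+ u. \<integral>\<^sup>+ v. ennreal ((norm (f v - f u))\<^sup>2 * circle_kernel s (\<theta> v - \<theta> u) * (\<theta>' u * \<theta>' v))
     * indicator ({0..1} \<times> {0..1}) (u, v) \<partial>lborel \<partial>lborel)"
  proof (rule nn_integral_cong)
    fix u
    have "(\<integral>\<^sup>+ v\<in>{0..1}. P u (\<theta> v) * ennreal (\<theta>' v) \<partial>lborel) * ennreal (\<theta>' u) * indicator {0..1} u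
      = (\<integral>\<^sup>+ v. (P u (\<theta> v) * ennreal (\<theta>' v) * indicator {0..1} v) * (ennreal (\<theta>' u) * indicator {0..1} u) \<partial>lborel)"
      by (subst nn_integral_multc) (auto simp: mult.assoc)
    also have "\<dots> = (\<integral>\<^sup>+ v. ennreal ((norm (f v - f u))\<^sup>2 * circle_kernel s (\<theta> v - \<theta> u) * (\<theta>' u * \<theta>' v))
     * indicator ({0..1} \<times> {0..1}) (u, v) \<partial>lborel)"
      using derivative_pos
      by (intro nn_integral_cong)
        (auto split: split_indicator simp: P_def ennreal_mult[symmetric] less_imp_le mult_ac)
    finally show "(\<integral>\<^sup>+ v\<in>{0..1}. P u (\<theta> v) * ennreal (\<theta>' v) \<partial>lborel) * ennreal (\<theta>' u) * indicator {0..1} u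
      = (\<integral>\<^sup>+ v. ennreal ((norm (f v - f u))\<^sup>2 * circle_kernel s (\<theta> v - \<theta> u) * (\<theta>' u * \<theta>' v))
     * indicator ({0..1} \<times> {0..1}) (u, v) \<partial>lborel)" .
  qed
  also have "\<dots> = (\<integral>\<^sup>+ (u, v).
     ennreal ((norm (f v - f u))\<^sup>2 * circle_kernel s (\<theta> v - \<theta> u) * (\<theta>' u * \<theta>' v))
     * indicator ({0..1} \<times> {0..1}) (u, v) \<partial>(lborel \<Otimes>\<^sub>M lborel))"
    by (subst lborel.nn_integral_fst[symmetric]) auto
  finally show ?thesis .
qed

lemma L2_norm_sq_compose_le:
  fixes f :: "real \<Rightarrow> 'a::euclidean_space"
  assumes [measurable]: "f \<in> borel_measurable borel"
  shows "L2_norm_sq (\<lambda>t. f (inverse_map t)) \<le> ennreal C * L2_norm_sq f"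
proof -
  have "L2_norm_sq (\<lambda>t. f (inverse_map t)) = (\<integral>\<^sup>+ u\<in>{0..1}. ennreal ((norm (f u))\<^sup>2) * ennreal (\<theta>' u) \<partial>lborel)"
    unfolding L2_norm_sq_def by (subst nn_integral_change_of_variables) auto
  also have "\<dots> \<le> (\<integral>\<^sup>+ u. ennreal C * (ennreal ((norm (f u))\<^sup>2) * indicator {0..1} u) \<partial>lborel)"
    using upper by (intro nn_integral_mono)
      (auto split: split_indicator simp: mult.commute[of "ennreal C"] intro!: mult_left_mono ennreal_leI)
  also have "\<dots> = ennreal C * L2_norm_sq f"
    unfolding L2_norm_sq_def by (rule nn_integral_cmult) auto
  finally show ?thesis .
qed

end

text \<open>
  The uniform lower bound for the derivatives turns convergence of the maps into convergence of the inverses.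
\<close>
lemma inverse_map_tendsto:
  assumes k: "\<And>k. circle_diffeo (X k) (X' k) c C" and lim: "circle_diffeo \<theta> \<theta>' c C"
    and conv: "\<And>t. (\<lambda>k. X k t) \<longlonglongrightarrow> \<theta> t"
  shows "(\<lambda>k. inv (X k) t) \<longlonglongrightarrow> inv \<theta> t"
proof -
  interpret k: circle_diffeo "X k" "X' k" c C for k by (rule k)
  interpret circle_diffeo \<theta> \<theta>' c C by (rule lim)
  let ?x = "inverse_map t"
  have "(\<lambda>k. \<bar>t - X k ?x\<bar> / c) \<longlonglongrightarrow> \<bar>t - \<theta> ?x\<bar> / c"
    by (intro tendsto_intros conv) (use c_pos in auto)
  then have "(\<lambda>k. \<bar>t - X k ?x\<bar> / c) \<longlonglongrightarrow> 0" by simp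
  moreover have "norm (k.inverse_map k t - ?x) \<le> \<bar>t - X k ?x\<bar> / c" for k
    using k.abs_expands[where k = k and x = "k.inverse_map k t" and y = ?x] c_pos by (simp add: field_simps)
  ultimately have "(\<lambda>k. k.inverse_map k t - ?x) \<longlonglongrightarrow> 0"
    by (intro Lim_null_comparison[of "\<lambda>k. k.inverse_map k t - ?x"]) auto
  then show ?thesis by (rule LIM_zero_cancel)
qed

lemma circle_kernel_tendsto:
  assumes "w \<notin> \<int>" "x \<longlonglongrightarrow> w"
  shows "(\<lambda>k. circle_kernel s (x k)) \<longlonglongrightarrow> circle_kernel s w"
  unfolding circle_kernel_def
  using infdist_Ints_pos[OF assms(1)] by (intro tendsto_intros assms(2)) auto

text \<open>
  After the substitution the diffeomorphisms occur only in the kernel and in the densities, where they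
  converge pointwise and are bounded by a constant times the original kernel. The differences of
  \<open>g k\<close> are dominated by those of the fixed function \<open>f\<close> and those of \<open>g k - f\<close>, which tend to 0 in the mean.
\<close>
lemma gagliardo_sq_compose_tendsto:
  fixes g :: "nat \<Rightarrow> real \<Rightarrow> 'a::euclidean_space" and f :: "real \<Rightarrow> 'a"
  assumes s: "s > 0"
    and k: "\<And>k. circle_diffeo (X k) (X' k) c C" and lim: "circle_diffeo \<theta> \<theta>' c C"
    and conv: "\<And>t. (\<lambda>k. X k t) \<longlonglongrightarrow> \<theta> t" "\<And>t. (\<lambda>k. X' k t) \<longlonglongrightarrow> \<theta>' t"
    and per: "\<And>k. periodic1 (g k)" "periodic1 f"
    and meas[measurable]: "\<And>k. g k \<in> borel_measurable borel" "f \<in> borel_measurable borel"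
    and fin: "gagliardo_sq s f < \<infinity>" and gag: "(\<lambda>k. gagliardo_sq s (\<lambda>u. g k u - f u)) \<longlonglongrightarrow> 0"
    and ptw: "\<And>t. (\<lambda>k. g k t) \<longlonglongrightarrow> f t"
  shows "(\<lambda>k. gagliardo_sq s (\<lambda>t. g k (inv (X k) t)))
      \<longlonglongrightarrow> gagliardo_sq s (\<lambda>t. f (inv \<theta> t))"
    and "gagliardo_sq s (\<lambda>t. f (inv \<theta> t)) < \<infinity>"
proof -
  interpret k: circle_diffeo "X k" "X' k" c C for k by (rule k)
  interpret circle_diffeo \<theta> \<theta>' c C by (rule lim)
  let ?I = "indicator ({0..1} \<times> {0..1}) :: real \<times> real \<Rightarrow> ennreal"
  let ?M = "(lborel :: real measure) \<Otimes>\<^sub>M (lborel :: real measure)"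
  \<comment> \<open>The kernel and the two densities of the substitution together cost at most the factor \<open>A\<close>.\<close>
  define A where "A = c powr (- (1 + 2 * s)) * (C * C)"
  have A: "A \<ge> 0" using C_pos by (simp add: A_def)
  define W where "W p = ennreal ((norm (f (snd p) - f (fst p)))\<^sup>2 * circle_kernel s (snd p - fst p)) * ?I p" for p
  define R where "R k p = ennreal ((norm ((g k (snd p) - f (snd p)) - (g k (fst p) - f (fst p))))\<^sup>2
      * circle_kernel s (snd p - fst p)) * ?I p" for k p
  define U where "U k p = ennreal ((norm (g k (snd p) - g k (fst p)))\<^sup>2
      * circle_kernel s (X k (snd p) - X k (fst p)) * (X' k (fst p) * X' k (snd p))) * ?I p" for k p
  define U' where "U' p = ennreal ((norm (f (snd p) - f (fst p)))\<^sup>2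
      * circle_kernel s (\<theta> (snd p) - \<theta> (fst p)) * (\<theta>' (fst p) * \<theta>' (snd p))) * ?I p" for p
  have [measurable]: "W \<in> borel_measurable ?M" "R k \<in> borel_measurable ?M" "U k \<in> borel_measurable ?M"
    "U' \<in> borel_measurable ?M" for k
    unfolding W_def R_def U_def U'_def by measurable
  have W_int: "(\<integral>\<^sup>+ p. W p \<partial>?M) = gagliardo_sq s f"
    unfolding W_def gagliardo_sq_pair[OF per(2) meas(2)] by (simp add: case_prod_beta')
  have R_int: "(\<integral>\<^sup>+ p. R k p \<partial>?M) = gagliardo_sq s (\<lambda>u. g k u - f u)" for k
  proof -
    have "periodic1 (\<lambda>u. g k u - f u)"
      by (rule periodic1I) (simp add: periodic1D[OF per(1)] periodic1D[OF per(2)])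
    then show ?thesis unfolding R_def by (subst gagliardo_sq_pair) (auto simp: case_prod_beta')
  qed
  have U_int: "(\<integral>\<^sup>+ p. U k p \<partial>?M) = gagliardo_sq s (\<lambda>t. g k (k.inverse_map k t))" for k
    unfolding U_def k.gagliardo_sq_compose[OF per(1) meas(1)] by (simp add: case_prod_beta')
  have U'_int: "(\<integral>\<^sup>+ p. U' p \<partial>?M) = gagliardo_sq s (\<lambda>t. f (inverse_map t))"
    unfolding U'_def gagliardo_sq_compose[OF per(2) meas(2)] by (simp add: case_prod_beta')
  have kernel_bound: "circle_kernel s (Y v - Y u) * (Y' u * Y' v) \<le> A * circle_kernel s (v - u)"
    if "circle_diffeo Y Y' c C" for Y Y' u v
  proof -
    interpret Y: circle_diffeo Y Y' c C by (rule that)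
    have "circle_kernel s (Y v - Y u) * (Y' u * Y' v)
        \<le> (c powr (- (1 + 2 * s)) * circle_kernel s (v - u)) * (C * C)"
      using Y.upper Y.derivative_pos Y.C_pos
      by (intro mult_mono Y.circle_kernel_le s) (auto simp: less_imp_le)
    then show ?thesis by (simp add: A_def mult_ac)
  qed
  have U_le: "U k p \<le> ennreal (2 * A) * W p + ennreal (2 * A) * R k p" for k p
  proof -
    obtain u v where p: "p = (u, v)" by (cases p)
    let ?K = "circle_kernel s (v - u)"
    have "(norm (g k v - g k u))\<^sup>2 = (norm ((f v - f u) + ((g k v - f v) - (g k u - f u))))\<^sup>2" by simp
    also have "\<dots> \<le> (1 + 1) * (norm (f v - f u))\<^sup>2 + (1 + 1 / 1) * (norm ((g k v - f v) - (g k u - f u)))\<^sup>2"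
      by (rule norm_add_sq_le) simp
    finally have 1: "(norm (g k v - g k u))\<^sup>2 \<le> 2 * (norm (f v - f u))\<^sup>2 + 2 * (norm ((g k v - f v) - (g k u - f u)))\<^sup>2"
      by simp
    have "(norm (g k v - g k u))\<^sup>2 * (circle_kernel s (X k v - X k u) * (X' k u * X' k v))
       \<le> (2 * (norm (f v - f u))\<^sup>2 + 2 * (norm ((g k v - f v) - (g k u - f u)))\<^sup>2) * (A * ?K)"
      using k.derivative_pos
      by (intro mult_mono[OF 1 kernel_bound[OF k]] mult_nonneg_nonneg) (auto simp: less_imp_le)
    also have "\<dots> = (2 * A) * ((norm (f v - f u))\<^sup>2 * ?K) + (2 * A) * ((norm ((g k v - f v) - (g k u - f u)))\<^sup>2 * ?K)"
      by (simp add: algebra_simps)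
    finally have "ennreal ((norm (g k v - g k u))\<^sup>2 * circle_kernel s (X k v - X k u) * (X' k u * X' k v))
      \<le> ennreal ((2 * A) * ((norm (f v - f u))\<^sup>2 * ?K) + (2 * A) * ((norm ((g k v - f v) - (g k u - f u)))\<^sup>2 * ?K))"
      by (intro ennreal_leI) (simp add: mult.assoc)
    also have "\<dots> = ennreal (2 * A) * ennreal ((norm (f v - f u))\<^sup>2 * ?K)
        + ennreal (2 * A) * ennreal ((norm ((g k v - f v) - (g k u - f u)))\<^sup>2 * ?K)"
      using A by (subst ennreal_plus) (auto simp: ennreal_mult)
    finally show ?thesis
      unfolding p U_def W_def R_def by (auto split: split_indicator)
  qed
  have R_lim: "(\<lambda>k. R k p) \<longlonglongrightarrow> 0" for p
  proof -
    have "(\<lambda>k. ennreal ((norm ((g k (snd p) - f (snd p)) - (g k (fst p) - f (fst p))))\<^sup>2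
      * circle_kernel s (snd p - fst p)) * ?I p) \<longlonglongrightarrow> ennreal ((norm ((f (snd p) - f (snd p)) - (f (fst p) - f (fst p))))\<^sup>2
      * circle_kernel s (snd p - fst p)) * ?I p"
      by (intro tendsto_mult_ennreal tendsto_ennrealI tendsto_intros ptw) (auto split: split_indicator)
    then show ?thesis by (simp add: R_def)
  qed
  have U_lim: "(\<lambda>k. U k p) \<longlonglongrightarrow> U' p" for p
  proof -
    obtain u v where p: "p = (u, v)" by (cases p)
    show ?thesis
    proof (cases "v - u \<in> \<int>")
      case True
      then obtain m where v: "v = u + of_int m" by (metis Ints_cases add.commute diff_add_cancel)
      have "g k v = g k u" "f v = f u" for k
        unfolding v by (rule periodic1_of_int[OF per(1)], rule periodic1_of_int[OF per(2)])
      then show ?thesis by (simp add: U_def U'_def p)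
    next
      case False
      have "\<theta> v - \<theta> u \<notin> \<int>"
      proof
        assume "\<theta> v - \<theta> u \<in> \<int>"
        then have "c * infdist (v - u) \<int> \<le> 0" using infdist_expands[of v u] by simp
        then show False using c_pos infdist_Ints_pos[OF False] by (simp add: mult_le_0_iff)
      qed
      then have "(\<lambda>k. circle_kernel s (X k v - X k u)) \<longlonglongrightarrow> circle_kernel s (\<theta> v - \<theta> u)"
        by (rule circle_kernel_tendsto) (intro tendsto_intros conv)
      then show ?thesis
        unfolding U_def U'_def p fst_conv snd_conv
        by (intro tendsto_mult_ennreal tendsto_ennrealI tendsto_intros ptw conv) (auto split: split_indicator)
    qed
  qed
  have W_fin: "(\<integral>\<^sup>+ p. ennreal (2 * A) * W p \<partial>?M) < \<infinity>"
    using fin by (simp add: nn_integral_cmult W_int ennreal_mult_less_top)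
  have "(\<lambda>k. \<integral>\<^sup>+ p. U k p \<partial>?M) \<longlonglongrightarrow> (\<integral>\<^sup>+ p. U' p \<partial>?M)"
  proof (rule nn_integral_dominated_convergence_Pratt[where w = "\<lambda>k p. ennreal (2 * A) * W p + ennreal (2 * A) * R k p"
        and w' = "\<lambda>p. ennreal (2 * A) * W p"])
    fix p show "(\<lambda>k. ennreal (2 * A) * W p + ennreal (2 * A) * R k p) \<longlonglongrightarrow> ennreal (2 * A) * W p"
      using tendsto_add[OF tendsto_const[of "ennreal (2 * A) * W p"] ennreal_tendsto_cmult[OF _ R_lim[of p], of "ennreal (2 * A)"]]
      by simp
  next
    have "(\<lambda>k. (\<integral>\<^sup>+ p. ennreal (2 * A) * W p \<partial>?M) + ennreal (2 * A) * gagliardo_sq s (\<lambda>u. g k u - f u))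
        \<longlonglongrightarrow> (\<integral>\<^sup>+ p. ennreal (2 * A) * W p \<partial>?M) + ennreal (2 * A) * 0"
      by (intro tendsto_add tendsto_const ennreal_tendsto_cmult gag) simp
    then show "(\<lambda>k. \<integral>\<^sup>+ p. ennreal (2 * A) * W p + ennreal (2 * A) * R k p \<partial>?M) \<longlonglongrightarrow> (\<integral>\<^sup>+ p. ennreal (2 * A) * W p \<partial>?M)"
      by (simp add: nn_integral_add nn_integral_cmult R_int)
  qed (use U_le U_lim W_fin in auto)
  then show "(\<lambda>k. gagliardo_sq s (\<lambda>t. g k (k.inverse_map k t))) \<longlonglongrightarrow> gagliardo_sq s (\<lambda>t. f (inverse_map t))"
    by (simp add: U_int U'_int)
  have "U' p \<le> ennreal A * W p" for p
  proof -
    obtain u v where p: "p = (u, v)" by (cases p)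
    have "(norm (f v - f u))\<^sup>2 * (circle_kernel s (\<theta> v - \<theta> u) * (\<theta>' u * \<theta>' v))
       \<le> (norm (f v - f u))\<^sup>2 * (A * circle_kernel s (v - u))"
      by (intro mult_left_mono kernel_bound lim) simp
    then have "ennreal ((norm (f v - f u))\<^sup>2 * circle_kernel s (\<theta> v - \<theta> u) * (\<theta>' u * \<theta>' v))
       \<le> ennreal (A * ((norm (f v - f u))\<^sup>2 * circle_kernel s (v - u)))"
      by (intro ennreal_leI) (simp add: mult_ac)
    also have "\<dots> = ennreal A * ennreal ((norm (f v - f u))\<^sup>2 * circle_kernel s (v - u))"
      using A by (simp add: ennreal_mult)
    finally show ?thesis unfolding p U'_def W_def by (auto split: split_indicator)
  qed
  then have "(\<integral>\<^sup>+ p. U' p \<partial>?M) \<le> (\<integral>\<^sup>+ p. ennreal A * W p \<partial>?M)"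
    by (intro nn_integral_mono)
  also have "\<dots> < \<infinity>" using fin by (simp add: nn_integral_cmult W_int ennreal_mult_less_top)
  finally show "gagliardo_sq s (\<lambda>t. f (inverse_map t)) < \<infinity>" by (simp add: U'_int)
qed


text \<open>
  The convergence of the seminorms in \<open>gagliardo_sq_compose_tendsto\<close> is upgraded to convergence in the
  seminorm: the integrand tends to 0 pointwise, and it is dominated by the integrands of \<open>g k\<close> and \<open>f\<close> in
  the new parameters, whose integrals converge.
\<close>
lemma gagliardo_sq_lipschitz_compose_tendsto:
  fixes g q :: "nat \<Rightarrow> real \<Rightarrow> 'a::euclidean_space" and f q' :: "real \<Rightarrow> 'a"
  assumes s: "s > 0"
    and k: "\<And>k. circle_diffeo (X k) (X' k) c C" and lim: "circle_diffeo \<theta> \<theta>' c C"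
    and conv: "\<And>t. (\<lambda>k. X k t) \<longlonglongrightarrow> \<theta> t" "\<And>t. (\<lambda>k. X' k t) \<longlonglongrightarrow> \<theta>' t"
    and per: "\<And>k. periodic1 (g k)" "periodic1 f"
    and meas[measurable]: "\<And>k. g k \<in> borel_measurable borel" "f \<in> borel_measurable borel"
    and fin: "gagliardo_sq s f < \<infinity>" and gag: "(\<lambda>k. gagliardo_sq s (\<lambda>u. g k u - f u)) \<longlonglongrightarrow> 0"
    and ptw: "\<And>t. (\<lambda>k. g k t) \<longlonglongrightarrow> f t"
    and ptw': "\<And>t. (\<lambda>k. g k (inv (X k) t)) \<longlonglongrightarrow> f (inv \<theta> t)"
    and perq: "\<And>k. periodic1 (q k)" "periodic1 q'"
    and measq[measurable]: "\<And>k. q k \<in> borel_measurable borel" "q' \<in> borel_measurable borel"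
    and lip: "\<And>k u v. norm (q k u - q k v) \<le> K * norm (g k u - g k v)"
      "\<And>u v. norm (q' u - q' v) \<le> K * norm (f u - f v)"
    and ptwq: "\<And>t. (\<lambda>k. q k (inv (X k) t)) \<longlonglongrightarrow> q' (inv \<theta> t)"
  shows "(\<lambda>k. gagliardo_sq s (\<lambda>t. q k (inv (X k) t) - q' (inv \<theta> t)))
      \<longlonglongrightarrow> 0"
proof -
  interpret k: circle_diffeo "X k" "X' k" c C for k by (rule k)
  interpret circle_diffeo \<theta> \<theta>' c C by (rule lim)
  let ?I = "indicator ({0..1} \<times> {0..1}) :: real \<times> real \<Rightarrow> ennreal"
  let ?M = "(lborel :: real measure) \<Otimes>\<^sub>M (lborel :: real measure)"
  define G where "G k p = ennreal ((norm (g k (k.inverse_map k (snd p)) - g k (k.inverse_map k (fst p))))\<^sup>2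
      * circle_kernel s (snd p - fst p)) * ?I p" for k p
  define G' where "G' p = ennreal ((norm (f (inverse_map (snd p)) - f (inverse_map (fst p))))\<^sup>2
      * circle_kernel s (snd p - fst p)) * ?I p" for p
  define U where "U k p = ennreal ((norm ((q k (k.inverse_map k (snd p)) - q' (inverse_map (snd p)))
      - (q k (k.inverse_map k (fst p)) - q' (inverse_map (fst p)))))\<^sup>2 * circle_kernel s (snd p - fst p)) * ?I p" for k p
  have [measurable]: "G k \<in> borel_measurable ?M" "G' \<in> borel_measurable ?M" "U k \<in> borel_measurable ?M" for k
    unfolding G_def G'_def U_def by measurable
  have G_int: "(\<integral>\<^sup>+ p. G k p \<partial>?M) = gagliardo_sq s (\<lambda>t. g k (k.inverse_map k t))" for k
    unfolding G_def by (subst gagliardo_sq_pair[OF k.periodic_compose[OF per(1)]]) (auto simp: case_prod_beta')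
  have G'_int: "(\<integral>\<^sup>+ p. G' p \<partial>?M) = gagliardo_sq s (\<lambda>t. f (inverse_map t))"
    unfolding G'_def by (subst gagliardo_sq_pair[OF periodic_compose[OF per(2)]]) (auto simp: case_prod_beta')
  have U_int: "(\<integral>\<^sup>+ p. U k p \<partial>?M) = gagliardo_sq s (\<lambda>t. q k (k.inverse_map k t) - q' (inverse_map t))" for k
  proof -
    have "periodic1 (\<lambda>t. q k (k.inverse_map k t) - q' (inverse_map t))"
      by (rule periodic1I)
        (simp add: periodic1D[OF k.periodic_compose[OF perq(1)]] periodic1D[OF periodic_compose[OF perq(2)]])
    then show ?thesis unfolding U_def by (subst gagliardo_sq_pair) (auto simp: case_prod_beta')
  qed
  note G_lim_int = gagliardo_sq_compose_tendsto[OF s k lim conv per meas fin gag ptw]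
  define A where "A = ennreal (2 * K\<^sup>2)"
  have U_le: "U k p \<le> A * (G k p + G' p)" for k p
  proof -
    obtain u v where p: "p = (u, v)" by (cases p)
    let ?x = "q k (k.inverse_map k v) - q k (k.inverse_map k u)" and ?y = "q' (inverse_map v) - q' (inverse_map u)"
    let ?a = "g k (k.inverse_map k v) - g k (k.inverse_map k u)" and ?b = "f (inverse_map v) - f (inverse_map u)"
    have "(norm (?x - ?y))\<^sup>2 = (norm (?x + (- ?y)))\<^sup>2" by (simp only: diff_conv_add_uminus)
    also have "\<dots> \<le> (1 + 1) * (norm ?x)\<^sup>2 + (1 + 1 / 1) * (norm (- ?y))\<^sup>2"
      by (rule norm_add_sq_le) simp
    also have "\<dots> = 2 * (norm ?x)\<^sup>2 + 2 * (norm ?y)\<^sup>2" by (simp add: norm_minus_commute)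
    also have "\<dots> \<le> 2 * (K * norm ?a)\<^sup>2 + 2 * (K * norm ?b)\<^sup>2"
      by (intro add_mono mult_left_mono power_mono lip) auto
    also have "\<dots> = 2 * K\<^sup>2 * ((norm ?a)\<^sup>2 + (norm ?b)\<^sup>2)" by (simp add: power_mult_distrib algebra_simps)
    finally have "(norm (?x - ?y))\<^sup>2 * circle_kernel s (v - u)
        \<le> 2 * K\<^sup>2 * ((norm ?a)\<^sup>2 + (norm ?b)\<^sup>2) * circle_kernel s (v - u)"
      by (intro mult_right_mono) auto
    then have "ennreal ((norm (?x - ?y))\<^sup>2 * circle_kernel s (v - u))
        \<le> ennreal (2 * K\<^sup>2 * ((norm ?a)\<^sup>2 * circle_kernel s (v - u) + (norm ?b)\<^sup>2 * circle_kernel s (v - u)))"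
      by (intro ennreal_leI) (simp add: algebra_simps)
    also have "\<dots> = A * (ennreal ((norm ?a)\<^sup>2 * circle_kernel s (v - u)) + ennreal ((norm ?b)\<^sup>2 * circle_kernel s (v - u)))"
      by (simp add: A_def ennreal_mult)
    finally show ?thesis
      unfolding p U_def G_def G'_def by (auto split: split_indicator simp: algebra_simps)
  qed
  have G_lim: "(\<lambda>k. G k p) \<longlonglongrightarrow> G' p" for p
    unfolding G_def G'_def
    by (intro tendsto_mult_ennreal tendsto_ennrealI tendsto_intros ptw') (auto split: split_indicator)
  have U_lim: "(\<lambda>k. U k p) \<longlonglongrightarrow> 0" for p
  proof -
    have "(\<lambda>k. U k p) \<longlonglongrightarrow> ennreal ((norm ((q' (inverse_map (snd p)) - q' (inverse_map (snd p)))
      - (q' (inverse_map (fst p)) - q' (inverse_map (fst p)))))\<^sup>2 * circle_kernel s (snd p - fst p)) * ?I p"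
      unfolding U_def
      by (intro tendsto_mult_ennreal tendsto_ennrealI tendsto_intros ptwq) (auto split: split_indicator)
    then show ?thesis by simp
  qed
  have A_fin: "A \<noteq> \<infinity>" "A < top" by (simp_all add: A_def)
  have "(\<lambda>k. \<integral>\<^sup>+ p. U k p \<partial>?M) \<longlonglongrightarrow> (\<integral>\<^sup>+ p. 0 \<partial>?M)"
  proof (rule nn_integral_dominated_convergence_Pratt[where M = ?M and u = U and u' = "\<lambda>p. 0" and w = "\<lambda>k p. A * (G k p + G' p)"
        and w' = "\<lambda>p. A * (G' p + G' p)"])
    show "(\<lambda>k. A * (G k p + G' p)) \<longlonglongrightarrow> A * (G' p + G' p)" for p
      by (intro ennreal_tendsto_cmult tendsto_add G_lim tendsto_const A_fin)
    have "(\<lambda>k. A * (gagliardo_sq s (\<lambda>t. g k (k.inverse_map k t)) + gagliardo_sq s (\<lambda>t. f (inverse_map t))))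
        \<longlonglongrightarrow> A * (gagliardo_sq s (\<lambda>t. f (inverse_map t)) + gagliardo_sq s (\<lambda>t. f (inverse_map t)))"
      by (intro ennreal_tendsto_cmult tendsto_add G_lim_int tendsto_const A_fin)
    then show "(\<lambda>k. \<integral>\<^sup>+ p. A * (G k p + G' p) \<partial>?M) \<longlonglongrightarrow> (\<integral>\<^sup>+ p. A * (G' p + G' p) \<partial>?M)"
      by (simp add: nn_integral_cmult nn_integral_add G_int G'_int)
    show "(\<integral>\<^sup>+ p. A * (G' p + G' p) \<partial>?M) < \<infinity>"
      using G_lim_int(2) A_fin by (simp add: nn_integral_cmult nn_integral_add G'_int ennreal_mult_less_top)
  qed (use U_le U_lim in auto)
  then show ?thesis by (simp add: U_int)
qed

section \<open>Strong continuity of composition on \<open>L\<^sup>2\<close>\<close>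

lemma ennreal_tendsto_0I:
  fixes X :: "nat \<Rightarrow> ennreal"
  assumes "\<And>e. e > 0 \<Longrightarrow> \<forall>\<^sub>F k in sequentially. X k \<le> ennreal e"
  shows "X \<longlonglongrightarrow> 0"
proof (rule order_tendstoI)
  fix a :: ennreal assume "0 < a"
  then obtain b where b: "0 < b" "b < a" using dense by blast
  then have "b < top" by (meson less_le_trans top_greatest)
  then have eq: "b = ennreal (enn2real b)" by simp
  then have "enn2real b > 0" using b by (metis enn2real_positive_iff \<open>b < top\<close>)
  from assms[OF this] show "\<forall>\<^sub>F k in sequentially. X k < a"
    by eventually_elim (use b eq in auto)
qed simp

lemma borel_AE_limit_of_continuous:
  fixes f :: "real \<Rightarrow> 'a::euclidean_space"
  assumes "f \<in> borel_measurable borel"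
  obtains c where "\<And>n. continuous_on UNIV (c n :: real \<Rightarrow> 'a)" "AE u in lborel. (\<lambda>n. c n u) \<longlonglongrightarrow> f u"
proof -
  have "f \<in> borel_measurable lebesgue"
    using assms by (intro measurable_completion) simp
  then have "f measurable_on UNIV"
    by (rule lebesgue_measurable_imp_measurable_on) simp
  then obtain N c where N: "negligible N" and c: "\<And>n. continuous_on UNIV (c n :: real \<Rightarrow> 'a)"
    "\<And>x. x \<notin> N \<Longrightarrow> (\<lambda>n. c n x) \<longlonglongrightarrow> f x"
    unfolding measurable_on_def by auto
  have "AE u in lebesgue. u \<notin> N"
    using N by (intro AE_not_in) (simp add: negligible_iff_null_sets)
  then have "AE u in lborel. u \<notin> N" by (simp add: AE_completion_iff)
  then have "AE u in lborel. (\<lambda>n. c n u) \<longlonglongrightarrow> f u"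
    by eventually_elim (rule c(2))
  with c(1) show ?thesis by (rule that)
qed

text \<open>Radial truncation at radius \<open>B\<close>.\<close>
definition truncate_at :: "real \<Rightarrow> 'a::real_normed_vector \<Rightarrow> 'a" where
  "truncate_at B v = (B / max B (norm v)) *\<^sub>R v"

lemma norm_truncate_at_le: "B > 0 \<Longrightarrow> norm (truncate_at B v) \<le> B"
  by (auto simp: truncate_at_def max_def field_simps)

lemma truncate_at_eq: "B > 0 \<Longrightarrow> norm v \<le> B \<Longrightarrow> truncate_at B v = v"
  by (simp add: truncate_at_def max_def)

lemma norm_diff_truncate_at_le: "B > 0 \<Longrightarrow> norm (v - truncate_at B v) \<le> norm v"
proof -
  assume B: "B > 0"
  have "v - truncate_at B v = (1 - B / max B (norm v)) *\<^sub>R v"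
    by (simp add: truncate_at_def scaleR_diff_left)
  moreover have "0 \<le> B / max B (norm v)" "B / max B (norm v) \<le> 1" using B by (auto simp: divide_le_eq_1)
  then have "\<bar>1 - B / max B (norm v)\<bar> \<le> 1" by linarith
  ultimately show ?thesis using mult_right_mono[of "\<bar>1 - B / max B (norm v)\<bar>" 1 "norm v"] by simp
qed

lemma continuous_on_truncate_at: "B > 0 \<Longrightarrow> continuous_on A (truncate_at B)"
  unfolding truncate_at_def by (intro continuous_intros) (auto simp: max_def)

lemma borel_measurable_truncate_at [measurable]:
  "(truncate_at B :: 'a::euclidean_space \<Rightarrow> 'a) \<in> borel_measurable borel"
  unfolding truncate_at_def[abs_def] by measurable

text \<open>
  Truncating \<open>x\<close> costs little in \<open>L\<^sup>2\<close> and makes it bounded. A bounded measurable function is almost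
  everywhere a limit of continuous functions, which may be truncated at the same radius, so that dominated
  convergence applies.
\<close>
lemma L2_continuous_approx:
  fixes x :: "real \<Rightarrow> 'a::euclidean_space"
  assumes x: "x \<in> L2_circle" and "e > 0"
  obtains y where "continuous_on UNIV (y :: real \<Rightarrow> 'a)" "L2_norm_sq (\<lambda>u. x u - y u) \<le> ennreal e"
proof -
  have [measurable]: "x \<in> borel_measurable borel" and fin: "L2_norm_sq x < \<infinity>" using x by (auto simp: L2_circle_iff)
  have "(\<lambda>n. L2_norm_sq (\<lambda>u. x u - truncate_at (real (Suc n)) (x u))) \<longlonglongrightarrow> (\<integral>\<^sup>+ u. 0 \<partial>(lborel :: real measure))"
    unfolding L2_norm_sq_def
  proof (rule nn_integral_dominated_convergence[where w = "\<lambda>u. ennreal ((norm (x u))\<^sup>2) * indicator {0..1} u"])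
    show "AE u in lborel. ennreal ((norm (x u - truncate_at (real (Suc n)) (x u)))\<^sup>2) * indicator {0..1} u
        \<le> ennreal ((norm (x u))\<^sup>2) * indicator {0..1} u" for n
      by (intro AE_I2 mult_right_mono ennreal_leI power_mono norm_diff_truncate_at_le) auto
    show "AE u in lborel. (\<lambda>n. ennreal ((norm (x u - truncate_at (real (Suc n)) (x u)))\<^sup>2) * indicator {0..1} u) \<longlonglongrightarrow> 0"
    proof (rule AE_I2)
      fix u
      obtain m where m: "norm (x u) \<le> real m" using real_arch_simple by blast
      have "\<forall>\<^sub>F n in sequentially. ennreal ((norm (x u - truncate_at (real (Suc n)) (x u)))\<^sup>2) * indicator {0..1} u = 0"
        using eventually_ge_at_top[of m]
      proof eventually_elim
        case (elim n)
        then have "truncate_at (real (Suc n)) (x u) = x u" using m by (intro truncate_at_eq) auto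
        then show ?case by simp
      qed
      then show "(\<lambda>n. ennreal ((norm (x u - truncate_at (real (Suc n)) (x u)))\<^sup>2) * indicator {0..1} u) \<longlonglongrightarrow> 0"
        by (rule tendsto_eventually)
    qed
  qed (use fin in \<open>auto simp: L2_norm_sq_def\<close>)
  then have "\<forall>\<^sub>F n in sequentially. L2_norm_sq (\<lambda>u. x u - truncate_at (real (Suc n)) (x u)) < ennreal (e / 4)"
    using \<open>e > 0\<close> by (intro order_tendstoD(2)[of _ 0]) auto
  then obtain n where n: "L2_norm_sq (\<lambda>u. x u - truncate_at (real (Suc n)) (x u)) < ennreal (e / 4)"
    by (auto simp: eventually_sequentially)
  define B where "B = real (Suc n)"
  have B: "B > 0" by (simp add: B_def)
  obtain c where c: "\<And>n. continuous_on UNIV (c n :: real \<Rightarrow> 'a)" "AE u in lborel. (\<lambda>n. c n u) \<longlonglongrightarrow> x u"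
    by (rule borel_AE_limit_of_continuous[of x]) (auto intro: that)
  define y where "y k u = truncate_at B (c k u)" for k u
  have cont_y: "continuous_on UNIV (y k)" for k
    unfolding y_def by (rule continuous_on_compose2[OF continuous_on_truncate_at[OF B, of UNIV] c(1)]) simp
  have [measurable]: "y k \<in> borel_measurable borel" for k
    using cont_y by (auto intro: borel_measurable_continuous_onI)
  have "(\<lambda>k. L2_norm_sq (\<lambda>u. truncate_at B (x u) - y k u)) \<longlonglongrightarrow> (\<integral>\<^sup>+ u. 0 \<partial>(lborel :: real measure))"
    unfolding L2_norm_sq_def
  proof (rule nn_integral_dominated_convergence[where w = "\<lambda>u. ennreal ((2 * B)\<^sup>2) * indicator {0..1} u"])
    show "AE u in lborel. ennreal ((norm (truncate_at B (x u) - y k u))\<^sup>2) * indicator {0..1} u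
        \<le> ennreal ((2 * B)\<^sup>2) * indicator {0..1} u" for k
    proof (intro AE_I2 mult_right_mono ennreal_leI power_mono)
      fix u
      have "norm (truncate_at B (x u) - y k u) \<le> norm (truncate_at B (x u)) + norm (y k u)"
        by (rule norm_triangle_ineq4)
      then show "norm (truncate_at B (x u) - y k u) \<le> 2 * B"
        using norm_truncate_at_le[OF B, of "x u"] norm_truncate_at_le[OF B, of "c k u"] by (simp add: y_def)
    qed auto
    show "AE u in lborel. (\<lambda>k. ennreal ((norm (truncate_at B (x u) - y k u))\<^sup>2) * indicator {0..1} u) \<longlonglongrightarrow> 0"
      using c(2)
    proof eventually_elim
      case (elim u)
      have "isCont (truncate_at B) (x u)"
        using continuous_on_truncate_at[OF B, of "UNIV :: 'a set"] by (simp add: continuous_on_eq_continuous_at)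
      then have "(\<lambda>k. y k u) \<longlonglongrightarrow> truncate_at B (x u)"
        unfolding y_def using elim by (rule isCont_tendsto_compose)
      then have "(\<lambda>k. ennreal ((norm (truncate_at B (x u) - y k u))\<^sup>2) * indicator {0..1} u)
          \<longlonglongrightarrow> ennreal ((norm (truncate_at B (x u) - truncate_at B (x u)))\<^sup>2) * indicator {0..1} u"
        by (intro tendsto_mult_ennreal tendsto_ennrealI tendsto_intros) (auto split: split_indicator)
      then show ?case by simp
    qed
  qed (auto simp: nn_integral_cmult ennreal_mult_less_top)
  then have "\<forall>\<^sub>F k in sequentially. L2_norm_sq (\<lambda>u. truncate_at B (x u) - y k u) < ennreal (e / 4)"
    using \<open>e > 0\<close> by (intro order_tendstoD(2)[of _ 0]) auto
  then obtain k where k: "L2_norm_sq (\<lambda>u. truncate_at B (x u) - y k u) < ennreal (e / 4)"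
    by (auto simp: eventually_sequentially)
  have "L2_norm_sq (\<lambda>u. x u - y k u)
      = L2_norm_sq (\<lambda>u. (x u - truncate_at B (x u)) + (truncate_at B (x u) - y k u))" by simp
  also have "\<dots> \<le> ennreal (1 + 1) * L2_norm_sq (\<lambda>u. x u - truncate_at B (x u))
      + ennreal (1 + 1 / 1) * L2_norm_sq (\<lambda>u. truncate_at B (x u) - y k u)"
    by (rule L2_norm_sq_add_le) auto
  also have "\<dots> \<le> ennreal 2 * ennreal (e / 4) + ennreal 2 * ennreal (e / 4)"
    using n k by (intro add_mono mult_mono) (auto simp: B_def)
  also have "\<dots> = (2 + 2) * ennreal (e / 4)"
    by (simp only: distrib_right ennreal_numeral)
  also have "\<dots> = ennreal (4 * (e / 4))"
    using \<open>e > 0\<close> by (subst ennreal_mult) auto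
  also have "4 * (e / 4) = e" by simp
  finally show ?thesis by (rule that[OF cont_y])
qed

lemma L2_norm_sq_tendsto_0:
  fixes f :: "nat \<Rightarrow> real \<Rightarrow> 'a::euclidean_space"
  assumes [measurable]: "\<And>k. f k \<in> borel_measurable borel"
    and w: "w \<in> borel_measurable borel" "(\<integral>\<^sup>+ u\<in>{0..1}. ennreal ((w u)\<^sup>2) \<partial>lborel) < \<infinity>"
    and bound: "\<And>k u. u \<in> {0..1} \<Longrightarrow> norm (f k u) \<le> w u"
    and lim: "\<And>u. u \<in> {0..1} \<Longrightarrow> (\<lambda>k. f k u) \<longlonglongrightarrow> 0"
  shows "(\<lambda>k. L2_norm_sq (f k)) \<longlonglongrightarrow> 0"
proof -
  have [measurable]: "w \<in> borel_measurable borel" by fact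
  have "(\<lambda>k. L2_norm_sq (f k)) \<longlonglongrightarrow> (\<integral>\<^sup>+ u. 0 \<partial>(lborel :: real measure))"
    unfolding L2_norm_sq_def
  proof (rule nn_integral_dominated_convergence[where w = "\<lambda>u. ennreal ((w u)\<^sup>2) * indicator {0..1} u"])
    show "AE u in lborel. ennreal ((norm (f k u))\<^sup>2) * indicator {0..1} u \<le> ennreal ((w u)\<^sup>2) * indicator {0..1} u" for k
      using bound by (intro AE_I2) (auto split: split_indicator intro!: ennreal_leI power_mono)
    show "AE u in lborel. (\<lambda>k. ennreal ((norm (f k u))\<^sup>2) * indicator {0..1} u) \<longlonglongrightarrow> 0"
    proof (rule AE_I2)
      fix u
      show "(\<lambda>k. ennreal ((norm (f k u))\<^sup>2) * indicator {0..1} u) \<longlonglongrightarrow> 0"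
      proof (cases "u \<in> {0..1}")
        case True
        have "(\<lambda>k. ennreal ((norm (f k u))\<^sup>2)) \<longlonglongrightarrow> ennreal ((norm (0::'a))\<^sup>2)"
          by (intro tendsto_ennrealI tendsto_intros lim True)
        then show ?thesis using True by simp
      qed simp
    qed
  qed (use w in auto)
  then show ?thesis by simp
qed

lemma L2_norm_sq_bounded_tendsto_0:
  fixes f :: "nat \<Rightarrow> real \<Rightarrow> 'a::euclidean_space"
  assumes "\<And>k. f k \<in> borel_measurable borel" "\<And>k u. u \<in> {0..1} \<Longrightarrow> norm (f k u) \<le> B"
    and "\<And>u. u \<in> {0..1} \<Longrightarrow> (\<lambda>k. f k u) \<longlonglongrightarrow> 0"
  shows "(\<lambda>k. L2_norm_sq (f k)) \<longlonglongrightarrow> 0"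
  by (rule L2_norm_sq_tendsto_0[where w = "\<lambda>u. B"]) (use assms in \<open>auto simp: nn_integral_cmult ennreal_mult_less_top\<close>)

lemma circle_diffeo_inverse_map_Icc:
  assumes "circle_diffeo \<theta> \<theta>' c C" "t \<in> {0..1}"
  shows "inv \<theta> t \<in> {0..1}"
proof -
  interpret circle_diffeo \<theta> \<theta>' c C by fact
  have "inverse_map 0 \<le> inverse_map t" "inverse_map t \<le> inverse_map 1"
    using assms(2) by (auto intro: inverse_map_mono)
  then show ?thesis using inverse_map_zero inverse_map_left[of 1] one by simp
qed

text \<open>
  Composition with diffeomorphisms is strongly continuous on \<open>L\<^sup>2\<close>, although it is not continuous in the
  operator norm. For a continuous function it follows from pointwise convergence, and the general case by
  approximation, because the composition operators are uniformly bounded.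
\<close>
lemma L2_compose_tendsto:
  fixes x :: "nat \<Rightarrow> real \<Rightarrow> 'a::euclidean_space" and x' :: "real \<Rightarrow> 'a"
  assumes k: "\<And>k. circle_diffeo (X k) (X' k) c C" and lim: "circle_diffeo \<theta> \<theta>' c C"
    and conv: "\<And>t. (\<lambda>k. X k t) \<longlonglongrightarrow> \<theta> t"
    and x: "\<And>k. x k \<in> L2_circle" "x' \<in> L2_circle" "(\<lambda>k. L2_norm_sq (\<lambda>u. x k u - x' u)) \<longlonglongrightarrow> 0"
  shows "(\<lambda>k. L2_norm_sq (\<lambda>t. x k (inv (X k) t) - x' (inv \<theta> t))) \<longlonglongrightarrow> 0"
proof (rule ennreal_tendsto_0I)
  fix e :: real assume "e > 0"
  interpret k: circle_diffeo "X k" "X' k" c C for k by (rule k)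
  interpret circle_diffeo \<theta> \<theta>' c C by (rule lim)
  have [measurable]: "x k \<in> borel_measurable borel" "x' \<in> borel_measurable borel" for k
    using x by (auto simp: L2_circle_iff)
  \<comment> \<open>Four terms of size \<open>C * d\<close> are added in two stages, each of which costs a factor 2.\<close>
  define d where "d = e / (16 * C)"
  have d: "d > 0" using C_pos \<open>e > 0\<close> by (simp add: d_def)
  obtain y where y: "continuous_on UNIV (y :: real \<Rightarrow> 'a)" "L2_norm_sq (\<lambda>u. x' u - y u) \<le> ennreal d"
    by (rule L2_continuous_approx[OF x(2) d], rule that)
  have [measurable]: "y \<in> borel_measurable borel" using y(1) by (rule borel_measurable_continuous_onI)
  have "compact (y ` {0..1})"
    by (intro compact_continuous_image compact_Icc continuous_on_subset[OF y(1)]) auto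
  then obtain B where B: "\<And>t. t \<in> {0..1} \<Longrightarrow> norm (y t) \<le> B"
    using compact_imp_bounded bounded_iff by (metis imageI)
  have mid: "(\<lambda>k. L2_norm_sq (\<lambda>t. y (k.inverse_map k t) - y (inverse_map t))) \<longlonglongrightarrow> 0"
  proof (rule L2_norm_sq_bounded_tendsto_0[where B = "B + B"])
    show "norm (y (k.inverse_map k t) - y (inverse_map t)) \<le> B + B" if "t \<in> {0..1}" for k t
      by (intro order_trans[OF norm_triangle_ineq4 add_mono] B circle_diffeo_inverse_map_Icc[OF k that]
          circle_diffeo_inverse_map_Icc[OF lim that])
    show "(\<lambda>k. y (k.inverse_map k t) - y (inverse_map t)) \<longlonglongrightarrow> 0" for t
    proof -
      have "isCont y (inverse_map t)" using y(1) by (simp add: continuous_on_eq_continuous_at)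
      then have "(\<lambda>k. y (k.inverse_map k t)) \<longlonglongrightarrow> y (inverse_map t)"
        by (rule isCont_tendsto_compose) (rule inverse_map_tendsto[OF k lim conv])
      then show ?thesis by (rule LIM_zero)
    qed
  qed auto
  have ev: "\<forall>\<^sub>F k in sequentially. L2_norm_sq (\<lambda>u. x k u - x' u) < ennreal d"
    "\<forall>\<^sub>F k in sequentially. L2_norm_sq (\<lambda>t. y (k.inverse_map k t) - y (inverse_map t)) < ennreal (C * d)"
    using d C_pos by (auto intro!: order_tendstoD(2)[OF x(3)] order_tendstoD(2)[OF mid])
  have two: "L2_norm_sq (\<lambda>t. f t + g t) \<le> 2 * L2_norm_sq f + 2 * L2_norm_sq g"
    if "f \<in> borel_measurable borel" "g \<in> borel_measurable borel" for f g :: "real \<Rightarrow> 'a"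
    using L2_norm_sq_add_le[OF that, of 1] by simp
  show "\<forall>\<^sub>F k in sequentially. L2_norm_sq (\<lambda>t. x k (k.inverse_map k t) - x' (inverse_map t)) \<le> ennreal e"
    using ev
  proof eventually_elim
    case (elim k)
    let ?a = "\<lambda>t. x k (k.inverse_map k t) - x' (k.inverse_map k t)"
    let ?b = "\<lambda>t. x' (k.inverse_map k t) - y (k.inverse_map k t)"
    let ?c = "\<lambda>t. y (k.inverse_map k t) - y (inverse_map t)"
    let ?d = "\<lambda>t. y (inverse_map t) - x' (inverse_map t)"
    have a: "L2_norm_sq ?a \<le> ennreal (C * d)"
    proof -
      have "L2_norm_sq ?a \<le> ennreal C * L2_norm_sq (\<lambda>u. x k u - x' u)"
        by (rule k.L2_norm_sq_compose_le) measurable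
      also have "\<dots> \<le> ennreal C * ennreal d" using elim by (intro mult_left_mono) auto
      finally show ?thesis using C_pos d by (simp add: ennreal_mult)
    qed
    have b: "L2_norm_sq ?b \<le> ennreal (C * d)"
    proof -
      have "L2_norm_sq ?b \<le> ennreal C * L2_norm_sq (\<lambda>u. x' u - y u)"
        by (rule k.L2_norm_sq_compose_le) measurable
      also have "\<dots> \<le> ennreal C * ennreal d" using y(2) by (intro mult_left_mono) auto
      finally show ?thesis using C_pos d by (simp add: ennreal_mult)
    qed
    have d': "L2_norm_sq ?d \<le> ennreal (C * d)"
    proof -
      have "L2_norm_sq ?d = L2_norm_sq (\<lambda>t. x' (inverse_map t) - y (inverse_map t))"
        by (simp add: L2_norm_sq_def norm_minus_commute)
      also have "\<dots> \<le> ennreal C * L2_norm_sq (\<lambda>u. x' u - y u)"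
        by (rule L2_norm_sq_compose_le) measurable
      also have "\<dots> \<le> ennreal C * ennreal d" using y(2) by (intro mult_left_mono) auto
      finally show ?thesis using C_pos d by (simp add: ennreal_mult)
    qed
    have "L2_norm_sq (\<lambda>t. x k (k.inverse_map k t) - x' (inverse_map t))
        = L2_norm_sq (\<lambda>t. (?a t + ?b t) + (?c t + ?d t))" by simp
    also have "\<dots> \<le> 2 * (2 * L2_norm_sq ?a + 2 * L2_norm_sq ?b) + 2 * (2 * L2_norm_sq ?c + 2 * L2_norm_sq ?d)"
      by (intro order_trans[OF two] add_mono mult_left_mono two) auto
    also have "\<dots> \<le> 2 * (2 * ennreal (C * d) + 2 * ennreal (C * d)) + 2 * (2 * ennreal (C * d) + 2 * ennreal (C * d))"
      using elim(2) by (intro add_mono mult_left_mono a b d') auto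
    also have "\<dots> = (2 * 2 + 2 * 2 + (2 * 2 + 2 * 2)) * ennreal (C * d)"
      by (simp only: distrib_left distrib_right mult.assoc)
    also have "\<dots> = ennreal (16 * (C * d))"
      using C_pos d by (subst ennreal_mult) auto
    also have "16 * (C * d) = e" using C_pos by (simp add: d_def)
    finally show ?case .
  qed
qed

text \<open>
  Uniformly bounded multipliers that converge only pointwise preserve convergence in \<open>L\<^sup>2\<close>: on the
  difference \<open>y k - y'\<close> the bound suffices, and on the fixed \<open>y'\<close> dominated convergence applies.
\<close>
lemma L2_apply_tendsto:
  fixes y :: "nat \<Rightarrow> real \<Rightarrow> 'a::euclidean_space" and y' :: "real \<Rightarrow> 'a"
    and T :: "nat \<Rightarrow> real \<Rightarrow> 'a \<Rightarrow> 'a" and T' :: "real \<Rightarrow> 'a \<Rightarrow> 'a"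
  assumes y: "\<And>k. y k \<in> borel_measurable borel" "y' \<in> L2_circle" "(\<lambda>k. L2_norm_sq (\<lambda>u. y k u - y' u)) \<longlonglongrightarrow> 0"
    and T: "\<And>k t v w. T k t (v - w) = T k t v - T k t w" "\<And>k t v. norm (T k t v) \<le> K * norm v"
      "\<And>t v. norm (T' t v) \<le> K * norm v" "\<And>t v. (\<lambda>k. T k t v) \<longlonglongrightarrow> T' t v"
    and meas: "\<And>k y. y \<in> borel_measurable borel \<Longrightarrow> (\<lambda>t. T k t (y t)) \<in> borel_measurable borel"
      "\<And>y. y \<in> borel_measurable borel \<Longrightarrow> (\<lambda>t. T' t (y t)) \<in> borel_measurable borel"
  shows "(\<lambda>k. L2_norm_sq (\<lambda>t. T k t (y k t) - T' t (y' t))) \<longlonglongrightarrow> 0"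
proof -
  have [measurable]: "y k \<in> borel_measurable borel" "y' \<in> borel_measurable borel" for k
    using y by (auto simp: L2_circle_iff)
  note [measurable] = meas
  have 1: "L2_norm_sq (\<lambda>t. T k t (y k t - y' t)) \<le> ennreal (K\<^sup>2) * L2_norm_sq (\<lambda>u. y k u - y' u)" for k
  proof -
    have "L2_norm_sq (\<lambda>t. T k t (y k t - y' t)) \<le> L2_norm_sq (\<lambda>t. K *\<^sub>R (y k t - y' t))"
      unfolding L2_norm_sq_def
    proof (intro nn_integral_mono mult_right_mono ennreal_leI power_mono)
      fix t show "norm (T k t (y k t - y' t)) \<le> norm (K *\<^sub>R (y k t - y' t))"
        using T(2)[of k t "y k t - y' t"] abs_ge_self[of K]
        by (metis (no_types, opaque_lifting) mult_right_mono norm_ge_zero norm_scaleR order_trans)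
    qed auto
    then show ?thesis by (simp add: L2_norm_sq_scaleR)
  qed
  have 2: "(\<lambda>k. L2_norm_sq (\<lambda>t. T k t (y' t) - T' t (y' t))) \<longlonglongrightarrow> 0"
  proof (rule L2_norm_sq_tendsto_0[where w = "\<lambda>t. (2 * K) * norm (y' t)"])
    show "(\<lambda>k. T k t (y' t) - T' t (y' t)) \<longlonglongrightarrow> 0" for t
      by (rule LIM_zero[OF T(4)])
    show "norm (T k t (y' t) - T' t (y' t)) \<le> 2 * K * norm (y' t)" for k t
      using norm_triangle_ineq4[of "T k t (y' t)" "T' t (y' t)"] T(2)[of k t "y' t"] T(3)[of t "y' t"] by simp
    have "(\<integral>\<^sup>+ u\<in>{0..1}. ennreal ((2 * K * norm (y' u))\<^sup>2) \<partial>lborel) = L2_norm_sq (\<lambda>u. (2 * K) *\<^sub>R y' u)"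
      unfolding L2_norm_sq_def by (simp add: power_mult_distrib)
    also have "\<dots> < \<infinity>" using y(2) by (simp add: L2_norm_sq_scaleR L2_circle_iff ennreal_mult_less_top)
    finally show "(\<integral>\<^sup>+ u\<in>{0..1}. ennreal ((2 * K * norm (y' u))\<^sup>2) \<partial>lborel) < \<infinity>" .
  qed auto
  have "(\<lambda>k. 2 * (ennreal (K\<^sup>2) * L2_norm_sq (\<lambda>u. y k u - y' u)) + 2 * L2_norm_sq (\<lambda>t. T k t (y' t) - T' t (y' t)))
      \<longlonglongrightarrow> 2 * (ennreal (K\<^sup>2) * 0) + 2 * 0"
    by (intro tendsto_add ennreal_tendsto_cmult y(3) 2) auto
  then have upper: "(\<lambda>k. 2 * (ennreal (K\<^sup>2) * L2_norm_sq (\<lambda>u. y k u - y' u)) + 2 * L2_norm_sq (\<lambda>t. T k t (y' t) - T' t (y' t)))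
      \<longlonglongrightarrow> 0" by simp
  show ?thesis
  proof (rule tendsto_sandwich[OF _ _ tendsto_const upper])
    show "\<forall>\<^sub>F k in sequentially. L2_norm_sq (\<lambda>t. T k t (y k t) - T' t (y' t))
      \<le> 2 * (ennreal (K\<^sup>2) * L2_norm_sq (\<lambda>u. y k u - y' u)) + 2 * L2_norm_sq (\<lambda>t. T k t (y' t) - T' t (y' t))"
    proof (intro always_eventually allI)
      fix k
      have "L2_norm_sq (\<lambda>t. T k t (y k t) - T' t (y' t))
        = L2_norm_sq (\<lambda>t. T k t (y k t - y' t) + (T k t (y' t) - T' t (y' t)))" by (simp add: T(1))
      also have "\<dots> \<le> ennreal (1 + 1) * L2_norm_sq (\<lambda>t. T k t (y k t - y' t))
          + ennreal (1 + 1 / 1) * L2_norm_sq (\<lambda>t. T k t (y' t) - T' t (y' t))"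
        by (rule L2_norm_sq_add_le) auto
      also have "\<dots> \<le> 2 * (ennreal (K\<^sup>2) * L2_norm_sq (\<lambda>u. y k u - y' u)) + 2 * L2_norm_sq (\<lambda>t. T k t (y' t) - T' t (y' t))"
        using 1[of k] by (simp add: mult_left_mono)
      finally show "L2_norm_sq (\<lambda>t. T k t (y k t) - T' t (y' t))
        \<le> 2 * (ennreal (K\<^sup>2) * L2_norm_sq (\<lambda>u. y k u - y' u)) + 2 * L2_norm_sq (\<lambda>t. T k t (y' t) - T' t (y' t))" .
    qed
  qed simp
qed

section \<open>Rescaled velocities and arc length\<close>

text \<open>
  The secant slope of the norm is \<open>(v + w) / (norm v + norm w)\<close>, which is continuous away from 0.
\<close>
lemma primitive_of_norm:
  fixes g h :: "real \<Rightarrow> 'a::euclidean_space"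
  assumes prim: "primitive_of g h" and [measurable]: "h \<in> borel_measurable borel" and nz: "\<And>u. g u \<noteq> 0"
  shows "primitive_of (\<lambda>u. norm (g u)) (\<lambda>u. (g u \<bullet> h u) / norm (g u))"
proof -
  have cont: "continuous_on UNIV g" by (rule primitive_of_continuous[OF prim])
  define S where "S x y = (g x + g y) /\<^sub>R (norm (g x) + norm (g y))" for x y
  have pos: "norm (g x) + norm (g y) > 0" for x y
    using nz[of x] by (simp add: add_pos_nonneg)
  have "continuous_on UNIV (\<lambda>p. (g (fst p) + g (snd p)) /\<^sub>R (norm (g (fst p)) + norm (g (snd p))))"
    using pos by (intro continuous_intros continuous_on_compose2[OF cont]) (auto simp: less_imp_neq[THEN not_sym])
  then have S: "continuous_on UNIV (\<lambda>(x, y). S x y)"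
    by (simp add: S_def case_prod_beta')
  have sec: "norm (g y) - norm (g x) = S x y \<bullet> (g y - g x)" for x y
  proof -
    have "(g x + g y) \<bullet> (g y - g x) = (norm (g y) - norm (g x)) * (norm (g x) + norm (g y))"
      by (simp add: algebra_simps inner_commute power2_norm_eq_inner[symmetric] power2_eq_square[symmetric])
    then have "S x y \<bullet> (g y - g x) = inverse (norm (g x) + norm (g y)) * ((norm (g y) - norm (g x)) * (norm (g x) + norm (g y)))"
      by (simp only: S_def inner_scaleR_left)
    also have "\<dots> = norm (g y) - norm (g x)"
      using pos[of x y] by simp
    finally show ?thesis by (rule sym)
  qed
  have "primitive_of (\<lambda>u. norm (g u)) (\<lambda>t. S t t \<bullet> h t)"
    by (rule primitive_of_secant[OF bounded_bilinear_inner prim _ S sec]) simp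
  moreover have "S t t \<bullet> h t = (g t \<bullet> h t) / norm (g t)" for t
    using nz[of t] by (simp add: S_def field_simps inner_add_left)
  ultimately show ?thesis by simp
qed

lemma primitive_of_inverse:
  fixes p k :: "real \<Rightarrow> real"
  assumes prim: "primitive_of p k" and [measurable]: "k \<in> borel_measurable borel" and nz: "\<And>u. p u \<noteq> 0"
  shows "primitive_of (\<lambda>u. inverse (p u)) (\<lambda>u. - (k u / (p u)\<^sup>2))"
proof -
  have cont: "continuous_on UNIV p" by (rule primitive_of_continuous[OF prim])
  define S where "S x y = - inverse (p x * p y)" for x y
  have "continuous_on UNIV (\<lambda>q. - inverse (p (fst q) * p (snd q)))"
    using nz by (intro continuous_intros continuous_on_compose2[OF cont]) auto
  then have S: "continuous_on UNIV (\<lambda>(x, y). S x y)"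
    by (simp add: S_def case_prod_beta')
  have sec: "inverse (p y) - inverse (p x) = S x y * (p y - p x)" for x y
    using nz[of x] nz[of y] by (simp add: S_def field_simps)
  have "primitive_of (\<lambda>u. inverse (p u)) (\<lambda>t. S t t * k t)"
    by (rule primitive_of_secant[OF bounded_bilinear_mult prim _ S sec]) simp
  moreover have "S t t * k t = - (k t / (p t)\<^sup>2)" for t
    by (simp add: S_def power2_eq_square divide_inverse)
  ultimately show ?thesis by simp
qed

text \<open>
  The velocity of a curve after reparametrization, as a function of its velocity \<open>v\<close> before; the next
  definition is its derivative at \<open>v\<close> in direction \<open>w\<close>.
\<close>
definition rescale :: "real \<Rightarrow> real \<Rightarrow> real \<Rightarrow> 'a::euclidean_space \<Rightarrow> 'a" where
  "rescale l a b v = inverse (l * (a + b * norm v)) *\<^sub>R v"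

definition rescale_deriv :: "real \<Rightarrow> real \<Rightarrow> real \<Rightarrow> 'a::euclidean_space \<Rightarrow> 'a \<Rightarrow> 'a" where
  "rescale_deriv l a b v w = inverse (l * (a + b * norm v)) *\<^sub>R w
     - (b * (v \<bullet> w) / (l * norm v * (a + b * norm v)\<^sup>2)) *\<^sub>R v"

lemma primitive_of_rescale:
  fixes g h :: "real \<Rightarrow> 'a::euclidean_space"
  assumes prim: "primitive_of g h" and [measurable]: "h \<in> borel_measurable borel" and nz: "\<And>u. g u \<noteq> 0"
    and l: "l \<noteq> 0" and p: "\<And>u. a + b * norm (g u) \<noteq> 0"
  shows "primitive_of (\<lambda>u. rescale l a b (g u)) (\<lambda>u. rescale_deriv l a b (g u) (h u))"
proof -
  have [measurable]: "g \<in> borel_measurable borel"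
    using primitive_of_continuous[OF prim] by (rule borel_measurable_continuous_onI)
  define p where "p u = l * (a + b * norm (g u))" for u
  define k where "k u = (g u \<bullet> h u) / norm (g u)" for u
  have [measurable]: "k \<in> borel_measurable borel" unfolding k_def by measurable
  have "primitive_of (\<lambda>u. norm (g u)) k"
    unfolding k_def by (rule primitive_of_norm[OF prim _ nz]) simp
  from primitive_of_add[OF primitive_of_const[of "l * a"] primitive_of_scaleR[OF this, of "l * b"]]
  have pp: "primitive_of p (\<lambda>u. (l * b) * k u)"
    unfolding p_def by (simp add: algebra_simps)
  have "primitive_of (\<lambda>u. inverse (p u)) (\<lambda>u. - ((l * b) * k u / (p u)\<^sup>2))"
    by (rule primitive_of_inverse[OF pp]) (use l assms(5) in \<open>auto simp: p_def\<close>)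
  from primitive_of_mult[OF prim _ this]
  have *: "primitive_of (\<lambda>u. inverse (p u) *\<^sub>R g u) (\<lambda>t. inverse (p t) *\<^sub>R h t + - ((l * b) * k t / (p t)\<^sup>2) *\<^sub>R g t)"
    unfolding p_def by measurable
  have eq: "(l * b) * k t / (p t)\<^sup>2 = b * (g t \<bullet> h t) / (l * norm (g t) * (a + b * norm (g t))\<^sup>2)" for t
    using l by (simp add: p_def k_def power_mult_distrib power2_eq_square)
  show ?thesis
    using * unfolding rescale_def rescale_deriv_def eq unfolding p_def by simp
qed

lemma rescale_deriv_diff: "rescale_deriv l a b v (x - y) = rescale_deriv l a b v x - rescale_deriv l a b v y"
  by (simp add: rescale_deriv_def algebra_simps inner_diff_right diff_divide_distrib)

text \<open>
  Each factor of the denominators is at least \<open>c\<close>, so the two summands have denominators at least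
  \<open>c\<^sup>2\<close> and \<open>c ^ 3\<close>; the latter summand also carries the factors \<open>b \<le> M\<close> and \<open>norm v \<le> B\<close>.
\<close>
lemma norm_rescale_deriv_le:
  assumes l: "l \<ge> c" and p: "a + b * norm v \<ge> c" and c: "c > 0" and b: "0 \<le> b" "b \<le> M" and v: "norm v \<le> B" "v \<noteq> 0"
  shows "norm (rescale_deriv l a b v w) \<le> (1 / c\<^sup>2 + M * B / c ^ 3) * norm w"
proof -
  define p where "p = a + b * norm v"
  have pc: "p \<ge> c" using p by (simp add: p_def)
  have lp: "c\<^sup>2 \<le> l * p" "c ^ 3 \<le> l * p\<^sup>2"
    using l pc c by (auto simp: power2_eq_square power3_eq_cube mult.assoc intro!: mult_mono)
  have "norm (rescale_deriv l a b v w) \<le> norm (inverse (l * p) *\<^sub>R w) + norm ((b * (v \<bullet> w) / (l * norm v * p\<^sup>2)) *\<^sub>R v)"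
    unfolding rescale_deriv_def p_def by (rule norm_triangle_ineq4)
  also have "norm (inverse (l * p) *\<^sub>R w) \<le> 1 / c\<^sup>2 * norm w"
  proof -
    have "inverse (l * p) \<le> inverse (c\<^sup>2)"
      using lp(1) c by (intro le_imp_inverse_le) auto
    then show ?thesis using lp c l pc by (simp add: divide_inverse mult_right_mono)
  qed
  also have "norm ((b * (v \<bullet> w) / (l * norm v * p\<^sup>2)) *\<^sub>R v) \<le> M * B / c ^ 3 * norm w"
  proof -
    have "norm ((b * (v \<bullet> w) / (l * norm v * p\<^sup>2)) *\<^sub>R v) = b * \<bar>v \<bullet> w\<bar> / (l * p\<^sup>2)"
      using b l c v by (simp add: abs_mult)
    also have "\<dots> \<le> M * (B * norm w) / c ^ 3"
    proof (rule frac_le)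
      have "\<bar>v \<bullet> w\<bar> \<le> norm v * norm w" by (rule Cauchy_Schwarz_ineq2)
      also have "\<dots> \<le> B * norm w" using v by (intro mult_right_mono) auto
      finally show "b * \<bar>v \<bullet> w\<bar> \<le> M * (B * norm w)" using b by (intro mult_mono) auto
      have "0 \<le> B" using v(1) norm_ge_zero order_trans by blast
      then show "0 \<le> M * (B * norm w)" using b by (intro mult_nonneg_nonneg) auto
    qed (use c lp in auto)
    finally show ?thesis by (simp add: mult_ac)
  qed
  finally show ?thesis by (simp add: distrib_right)
qed

lemma rescale_lipschitz:
  fixes v w :: "'a::euclidean_space"
  assumes l: "l \<ge> c" and p: "a + b * norm v \<ge> c" "a + b * norm w \<ge> c" and c: "c > 0" and b: "0 \<le> b" "b \<le> M"
    and B: "norm w \<le> B"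
  shows "norm (rescale l a b v - rescale l a b w) \<le> (1 / c\<^sup>2 + M * B / c ^ 3) * norm (v - w)"
proof -
  define p q where "p = a + b * norm v" and "q = a + b * norm w"
  have pc: "p \<ge> c" "q \<ge> c" using p by (auto simp: p_def q_def)
  have lp: "c\<^sup>2 \<le> l * p" "c ^ 3 \<le> l * p * q"
    using l pc c by (auto simp: power2_eq_square power3_eq_cube intro!: mult_mono)
  have nz: "l \<noteq> 0" "p \<noteq> 0" "q \<noteq> 0" using l pc c by auto
  have "rescale l a b v - rescale l a b w = inverse (l * p) *\<^sub>R (v - w) + (inverse (l * p) - inverse (l * q)) *\<^sub>R w"
    by (simp add: rescale_def p_def q_def algebra_simps)
  also have "inverse (l * p) - inverse (l * q) = (q - p) / (l * p * q)"
    using nz by (simp add: field_simps)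
  finally have "norm (rescale l a b v - rescale l a b w)
      \<le> norm (inverse (l * p) *\<^sub>R (v - w)) + norm (((q - p) / (l * p * q)) *\<^sub>R w)"
    using norm_triangle_ineq by metis
  also have "norm (inverse (l * p) *\<^sub>R (v - w)) \<le> 1 / c\<^sup>2 * norm (v - w)"
  proof -
    have "inverse (l * p) \<le> inverse (c\<^sup>2)"
      using lp(1) c by (intro le_imp_inverse_le) auto
    then show ?thesis using l pc c by (simp add: divide_inverse mult_right_mono)
  qed
  also have "norm (((q - p) / (l * p * q)) *\<^sub>R w) \<le> M * B / c ^ 3 * norm (v - w)"
  proof -
    have "norm (((q - p) / (l * p * q)) *\<^sub>R w) = (\<bar>q - p\<bar> * norm w) / (l * p * q)"
      using l pc c by (simp add: abs_mult)
    also have "\<dots> \<le> ((M * norm (v - w)) * B) / c ^ 3"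
    proof (rule frac_le)
      have "q - p = b * (norm w - norm v)" by (simp add: p_def q_def algebra_simps)
      then have "\<bar>q - p\<bar> = b * \<bar>norm w - norm v\<bar>" using b by (simp add: abs_mult)
      also have "\<dots> \<le> M * norm (v - w)"
        using b norm_triangle_ineq3[of w v] by (intro mult_mono) (auto simp: norm_minus_commute)
      finally show "\<bar>q - p\<bar> * norm w \<le> M * norm (v - w) * B" using b B by (intro mult_mono) auto
      have "0 \<le> B" using B norm_ge_zero order_trans by blast
      then show "0 \<le> M * norm (v - w) * B" using b by (intro mult_nonneg_nonneg) auto
    qed (use c lp in auto)
    finally show ?thesis by (simp add: mult_ac)
  qed
  finally show ?thesis by (simp add: distrib_right)
qed

context circle_diffeo
begin

text \<open>
  Integration by substitution for integrable densities, applied to each coordinate.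
\<close>
lemma primitive_of_inverse_map:
  fixes q k :: "real \<Rightarrow> 'a::euclidean_space"
  assumes prim: "primitive_of q k"
  shows "primitive_of (\<lambda>t. q (inverse_map t)) (\<lambda>t. inverse (\<theta>' (inverse_map t)) *\<^sub>R k (inverse_map t))"
  unfolding primitive_of_def
proof (intro allI impI)
  fix a b :: real assume "a \<le> b"
  let ?d = "\<lambda>t. inverse (\<theta>' (inverse_map t))"
  have ab: "inverse_map a \<le> inverse_map b" using \<open>a \<le> b\<close> by (rule inverse_map_mono)
  note K = primitive_ofD[OF prim ab]
  have cont_d: "continuous_on {a..b} ?d"
  proof (intro continuous_intros continuous_on_compose2[OF cont' inverse_map_continuous])
    show "\<forall>t\<in>{a..b}. \<theta>' (inverse_map t) \<noteq> 0"
      using derivative_pos by (metis less_irrefl)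
  qed auto
  have pos_d: "?d t \<ge> 0" for t using derivative_pos[of "inverse_map t"] by simp
  have I: "set_integrable lborel {a..b} (\<lambda>t. (k (inverse_map t) \<bullet> i) * ?d t)"
    and E: "(LBINT t. (k (inverse_map t) \<bullet> i) * ?d t * indicator {a..b} t)
      = (LBINT u. (k u \<bullet> i) * indicator {inverse_map a..inverse_map b} u)" for i
  proof -
    have si: "set_integrable lborel {inverse_map a..inverse_map b} (\<lambda>u. k u \<bullet> i)"
      using K(1) integrable_bounded_linear[OF bounded_linear_inner_left, of lborel "\<lambda>u. indicator {inverse_map a..inverse_map b} u *\<^sub>R k u" i]
      unfolding set_integrable_def by simp
    note S = integral_substitution[OF si inverse_map_deriv cont_d pos_d \<open>a \<le> b\<close>]
    show "set_integrable lborel {a..b} (\<lambda>t. (k (inverse_map t) \<bullet> i) * ?d t)" using S(1) .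
    show "(LBINT t. (k (inverse_map t) \<bullet> i) * ?d t * indicator {a..b} t)
      = (LBINT u. (k u \<bullet> i) * indicator {inverse_map a..inverse_map b} u)" using S(2) by simp
  qed
  have rep: "indicator {a..b} t *\<^sub>R (?d t *\<^sub>R k (inverse_map t))
      = (\<Sum>i\<in>Basis. (indicator {a..b} t *\<^sub>R ((k (inverse_map t) \<bullet> i) * ?d t)) *\<^sub>R i)" for t
  proof -
    have "indicator {a..b} t *\<^sub>R (?d t *\<^sub>R k (inverse_map t))
      = (indicator {a..b} t * ?d t) *\<^sub>R (\<Sum>i\<in>Basis. (k (inverse_map t) \<bullet> i) *\<^sub>R i)"
      by (simp add: euclidean_representation)
    then show ?thesis by (simp add: scaleR_sum_right mult_ac)
  qed
  show "set_integrable lborel {a..b} (\<lambda>t. ?d t *\<^sub>R k (inverse_map t))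
      \<and> (LBINT t:{a..b}. ?d t *\<^sub>R k (inverse_map t)) = q (inverse_map b) - q (inverse_map a)"
  proof
    show D: "set_integrable lborel {a..b} (\<lambda>t. ?d t *\<^sub>R k (inverse_map t))"
      unfolding set_integrable_def rep
      by (intro Bochner_Integration.integrable_sum integrable_scaleR_left) (use I in \<open>simp add: set_integrable_def\<close>)
    show "(LBINT t:{a..b}. ?d t *\<^sub>R k (inverse_map t)) = q (inverse_map b) - q (inverse_map a)"
    proof (rule euclidean_eqI)
      fix i :: 'a assume "i \<in> Basis"
      have "(LBINT t:{a..b}. ?d t *\<^sub>R k (inverse_map t)) \<bullet> i
          = (LBINT t. (indicator {a..b} t *\<^sub>R (?d t *\<^sub>R k (inverse_map t))) \<bullet> i)"
        using D unfolding set_lebesgue_integral_def set_integrable_def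
        by (rule integral_bounded_linear[OF bounded_linear_inner_left, symmetric])
      also have "\<dots> = (LBINT t. (k (inverse_map t) \<bullet> i) * ?d t * indicator {a..b} t)"
        by (intro Bochner_Integration.integral_cong) auto
      also have "\<dots> = (LBINT u. (indicator {inverse_map a..inverse_map b} u *\<^sub>R k u) \<bullet> i)"
        unfolding E by (intro Bochner_Integration.integral_cong) auto
      also have "\<dots> = (LBINT u:{inverse_map a..inverse_map b}. k u) \<bullet> i"
        using K(1) unfolding set_lebesgue_integral_def set_integrable_def
        by (rule integral_bounded_linear[OF bounded_linear_inner_left])
      finally show "(LBINT t:{a..b}. ?d t *\<^sub>R k (inverse_map t)) \<bullet> i = (q (inverse_map b) - q (inverse_map a)) \<bullet> i"
        by (simp add: K(2))
    qed
  qed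
qed

end

definition curve_length :: "(real \<Rightarrow> 'a::euclidean_space) \<Rightarrow> real" where
  "curve_length g = (LBINT u:{0..1}. norm (g u))"

text \<open>
  The derivative of \<open>arc_param\<close>, which interpolates between the identity for \<open>\<sigma> = 0\<close> and arc length
  divided by total length for \<open>\<sigma> = 1\<close>. The argument \<open>g\<close> is the velocity of the curve.
\<close>
definition arc_speed :: "real \<Rightarrow> (real \<Rightarrow> 'a::euclidean_space) \<Rightarrow> real \<Rightarrow> real" where
  "arc_speed \<sigma> g t = (1 - \<sigma>) + \<sigma> / curve_length g * norm (g t)"

definition arc_param :: "real \<Rightarrow> (real \<Rightarrow> 'a::euclidean_space) \<Rightarrow> real \<Rightarrow> real" where
  "arc_param \<sigma> g t = (1 - \<sigma>) * t + \<sigma> / curve_length g * (LBINT u=ereal 0..ereal t. norm (g u))"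

lemma curve_length_bounds:
  assumes cont: "continuous_on UNIV g" and b: "\<And>u. m \<le> norm (g u)" "\<And>u. norm (g u) \<le> B"
  shows "m \<le> curve_length g" "curve_length g \<le> B"
proof -
  have I: "set_integrable lborel {0..1::real} (\<lambda>u. norm (g u))"
    by (intro borel_integrable_atLeastAtMost' continuous_intros continuous_on_subset[OF cont]) simp
  have C: "set_integrable lborel {0..1::real} (\<lambda>u. v)" for v :: real
    by (intro borel_integrable_atLeastAtMost' continuous_intros)
  have "(LBINT u:{0..1::real}. m) \<le> curve_length g"
    unfolding curve_length_def by (rule set_integral_mono[OF C I b(1)])
  then show "m \<le> curve_length g" by (simp add: set_lebesgue_integral_def)
  have "curve_length g \<le> (LBINT u:{0..1::real}. B)"
    unfolding curve_length_def by (rule set_integral_mono[OF I C b(2)])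
  then show "curve_length g \<le> B" by (simp add: set_lebesgue_integral_def)
qed

text \<open>
  The ratio of speed to length lies between \<open>m / B\<close> and \<open>B / m\<close>, and so does 1; hence the same bounds
  hold for every convex combination, uniformly in \<open>\<sigma>\<close>.
\<close>
lemma arc_param_diffeo:
  assumes cont: "continuous_on UNIV g" and per: "periodic1 g"
    and b: "\<And>u. m \<le> norm (g u)" "\<And>u. norm (g u) \<le> B" and m: "0 < m" and \<sigma>: "\<sigma> \<in> {0..1}"
  shows "circle_diffeo (arc_param \<sigma> g) (arc_speed \<sigma> g) (m / B) (B / m)"
proof
  define L where "L = curve_length g"
  have L: "m \<le> L" "L \<le> B" unfolding L_def by (rule curve_length_bounds[OF cont b])+
  have mB: "m \<le> B" "0 < B" "0 < L" using L m by auto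
  define A where "A t = 0 + (LBINT u=ereal 0..ereal t. norm (g u))" for t
  have cn: "continuous_on UNIV (\<lambda>u. norm (g u))" by (intro continuous_intros cont)
  have I: "set_integrable lborel {x..y} (\<lambda>u. norm (g u))" for x y
    by (rule borel_integrable_atLeastAtMost') (rule continuous_on_subset[OF cn], simp)
  have prim: "primitive_of A (\<lambda>u. norm (g u))"
    unfolding A_def by (rule primitive_of_ext[where c = 0]) (auto simp: I zero_ereal_def)
  have dA: "(A has_real_derivative norm (g t)) (at t)" for t
    using primitive_of_continuous_derivative[OF prim cn]
    by (simp add: has_real_derivative_iff_has_vector_derivative)
  have A0: "A 0 = 0" by (simp add: A_def interval_integral_endpoints_same)
  have A1: "A 1 = L" using primitive_ofD(2)[OF prim, of 0 1] A0 by (simp add: L_def curve_length_def)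
  have A_plus: "A (t + 1) = A t + L" for t
  proof -
    have "((\<lambda>u. A (u + 1) - A u) has_real_derivative 0) (at x)" for x
    proof -
      have "((\<lambda>u. A (u + 1)) has_real_derivative norm (g x)) (at x)"
        using dA[of "x + 1"] DERIV_shift[of A "norm (g x)" x 1] by (simp add: periodic1D[OF per])
      from DERIV_diff[OF this dA[of x]] show ?thesis by simp
    qed
    then show ?thesis
      using DERIV_isconst_all[of "\<lambda>u. A (u + 1) - A u" t 0] A0 A1 by simp
  qed
  have eq: "arc_param \<sigma> g = (\<lambda>t. (1 - \<sigma>) * t + \<sigma> / L * A t)"
    by (simp add: fun_eq_iff arc_param_def A_def L_def)
  show "(arc_param \<sigma> g has_real_derivative arc_speed \<sigma> g t) (at t)" for t
    unfolding eq arc_speed_def L_def[symmetric] using mB(3) by (auto intro!: derivative_eq_intros dA)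
  show "continuous_on UNIV (arc_speed \<sigma> g)"
    unfolding arc_speed_def[abs_def] by (intro continuous_intros cont)
  show "0 < m / B" using m mB by simp
  show "m / B \<le> arc_speed \<sigma> g t" for t
  proof -
    have "m / B \<le> norm (g t) / L" using b(1)[of t] L m mB by (intro frac_le) auto
    moreover have "m / B \<le> 1" using mB by simp
    ultimately have "(1 - \<sigma>) * (m / B) + \<sigma> * (m / B) \<le> (1 - \<sigma>) * 1 + \<sigma> * (norm (g t) / L)"
      using \<sigma> by (intro add_mono mult_left_mono) auto
    moreover have "(1 - \<sigma>) * (m / B) + \<sigma> * (m / B) = m / B"
      unfolding distrib_right[symmetric] by simp
    ultimately show ?thesis by (simp add: arc_speed_def L_def[symmetric])
  qed
  show "arc_speed \<sigma> g t \<le> B / m" for t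
  proof -
    have "norm (g t) / L \<le> B / m" using b(2)[of t] L m mB by (intro frac_le) auto
    moreover have "1 \<le> B / m" using mB m by simp
    ultimately have "(1 - \<sigma>) * 1 + \<sigma> * (norm (g t) / L) \<le> (1 - \<sigma>) * (B / m) + \<sigma> * (B / m)"
      using \<sigma> by (intro add_mono mult_left_mono) auto
    moreover have "(1 - \<sigma>) * (B / m) + \<sigma> * (B / m) = B / m"
      unfolding distrib_right[symmetric] by simp
    ultimately show ?thesis by (simp add: arc_speed_def L_def[symmetric])
  qed
  show "arc_param \<sigma> g (t + 1) = arc_param \<sigma> g t + 1" for t
  proof -
    have "L \<noteq> 0" using mB(3) by simp
    then show ?thesis unfolding eq A_plus by (simp add: algebra_simps)
  qed
  show "arc_param \<sigma> g 0 = 0" unfolding eq A0 by simp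
qed

section \<open>The homotopy to unit speed\<close>

definition homotopy_scale :: "real \<Rightarrow> (real \<Rightarrow> 'a::euclidean_space) \<Rightarrow> real" where
  "homotopy_scale \<sigma> g = (1 - \<sigma>) + \<sigma> * curve_length g"

definition homotopy_velocity :: "real \<Rightarrow> (real \<Rightarrow> 'a::euclidean_space) \<Rightarrow> 'a \<Rightarrow> 'a" where
  "homotopy_velocity \<sigma> g v = rescale (homotopy_scale \<sigma> g) (1 - \<sigma>) (\<sigma> / curve_length g) v"

definition homotopy_acceleration :: "real \<Rightarrow> (real \<Rightarrow> 'a::euclidean_space) \<Rightarrow> 'a \<Rightarrow> 'a \<Rightarrow> 'a" where
  "homotopy_acceleration \<sigma> g v w = rescale_deriv (homotopy_scale \<sigma> g) (1 - \<sigma>) (\<sigma> / curve_length g) v w"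

text \<open>
  At \<open>\<sigma> = 1\<close> the reparametrization by the inverse of \<open>arc_param\<close> makes the speed constant, and division by
  \<open>homotopy_scale\<close>, which is then the length, makes this constant equal to 1. A curve of unit speed is fixed for all \<open>\<sigma>\<close>.
\<close>
definition unit_speed_homotopy :: "(real \<Rightarrow> 'a::euclidean_space) \<Rightarrow> real \<Rightarrow> real \<Rightarrow> 'a" where
  "unit_speed_homotopy \<gamma> \<sigma> t = (let g = \<lambda>u. vector_derivative \<gamma> (at u) in
     inverse (homotopy_scale \<sigma> g) *\<^sub>R \<gamma> (inv (arc_param \<sigma> g) t))"

lemma unit_speed_homotopy_jet_eq:
  assumes "sobolev_jet s \<gamma> g h"
  shows "unit_speed_homotopy \<gamma> \<sigma> t = inverse (homotopy_scale \<sigma> g) *\<^sub>R \<gamma> (inv (arc_param \<sigma> g) t)"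
  using sobolev_jetD(11)[OF assms] by (simp add: unit_speed_homotopy_def)

lemma periodic_bounded_below:
  fixes g :: "real \<Rightarrow> 'a::euclidean_space"
  assumes cont: "continuous_on UNIV g" and per: "periodic1 g" and nz: "\<And>u. g u \<noteq> 0"
  obtains m where "m > 0" "\<And>u. m \<le> norm (g u)"
proof -
  have "continuous_on {0..1} (\<lambda>u. norm (g u))"
    by (intro continuous_intros continuous_on_subset[OF cont]) simp
  then obtain x where x: "x \<in> {0..1}" "\<And>u. u \<in> {0..1} \<Longrightarrow> norm (g x) \<le> norm (g u)"
    using continuous_attains_inf[of "{0..1::real}" "\<lambda>u. norm (g u)"] by auto
  have "norm (g x) \<le> norm (g u)" for u
  proof -
    have "g u = g (frac u)"
      using periodic1_of_int[OF per, of "frac u" "\<lfloor>u\<rfloor>"] by (simp add: frac_def)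
    moreover have "frac u \<in> {0..1}" by (simp add: less_imp_le frac_lt_1)
    ultimately show ?thesis using x(2)[of "frac u"] by simp
  qed
  then show ?thesis using that[of "norm (g x)"] nz by simp
qed

text \<open>
  Everything that enters the homotopy at time \<open>\<sigma>\<close> is controlled by an upper and a lower bound for the
  speed. A \<open>C\<^sup>1\<close>-convergent sequence of regular curves has common bounds, hence common constants.
\<close>
locale speed_bounds =
  fixes g :: "real \<Rightarrow> 'a::euclidean_space" and m B \<sigma> :: real
  assumes cont: "continuous_on UNIV g" and per: "periodic1 g"
    and lower: "\<And>u. m \<le> norm (g u)" and upper: "\<And>u. norm (g u) \<le> B"
    and m: "0 < m" and \<sigma>: "\<sigma> \<in> {0..1}"
begin

abbreviation c_low :: real where "c_low \<equiv> min m (m / B)"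
abbreviation K_lip :: real where "K_lip \<equiv> 1 / c_low\<^sup>2 + (1 / m) * B / c_low ^ 3"

lemma diffeo: "circle_diffeo (arc_param \<sigma> g) (arc_speed \<sigma> g) (m / B) (B / m)"
  by (rule arc_param_diffeo[OF cont per lower upper m \<sigma>])

lemma m_le_B: "m \<le> B"
  using lower[of 0] upper[of 0] by linarith

lemma B_pos: "B > 0"
  using m m_le_B by linarith

lemma c_low_pos: "c_low > 0"
  using m B_pos by simp

lemma length: "m \<le> curve_length g" "curve_length g \<le> B"
  by (rule curve_length_bounds[OF cont lower upper])+

lemma scale_lower: "c_low \<le> homotopy_scale \<sigma> g"
proof -
  have "m / B \<le> 1" using m_le_B B_pos by simp
  then have "(1 - \<sigma>) * c_low + \<sigma> * c_low \<le> (1 - \<sigma>) * 1 + \<sigma> * curve_length g"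
    using \<sigma> length by (intro add_mono mult_left_mono) auto
  then show ?thesis by (simp add: homotopy_scale_def algebra_simps)
qed

lemma speed_eq: "(1 - \<sigma>) + \<sigma> / curve_length g * norm (g u) = arc_speed \<sigma> g u"
  by (simp add: arc_speed_def)

lemma speed_lower: "c_low \<le> (1 - \<sigma>) + \<sigma> / curve_length g * norm (g u)"
  unfolding speed_eq by (rule min.coboundedI2) (rule circle_diffeo.lower[OF diffeo])

lemma coeff: "0 \<le> \<sigma> / curve_length g" "\<sigma> / curve_length g \<le> 1 / m"
  using \<sigma> length m by (auto intro!: divide_nonneg_pos frac_le)

lemma nonzero: "g u \<noteq> 0"
  using lower[of u] m by auto

lemma velocity_lipschitz: "norm (homotopy_velocity \<sigma> g (g u) - homotopy_velocity \<sigma> g (g v)) \<le> K_lip * norm (g u - g v)"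
  unfolding homotopy_velocity_def
  by (rule rescale_lipschitz[OF scale_lower speed_lower speed_lower c_low_pos coeff upper])

lemma norm_acceleration_le: "norm (homotopy_acceleration \<sigma> g (g u) w) \<le> K_lip * norm w"
  unfolding homotopy_acceleration_def
  by (rule norm_rescale_deriv_le[OF scale_lower speed_lower c_low_pos coeff upper nonzero])

lemma norm_velocity_le: "norm (homotopy_velocity \<sigma> g (g u)) \<le> B / c_low\<^sup>2"
proof -
  let ?p = "(1 - \<sigma>) + \<sigma> / curve_length g * norm (g u)"
  have "c_low * c_low \<le> homotopy_scale \<sigma> g * ?p"
    using scale_lower speed_lower[of u] c_low_pos by (intro mult_mono) linarith+
  then have *: "c_low\<^sup>2 \<le> homotopy_scale \<sigma> g * ?p" by (simp only: power2_eq_square)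
  have "norm (homotopy_velocity \<sigma> g (g u)) = norm (g u) / \<bar>homotopy_scale \<sigma> g * ?p\<bar>"
    by (simp only: homotopy_velocity_def rescale_def norm_scaleR abs_inverse divide_inverse mult.commute)
  also have "\<dots> \<le> B / c_low\<^sup>2"
  proof (rule frac_le)
    show "0 < c_low\<^sup>2" by (rule zero_less_power[OF c_low_pos])
    show "c_low\<^sup>2 \<le> \<bar>homotopy_scale \<sigma> g * ?p\<bar>" by (rule order_trans[OF * abs_ge_self])
  qed (use upper B_pos in \<open>auto simp: less_imp_le\<close>)
  finally show ?thesis .
qed

lemma primitive_of_velocity:
  assumes "primitive_of g h" "h \<in> borel_measurable borel"
  shows "primitive_of (\<lambda>u. homotopy_velocity \<sigma> g (g u)) (\<lambda>u. homotopy_acceleration \<sigma> g (g u) (h u))"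
  unfolding homotopy_velocity_def homotopy_acceleration_def
proof (rule primitive_of_rescale[OF assms nonzero])
  show "homotopy_scale \<sigma> g \<noteq> 0" using scale_lower c_low_pos by linarith
  show "(1 - \<sigma>) + \<sigma> / curve_length g * norm (g u) \<noteq> 0" for u using speed_lower[of u] c_low_pos by linarith
qed

lemma borel_measurable_velocity: "(\<lambda>u. homotopy_velocity \<sigma> g (g u)) \<in> borel_measurable borel"
proof -
  have [measurable]: "g \<in> borel_measurable borel" using cont by (rule borel_measurable_continuous_onI)
  show ?thesis unfolding homotopy_velocity_def rescale_def by measurable
qed

lemma borel_measurable_acceleration:
  assumes [measurable]: "h \<in> borel_measurable borel"
  shows "(\<lambda>u. homotopy_acceleration \<sigma> g (g u) (h u)) \<in> borel_measurable borel"
proof -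
  have [measurable]: "g \<in> borel_measurable borel" using cont by (rule borel_measurable_continuous_onI)
  show ?thesis unfolding homotopy_acceleration_def rescale_deriv_def by measurable
qed

end

lemma speed_bounds_exist:
  assumes j: "sobolev_jet s \<gamma> g h" and nz: "\<And>u. g u \<noteq> 0" and \<sigma>: "\<sigma> \<in> {0..1}"
  obtains m B where "speed_bounds g m B \<sigma>"
proof -
  note J = sobolev_jetD[OF j]
  obtain m where m: "m > 0" "\<And>u. m \<le> norm (g u)"
    by (rule periodic_bounded_below[OF J(2,4) nz], rule that)
  obtain B where B: "B > 0" "\<And>u. norm (g u) \<le> B"
    by (rule periodic_bounded[OF J(2,4)], rule that)
  show ?thesis by (rule that[of m B], rule speed_bounds.intro) (use J m B \<sigma> in auto)
qed

lemma gagliardo_sq_lipschitz_le: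
  fixes f g :: "real \<Rightarrow> 'a::euclidean_space"
  assumes per: "periodic1 f" "periodic1 g" and [measurable]: "f \<in> borel_measurable borel" "g \<in> borel_measurable borel"
    and lip: "\<And>u v. norm (f u - f v) \<le> K * norm (g u - g v)"
  shows "gagliardo_sq s f \<le> ennreal (K\<^sup>2) * gagliardo_sq s g"
proof -
  have "gagliardo_sq s f \<le> gagliardo_sq s (\<lambda>u. K *\<^sub>R g u)"
    unfolding gagliardo_sq_def
  proof (intro nn_integral_mono mult_right_mono ennreal_leI divide_right_mono power_mono)
    fix u w
    show "norm (f (u + w) - f u) \<le> norm (K *\<^sub>R g (u + w) - K *\<^sub>R g u)"
      using lip[of "u + w" u] abs_ge_self[of K]
      by (metis (no_types, opaque_lifting) mult_right_mono norm_ge_zero norm_scaleR order_trans scaleR_diff_right)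
  qed auto
  then show ?thesis by (simp add: gagliardo_sq_scaleR per)
qed

lemma L2_norm_sq_le:
  fixes f g :: "real \<Rightarrow> 'a::euclidean_space"
  assumes [measurable]: "g \<in> borel_measurable borel" and le: "\<And>u. norm (f u) \<le> K * norm (g u)"
  shows "L2_norm_sq f \<le> ennreal (K\<^sup>2) * L2_norm_sq g"
proof -
  have "L2_norm_sq f \<le> L2_norm_sq (\<lambda>u. K *\<^sub>R g u)"
    unfolding L2_norm_sq_def
  proof (intro nn_integral_mono mult_right_mono ennreal_leI power_mono)
    fix u
    show "norm (f u) \<le> norm (K *\<^sub>R g u)"
      using le[of u] abs_ge_self[of K]
      by (metis (no_types, opaque_lifting) mult_right_mono norm_ge_zero norm_scaleR order_trans)
  qed auto
  then show ?thesis by (simp add: L2_norm_sq_scaleR)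
qed

lemma circle_diffeo_gagliardo_finite:
  fixes f :: "real \<Rightarrow> 'a::euclidean_space"
  assumes "circle_diffeo \<theta> \<theta>' c C" "s > 0" "periodic1 f" "f \<in> borel_measurable borel" "gagliardo_sq s f < \<infinity>"
  shows "gagliardo_sq s (\<lambda>t. f (inv \<theta> t)) < \<infinity>"
  by (rule gagliardo_sq_compose_tendsto(2)[where X = "\<lambda>k. \<theta>" and X' = "\<lambda>k. \<theta>'" and g = "\<lambda>k. f" and c = c and C = C])
    (use assms in \<open>auto simp: gagliardo_sq_def[of s "\<lambda>u. 0"]\<close>)

text \<open>
  In the reparametrized curve the factor \<open>arc_speed\<close> from the chain rule combines with the scaling to
  \<open>rescale\<close>, a Lipschitz function of the original velocity. Therefore the seminorm stays finite.
\<close>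
lemma sobolev_jet_homotopy:
  fixes \<gamma> :: "real \<Rightarrow> 'a::euclidean_space"
  assumes s: "s > 0" and j: "sobolev_jet s \<gamma> g h" and nz: "\<And>u. g u \<noteq> 0" and \<sigma>: "\<sigma> \<in> {0..1}"
  shows "sobolev_jet s (unit_speed_homotopy \<gamma> \<sigma>)
    (\<lambda>t. homotopy_velocity \<sigma> g (g (inv (arc_param \<sigma> g) t)))
    (\<lambda>t. inverse (arc_speed \<sigma> g (inv (arc_param \<sigma> g) t)) *\<^sub>R
       homotopy_acceleration \<sigma> g (g (inv (arc_param \<sigma> g) t)) (h (inv (arc_param \<sigma> g) t)))"
proof -
  note J = sobolev_jetD[OF j]
  obtain m B where "speed_bounds g m B \<sigma>" by (rule speed_bounds_exist[OF j nz \<sigma>])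
  then interpret speed_bounds g m B \<sigma> .
  interpret d: circle_diffeo "arc_param \<sigma> g" "arc_speed \<sigma> g" "m / B" "B / m" by (rule diffeo)
  let ?l = "homotopy_scale \<sigma> g"
  have eq: "unit_speed_homotopy \<gamma> \<sigma> = (\<lambda>t. inverse ?l *\<^sub>R \<gamma> (d.inverse_map t))"
    by (simp add: fun_eq_iff unit_speed_homotopy_jet_eq[OF j])
  have 1: "periodic1 (unit_speed_homotopy \<gamma> \<sigma>)"
    unfolding eq by (rule periodic1I) (simp add: periodic1D[OF d.periodic_compose[OF J(1)]])
  have 2: "(unit_speed_homotopy \<gamma> \<sigma> has_vector_derivative homotopy_velocity \<sigma> g (g (d.inverse_map t))) (at t)" for t
  proof -
    have "(d.inverse_map has_vector_derivative inverse (arc_speed \<sigma> g (d.inverse_map t))) (at t)"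
      using d.inverse_map_deriv by (simp add: has_real_derivative_iff_has_vector_derivative)
    from vector_diff_chain_at[OF this J(3)]
    have "((\<lambda>t. \<gamma> (d.inverse_map t)) has_vector_derivative
        inverse (arc_speed \<sigma> g (d.inverse_map t)) *\<^sub>R g (d.inverse_map t)) (at t)"
      by (simp add: o_def)
    from bounded_linear.has_vector_derivative[OF bounded_linear_scaleR_right this, of "inverse ?l"]
    show ?thesis
      unfolding eq homotopy_velocity_def rescale_def speed_eq by (simp add: mult.commute)
  qed
  have c: "continuous_on UNIV (\<lambda>u. homotopy_velocity \<sigma> g (g u))"
  proof -
    have "?l \<noteq> 0" using scale_lower c_low_pos by linarith
    moreover have "(1 - \<sigma>) + \<sigma> / curve_length g * norm (g u) \<noteq> 0" for u
      using speed_lower[of u] c_low_pos by linarith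
    ultimately show ?thesis
      unfolding homotopy_velocity_def rescale_def by (intro continuous_intros cont) auto
  qed
  have 3: "continuous_on UNIV (\<lambda>t. homotopy_velocity \<sigma> g (g (d.inverse_map t)))"
    by (rule continuous_on_compose2[OF c d.inverse_map_continuous]) simp
  have 4: "gagliardo_sq s (\<lambda>t. homotopy_velocity \<sigma> g (g (d.inverse_map t))) < \<infinity>" if "s < 1"
  proof -
    have "gagliardo_sq s g < \<infinity>" using j that by (simp add: sobolev_jet_def)
    then have fin: "gagliardo_sq s (\<lambda>t. g (d.inverse_map t)) < \<infinity>"
      by (rule circle_diffeo_gagliardo_finite[OF diffeo s J(4,10)])
    have perq: "periodic1 (\<lambda>u. homotopy_velocity \<sigma> g (g u))"
      by (rule periodic1I) (simp add: periodic1D[OF per])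
    have [measurable]: "g \<in> borel_measurable borel" "(\<lambda>u. homotopy_velocity \<sigma> g (g u)) \<in> borel_measurable borel"
      using J(10) borel_measurable_velocity by auto
    have m1: "(\<lambda>t. homotopy_velocity \<sigma> g (g (d.inverse_map t))) \<in> borel_measurable borel"
      using measurable_compose[OF d.borel_measurables(3) borel_measurable_velocity] .
    have m2: "(\<lambda>t. g (d.inverse_map t)) \<in> borel_measurable borel" by measurable
    have "gagliardo_sq s (\<lambda>t. homotopy_velocity \<sigma> g (g (d.inverse_map t)))
        \<le> ennreal (K_lip\<^sup>2) * gagliardo_sq s (\<lambda>t. g (d.inverse_map t))"
      by (rule gagliardo_sq_lipschitz_le[OF d.periodic_compose[OF perq] d.periodic_compose[OF per] m1 m2 velocity_lipschitz])
    also have "\<dots> < \<infinity>" using fin by (simp add: ennreal_mult_less_top)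
    finally show ?thesis .
  qed
  let ?z = "\<lambda>u. inverse (arc_speed \<sigma> g u) *\<^sub>R homotopy_acceleration \<sigma> g (g u) (h u)"
  have 5: "(\<lambda>t. ?z (d.inverse_map t)) \<in> L2_circle
      \<and> primitive_of (\<lambda>t. homotopy_velocity \<sigma> g (g (d.inverse_map t))) (\<lambda>t. ?z (d.inverse_map t))" if "\<not> s < 1"
  proof
    have h: "h \<in> L2_circle" "primitive_of g h" using j that by (auto simp: sobolev_jet_def)
    then have [measurable]: "h \<in> borel_measurable borel" and perh: "periodic1 h" by (auto simp: L2_circle_iff)
    show "primitive_of (\<lambda>t. homotopy_velocity \<sigma> g (g (d.inverse_map t))) (\<lambda>t. ?z (d.inverse_map t))"
      by (rule d.primitive_of_inverse_map[OF primitive_of_velocity[OF h(2)]]) simp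
    have zm: "?z \<in> borel_measurable borel"
      using borel_measurable_acceleration[of h] by measurable
    have zper: "periodic1 ?z"
      by (rule periodic1I) (simp add: periodic1D[OF per] periodic1D[OF perh] arc_speed_def)
    have zle: "norm (?z u) \<le> (B / m * K_lip) * norm (h u)" for u
    proof -
      have inv_le: "inverse (arc_speed \<sigma> g u) \<le> inverse (m / B)"
        using d.lower[of u] d.c_pos by (intro le_imp_inverse_le) auto
      have "norm (?z u) \<le> (B / m) * (K_lip * norm (h u))"
        unfolding norm_scaleR
      proof (rule mult_mono)
        show "\<bar>inverse (arc_speed \<sigma> g u)\<bar> \<le> B / m"
          using inv_le d.derivative_pos[of u] by simp
      qed (use m B_pos norm_acceleration_le[of u "h u"] in auto)
      then show ?thesis by (simp only: mult.assoc)
    qed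
    have "L2_norm_sq (\<lambda>t. ?z (d.inverse_map t)) \<le> ennreal (B / m) * L2_norm_sq ?z"
      by (rule d.L2_norm_sq_compose_le[OF zm])
    also have "\<dots> \<le> ennreal (B / m) * (ennreal ((B / m * K_lip)\<^sup>2) * L2_norm_sq h)"
      by (intro mult_left_mono L2_norm_sq_le zle) auto
    also have "\<dots> < \<infinity>"
      using h(1) by (simp add: L2_circle_iff ennreal_mult_less_top)
    finally show "(\<lambda>t. ?z (d.inverse_map t)) \<in> L2_circle"
      using d.periodic_compose[OF zper] measurable_compose[OF d.borel_measurables(3) zm]
      by (simp add: L2_circle_iff)
  qed
  show ?thesis
    unfolding sobolev_jet_def using 1 2 3 4 5 by simp
qed

section \<open>Continuity of the homotopy\<close>

lemma tendsto_compose_uniform: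
  fixes f :: "nat \<Rightarrow> real \<Rightarrow> 'a::real_normed_vector"
  assumes unif: "\<And>k u. norm (f k u - f' u) \<le> e k" and e: "e \<longlonglongrightarrow> 0"
    and cont: "continuous_on UNIV f'" and x: "x \<longlonglongrightarrow> x'"
  shows "(\<lambda>k. f k (x k)) \<longlonglongrightarrow> f' x'"
proof -
  have "(\<lambda>k. f k (x k) - f' (x k)) \<longlonglongrightarrow> 0"
    by (rule Lim_null_comparison[OF _ e]) (simp add: unif)
  moreover have "isCont f' x'" using cont by (simp add: continuous_on_eq_continuous_at)
  then have "(\<lambda>k. f' (x k)) \<longlonglongrightarrow> f' x'" using x by (rule isCont_tendsto_compose)
  ultimately have "(\<lambda>k. (f k (x k) - f' (x k)) + f' (x k)) \<longlonglongrightarrow> 0 + f' x'" by (rule tendsto_add)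
  then show ?thesis by simp
qed

text \<open>
  A convergent sequence of regular curves and times, with common bounds for the speeds. The primed letters
  denote the limits.
\<close>
locale homotopy_sequence =
  fixes s :: real and \<gamma> g h :: "nat \<Rightarrow> real \<Rightarrow> 'a::euclidean_space" and \<gamma>' g' h' :: "real \<Rightarrow> 'a"
    and \<sigma> :: "nat \<Rightarrow> real" and \<sigma>' m B :: real
  assumes s: "1 / 2 < s" and j: "\<And>k. sobolev_jet s (\<gamma> k) (g k) (h k)" and j': "sobolev_jet s \<gamma>' g' h'"
    and b: "\<And>k. speed_bounds (g k) m B (\<sigma> k)" and b': "speed_bounds g' m B \<sigma>'"
    and \<sigma>_lim: "\<sigma> \<longlonglongrightarrow> \<sigma>'"
    and E_lim: "(\<lambda>k. sobolev_energy s (\<lambda>u. \<gamma> k u - \<gamma>' u) (\<lambda>u. g k u - g' u) (\<lambda>u. h k u - h' u)) \<longlonglongrightarrow> 0"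
begin

sublocale k: speed_bounds "g k" m B "\<sigma> k" for k by (rule b)
sublocale l: speed_bounds g' m B \<sigma>' by (rule b')
sublocale dk: circle_diffeo "arc_param (\<sigma> k) (g k)" "arc_speed (\<sigma> k) (g k)" "m / B" "B / m" for k
  by (rule k.diffeo)
sublocale dl: circle_diffeo "arc_param \<sigma>' g'" "arc_speed \<sigma>' g'" "m / B" "B / m"
  by (rule l.diffeo)

lemmas J = sobolev_jetD[OF j]
lemmas J' = sobolev_jetD[OF j']

definition e :: "nat \<Rightarrow> real" where
  "e k = sobolev_const s * sqrt (enn2real (sobolev_energy s (\<lambda>u. \<gamma> k u - \<gamma>' u) (\<lambda>u. g k u - g' u) (\<lambda>u. h k u - h' u)))"

lemma sup_bounds: "norm (\<gamma> k u - \<gamma>' u) \<le> e k" "norm (g k u - g' u) \<le> e k"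
  using sup_le_sobolev_energy[OF s sobolev_jet_diff[OF j j'], of k u] by (simp_all add: e_def)

lemma e_lim: "e \<longlonglongrightarrow> 0"
proof -
  have "(\<lambda>k. enn2real (sobolev_energy s (\<lambda>u. \<gamma> k u - \<gamma>' u) (\<lambda>u. g k u - g' u) (\<lambda>u. h k u - h' u))) \<longlonglongrightarrow> 0"
    by (rule tendsto_enn2real) (use E_lim in auto)
  from tendsto_mult_left[OF tendsto_real_sqrt[OF this], of "sobolev_const s"]
  show ?thesis by (simp add: e_def[abs_def])
qed

lemma length_lim: "(\<lambda>k. curve_length (g k)) \<longlonglongrightarrow> curve_length g'"
proof -
  have I: "set_integrable lborel {0..1::real} (\<lambda>u. norm (f u))" if "continuous_on UNIV f" for f :: "real \<Rightarrow> 'a"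
    by (intro borel_integrable_atLeastAtMost' continuous_intros continuous_on_subset[OF that]) simp
  have C: "set_integrable lborel {0..1::real} (\<lambda>u. v)" for v :: real
    by (intro borel_integrable_atLeastAtMost' continuous_intros)
  have le: "curve_length f \<le> curve_length f' + d"
    if "continuous_on UNIV f" "continuous_on UNIV f'" "\<And>u. norm (f u) \<le> norm (f' u) + d" for f f' :: "real \<Rightarrow> 'a" and d
  proof -
    have "curve_length f \<le> (LBINT u:{0..1}. norm (f' u) + d)"
      unfolding curve_length_def by (rule set_integral_mono) (use that I C in auto)
    also have "\<dots> = curve_length f' + d"
      by (subst set_integral_add) (auto simp: I C that curve_length_def set_lebesgue_integral_def[of _ _ "\<lambda>u. d"])
    finally show ?thesis .
  qed
  have "norm (curve_length (g k) - curve_length g') \<le> e k" for k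
  proof -
    have 1: "norm (g k u) \<le> norm (g' u) + e k" "norm (g' u) \<le> norm (g k u) + e k" for u
      using sup_bounds(2)[of k u] norm_triangle_ineq2[of "g k u" "g' u"] norm_triangle_ineq2[of "g' u" "g k u"]
      by (auto simp: norm_minus_commute)
    show ?thesis
      using le[OF k.cont l.cont 1(1)] le[OF l.cont k.cont 1(2)] by (simp add: abs_le_iff)
  qed
  then have "(\<lambda>k. curve_length (g k) - curve_length g') \<longlonglongrightarrow> 0"
    by (intro Lim_null_comparison[OF _ e_lim]) simp
  then show ?thesis by (rule LIM_zero_cancel)
qed

lemma length_pos: "curve_length g' \<noteq> 0"
  using l.length(1) l.m by linarith

lemma scale_lim: "(\<lambda>k. homotopy_scale (\<sigma> k) (g k)) \<longlonglongrightarrow> homotopy_scale \<sigma>' g'"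
  unfolding homotopy_scale_def by (intro tendsto_intros \<sigma>_lim length_lim)

lemma scale_nonzero: "homotopy_scale \<sigma>' g' \<noteq> 0"
  using l.scale_lower l.c_low_pos by linarith

lemma g_lim: "x \<longlonglongrightarrow> x' \<Longrightarrow> (\<lambda>k. g k (x k)) \<longlonglongrightarrow> g' x'"
  by (rule tendsto_compose_uniform[OF sup_bounds(2) e_lim l.cont])

lemma arc_speed_lim: "x \<longlonglongrightarrow> x' \<Longrightarrow> (\<lambda>k. arc_speed (\<sigma> k) (g k) (x k)) \<longlonglongrightarrow> arc_speed \<sigma>' g' x'"
  unfolding arc_speed_def by (intro tendsto_intros \<sigma>_lim length_lim length_pos g_lim)

text \<open>
  The increments of the difference of two arc length functions are bounded by the supremum of the
  difference of the velocities times the length of the interval.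
\<close>
lemma arc_param_lim: "(\<lambda>k. arc_param (\<sigma> k) (g k) t) \<longlonglongrightarrow> arc_param \<sigma>' g' t"
proof -
  define A where "A f t = 0 + (LBINT u=ereal 0..ereal t. norm (f u :: 'a))" for f t
  have prim: "primitive_of (A f) (\<lambda>u. norm (f u))" if "continuous_on UNIV f" for f
  proof -
    have "set_integrable lborel {x..y} (\<lambda>u. norm (f u))" for x y :: real
      by (intro borel_integrable_atLeastAtMost' continuous_intros continuous_on_subset[OF that]) simp
    then show ?thesis
      unfolding A_def by (intro primitive_of_ext[where c = 0]) (auto simp: zero_ereal_def)
  qed
  have A0: "A f 0 = 0" for f by (simp add: A_def interval_integral_endpoints_same)
  have le: "norm (A (g k) b - A g' b - (A (g k) a - A g' a)) \<le> e k * (b - a)" if "a \<le> b" for a b k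
  proof -
    note p = primitive_of_diff[OF prim[OF k.cont[of k]] prim[OF l.cont]]
    have "norm (A (g k) b - A g' b - (A (g k) a - A g' a)) \<le> (LBINT u:{a..b}. norm (norm (g k u) - norm (g' u)))"
      using primitive_of_norm_le[OF p that] by simp
    also have "\<dots> \<le> (LBINT u:{a..b}. e k)"
    proof (rule set_integral_mono)
      show "set_integrable lborel {a..b} (\<lambda>u. norm (norm (g k u) - norm (g' u)))"
        by (rule set_integrable_norm[OF primitive_ofD(1)[OF p that]])
      show "set_integrable lborel {a..b} (\<lambda>u. e k)"
        by (intro borel_integrable_atLeastAtMost' continuous_intros)
      show "norm (norm (g k u) - norm (g' u)) \<le> e k" for u
        using norm_triangle_ineq3[of "g k u" "g' u"] sup_bounds(2)[of k u] by simp
    qed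
    also have "\<dots> = e k * (b - a)" using that by (simp add: set_lebesgue_integral_def)
    finally show ?thesis .
  qed
  have "norm (A (g k) t - A g' t) \<le> e k * \<bar>t\<bar>" for k
    using le[of 0 t k] le[of t 0 k] by (cases "0 \<le> t") (auto simp: A0 norm_minus_commute)
  moreover have "(\<lambda>k. e k * \<bar>t\<bar>) \<longlonglongrightarrow> 0"
    using tendsto_mult_right[OF e_lim, of "\<bar>t\<bar>"] by simp
  ultimately have "(\<lambda>k. A (g k) t - A g' t) \<longlonglongrightarrow> 0"
    by (intro Lim_null_comparison[of "\<lambda>k. A (g k) t - A g' t"]) auto
  then have "(\<lambda>k. A (g k) t) \<longlonglongrightarrow> A g' t" by (rule LIM_zero_cancel)
  then have "(\<lambda>k. (1 - \<sigma> k) * t + \<sigma> k / curve_length (g k) * A (g k) t)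
      \<longlonglongrightarrow> (1 - \<sigma>') * t + \<sigma>' / curve_length g' * A g' t"
    by (intro tendsto_intros \<sigma>_lim length_lim length_pos)
  then show ?thesis by (simp add: arc_param_def A_def)
qed

lemma inverse_lim: "(\<lambda>k. dk.inverse_map k t) \<longlonglongrightarrow> dl.inverse_map t"
  by (rule inverse_map_tendsto[OF k.diffeo l.diffeo arc_param_lim])

lemma velocity_lim: "x \<longlonglongrightarrow> x' \<Longrightarrow>
    (\<lambda>k. homotopy_velocity (\<sigma> k) (g k) (g k (x k))) \<longlonglongrightarrow> homotopy_velocity \<sigma>' g' (g' x')"
  unfolding homotopy_velocity_def rescale_def
proof (intro tendsto_intros \<sigma>_lim length_lim length_pos g_lim scale_lim)
  show "homotopy_scale \<sigma>' g' * (1 - \<sigma>' + \<sigma>' / curve_length g' * norm (g' x')) \<noteq> 0"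
    using scale_nonzero l.speed_lower[of x'] l.c_low_pos by auto
qed

lemma acceleration_lim: "x \<longlonglongrightarrow> x' \<Longrightarrow>
    (\<lambda>k. homotopy_acceleration (\<sigma> k) (g k) (g k (x k)) v) \<longlonglongrightarrow> homotopy_acceleration \<sigma>' g' (g' x') v"
  unfolding homotopy_acceleration_def rescale_deriv_def
proof (intro tendsto_intros \<sigma>_lim length_lim length_pos g_lim scale_lim)
  have nz: "1 - \<sigma>' + \<sigma>' / curve_length g' * norm (g' x') \<noteq> 0"
    using l.speed_lower[of x'] l.c_low_pos by linarith
  show "homotopy_scale \<sigma>' g' * (1 - \<sigma>' + \<sigma>' / curve_length g' * norm (g' x')) \<noteq> 0"
    using scale_nonzero nz by simp
  show "homotopy_scale \<sigma>' g' * norm (g' x') * (1 - \<sigma>' + \<sigma>' / curve_length g' * norm (g' x'))\<^sup>2 \<noteq> 0"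
    using scale_nonzero nz l.nonzero[of x'] by simp
qed

lemma top_order_lim:
  "(\<lambda>k. if s < 1 then gagliardo_sq s (\<lambda>u. g k u - g' u) else L2_norm_sq (\<lambda>u. h k u - h' u)) \<longlonglongrightarrow> 0"
  by (rule tendsto_sandwich[OF _ _ tendsto_const E_lim])
    (auto simp: sobolev_energy_def intro: add_increasing)

lemma position_energy_lim:
  "(\<lambda>k. L2_norm_sq (\<lambda>t. unit_speed_homotopy (\<gamma> k) (\<sigma> k) t - unit_speed_homotopy \<gamma>' \<sigma>' t)) \<longlonglongrightarrow> 0"
proof -
  obtain D where D: "D > 0" "\<And>u. norm (\<gamma>' u) \<le> D"
    by (rule periodic_bounded[OF J'(8,1)], rule that)
  obtain D' where D': "\<And>k. e k \<le> D'"
    using convergent_imp_Bseq[OF convergentI[OF e_lim]] unfolding Bseq_def by (auto simp: abs_le_iff)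
  define c where "c = l.c_low"
  have c: "c > 0" by (simp only: c_def l.c_low_pos)
  have le: "norm (inverse l *\<^sub>R x) \<le> (D + D') / c"
    if "c \<le> l" "norm x \<le> D + D'" for l and x :: 'a
  proof -
    have "norm (inverse l *\<^sub>R x) = norm x / l" using that c by (simp add: divide_inverse mult.commute)
    also have "\<dots> \<le> (D + D') / c" using that c by (intro frac_le) (auto intro: order_trans[OF norm_ge_zero])
    finally show ?thesis .
  qed
  have D'0: "0 \<le> D'" using D'[of 0] sup_bounds(1)[of 0 0] norm_ge_zero[of "\<gamma> 0 0 - \<gamma>' 0"] by linarith
  have "norm (\<gamma> k u) \<le> D + D'" for k u
    using sup_bounds(1)[of k u] D(2)[of u] D'[of k] norm_triangle_ineq2[of "\<gamma> k u" "\<gamma>' u"] by linarith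
  then have bk: "norm (unit_speed_homotopy (\<gamma> k) (\<sigma> k) t) \<le> (D + D') / c" for k t
    unfolding unit_speed_homotopy_jet_eq[OF j] c_def[symmetric] by (rule le[OF k.scale_lower[folded c_def]])
  have "norm (\<gamma>' u) \<le> D + D'" for u using D(2)[of u] D'0 by linarith
  then have bl: "norm (unit_speed_homotopy \<gamma>' \<sigma>' t) \<le> (D + D') / c" for t
    unfolding unit_speed_homotopy_jet_eq[OF j'] c_def[symmetric] by (rule le[OF l.scale_lower[folded c_def]])
  show ?thesis
  proof (rule L2_norm_sq_bounded_tendsto_0[where B = "(D + D') / c + (D + D') / c"])
    have jk: "sobolev_jet s (unit_speed_homotopy (\<gamma> k) (\<sigma> k))
      (\<lambda>t. homotopy_velocity (\<sigma> k) (g k) (g k (dk.inverse_map k t)))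
      (\<lambda>t. inverse (arc_speed (\<sigma> k) (g k) (dk.inverse_map k t)) *\<^sub>R
       homotopy_acceleration (\<sigma> k) (g k) (g k (dk.inverse_map k t)) (h k (dk.inverse_map k t)))" for k
      using s by (intro sobolev_jet_homotopy j k.nonzero k.\<sigma>) simp
    have jl: "sobolev_jet s (unit_speed_homotopy \<gamma>' \<sigma>')
      (\<lambda>t. homotopy_velocity \<sigma>' g' (g' (dl.inverse_map t)))
      (\<lambda>t. inverse (arc_speed \<sigma>' g' (dl.inverse_map t)) *\<^sub>R
       homotopy_acceleration \<sigma>' g' (g' (dl.inverse_map t)) (h' (dl.inverse_map t)))"
      using s by (intro sobolev_jet_homotopy j' l.nonzero l.\<sigma>) simp
    show "(\<lambda>t. unit_speed_homotopy (\<gamma> k) (\<sigma> k) t - unit_speed_homotopy \<gamma>' \<sigma>' t) \<in> borel_measurable borel" for k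
      by (intro borel_measurable_diff sobolev_jetD(9)[OF jk] sobolev_jetD(9)[OF jl])
    show "norm (unit_speed_homotopy (\<gamma> k) (\<sigma> k) t - unit_speed_homotopy \<gamma>' \<sigma>' t) \<le> (D + D') / c + (D + D') / c" for k t
      by (rule order_trans[OF norm_triangle_ineq4 add_mono[OF bk bl]])
    show "(\<lambda>k. unit_speed_homotopy (\<gamma> k) (\<sigma> k) t - unit_speed_homotopy \<gamma>' \<sigma>' t) \<longlonglongrightarrow> 0" for t
      unfolding unit_speed_homotopy_jet_eq[OF j] unit_speed_homotopy_jet_eq[OF j']
      by (intro LIM_zero tendsto_intros scale_lim scale_nonzero
          tendsto_compose_uniform[OF sup_bounds(1) e_lim J'(8)] inverse_lim)
  qed
qed

lemma velocity_measurable: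
  "(\<lambda>t. homotopy_velocity (\<sigma> k) (g k) (g k (dk.inverse_map k t))) \<in> borel_measurable borel"
  "(\<lambda>t. homotopy_velocity \<sigma>' g' (g' (dl.inverse_map t))) \<in> borel_measurable borel"
  using measurable_compose[OF dk.borel_measurables(3) k.borel_measurable_velocity]
    measurable_compose[OF dl.borel_measurables(3) l.borel_measurable_velocity] by auto

lemma velocity_energy_lim:
  "(\<lambda>k. L2_norm_sq (\<lambda>t. homotopy_velocity (\<sigma> k) (g k) (g k (dk.inverse_map k t))
     - homotopy_velocity \<sigma>' g' (g' (dl.inverse_map t)))) \<longlonglongrightarrow> 0"
proof (rule L2_norm_sq_bounded_tendsto_0)
  show "(\<lambda>t. homotopy_velocity (\<sigma> k) (g k) (g k (dk.inverse_map k t))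
     - homotopy_velocity \<sigma>' g' (g' (dl.inverse_map t))) \<in> borel_measurable borel" for k
    by (intro borel_measurable_diff velocity_measurable)
  show "norm (homotopy_velocity (\<sigma> k) (g k) (g k (dk.inverse_map k t))
     - homotopy_velocity \<sigma>' g' (g' (dl.inverse_map t))) \<le> B / l.c_low\<^sup>2 + B / l.c_low\<^sup>2" for k t
    by (rule order_trans[OF norm_triangle_ineq4 add_mono[OF k.norm_velocity_le l.norm_velocity_le]])
  show "(\<lambda>k. homotopy_velocity (\<sigma> k) (g k) (g k (dk.inverse_map k t))
     - homotopy_velocity \<sigma>' g' (g' (dl.inverse_map t))) \<longlonglongrightarrow> 0" for t
    by (intro LIM_zero velocity_lim inverse_lim)
qed

lemma velocity_gagliardo_lim:
  assumes "s < 1"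
  shows "(\<lambda>k. gagliardo_sq s (\<lambda>t. homotopy_velocity (\<sigma> k) (g k) (g k (dk.inverse_map k t))
     - homotopy_velocity \<sigma>' g' (g' (dl.inverse_map t)))) \<longlonglongrightarrow> 0"
proof (rule gagliardo_sq_lipschitz_compose_tendsto[where g = g and f = g'
      and q = "\<lambda>k u. homotopy_velocity (\<sigma> k) (g k) (g k u)" and q' = "\<lambda>u. homotopy_velocity \<sigma>' g' (g' u)"
      and X = "\<lambda>k. arc_param (\<sigma> k) (g k)" and \<theta> = "arc_param \<sigma>' g'"])
  show "s > 0" using s by simp
  show "circle_diffeo (arc_param (\<sigma> k) (g k)) (arc_speed (\<sigma> k) (g k)) (m / B) (B / m)" for k by (rule k.diffeo)
  show "circle_diffeo (arc_param \<sigma>' g') (arc_speed \<sigma>' g') (m / B) (B / m)" by (rule l.diffeo)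
  show "(\<lambda>k. arc_param (\<sigma> k) (g k) t) \<longlonglongrightarrow> arc_param \<sigma>' g' t" for t by (rule arc_param_lim)
  show "(\<lambda>k. arc_speed (\<sigma> k) (g k) t) \<longlonglongrightarrow> arc_speed \<sigma>' g' t" for t by (intro arc_speed_lim tendsto_const)
  show "periodic1 (g k)" for k by (rule k.per)
  show "periodic1 g'" by (rule l.per)
  show "g k \<in> borel_measurable borel" for k by (rule J(10))
  show "g' \<in> borel_measurable borel" by (rule J'(10))
  show "gagliardo_sq s g' < \<infinity>" using j' assms by (simp add: sobolev_jet_def)
  show "(\<lambda>k. gagliardo_sq s (\<lambda>u. g k u - g' u)) \<longlonglongrightarrow> 0" using top_order_lim assms by simp
  show "(\<lambda>k. g k t) \<longlonglongrightarrow> g' t" for t by (intro g_lim tendsto_const)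
  show "(\<lambda>k. g k (dk.inverse_map k t)) \<longlonglongrightarrow> g' (dl.inverse_map t)" for t by (intro g_lim inverse_lim)
  show "periodic1 (\<lambda>u. homotopy_velocity (\<sigma> k) (g k) (g k u))" for k
    by (rule periodic1I) (simp add: periodic1D[OF k.per])
  show "periodic1 (\<lambda>u. homotopy_velocity \<sigma>' g' (g' u))"
    by (rule periodic1I) (simp add: periodic1D[OF l.per])
  show "(\<lambda>u. homotopy_velocity (\<sigma> k) (g k) (g k u)) \<in> borel_measurable borel" for k
    by (rule k.borel_measurable_velocity)
  show "(\<lambda>u. homotopy_velocity \<sigma>' g' (g' u)) \<in> borel_measurable borel"
    by (rule l.borel_measurable_velocity)
  show "norm (homotopy_velocity (\<sigma> k) (g k) (g k u) - homotopy_velocity (\<sigma> k) (g k) (g k v))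
    \<le> l.K_lip * norm (g k u - g k v)" for k u v by (rule k.velocity_lipschitz)
  show "norm (homotopy_velocity \<sigma>' g' (g' u) - homotopy_velocity \<sigma>' g' (g' v)) \<le> l.K_lip * norm (g' u - g' v)" for u v
    by (rule l.velocity_lipschitz)
  show "(\<lambda>k. homotopy_velocity (\<sigma> k) (g k) (g k (dk.inverse_map k t)))
      \<longlonglongrightarrow> homotopy_velocity \<sigma>' g' (g' (dl.inverse_map t))" for t
    by (intro velocity_lim inverse_lim)
qed

text \<open>
  The second derivative is obtained from \<open>h k\<close> by composition, which is strongly continuous, followed by
  linear maps that depend on the velocity and converge pointwise.
\<close>
lemma acceleration_energy_lim:
  assumes "\<not> s < 1"
  shows "(\<lambda>k. L2_norm_sq (\<lambda>t.
      inverse (arc_speed (\<sigma> k) (g k) (dk.inverse_map k t)) *\<^sub>R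
        homotopy_acceleration (\<sigma> k) (g k) (g k (dk.inverse_map k t)) (h k (dk.inverse_map k t))
    - inverse (arc_speed \<sigma>' g' (dl.inverse_map t)) *\<^sub>R
        homotopy_acceleration \<sigma>' g' (g' (dl.inverse_map t)) (h' (dl.inverse_map t)))) \<longlonglongrightarrow> 0"
proof -
  have h: "h k \<in> L2_circle" "h' \<in> L2_circle" for k using j j' assms by (auto simp: sobolev_jet_def)
  have [measurable]: "h k \<in> borel_measurable borel" "h' \<in> borel_measurable borel"
    "g k \<in> borel_measurable borel" "g' \<in> borel_measurable borel" for k
    using h J(10) J'(10) by (auto simp: L2_circle_iff)
  have y': "(\<lambda>t. h' (dl.inverse_map t)) \<in> L2_circle"
  proof -
    have "L2_norm_sq (\<lambda>t. h' (dl.inverse_map t)) \<le> ennreal (B / m) * L2_norm_sq h'"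
      by (rule dl.L2_norm_sq_compose_le) measurable
    also have "\<dots> < \<infinity>" using h(2) by (simp add: L2_circle_iff ennreal_mult_less_top)
    finally show ?thesis using h(2) dl.periodic_compose[of h'] by (auto simp: L2_circle_iff)
  qed
  have ylim: "(\<lambda>k. L2_norm_sq (\<lambda>t. h k (dk.inverse_map k t) - h' (dl.inverse_map t))) \<longlonglongrightarrow> 0"
    by (rule L2_compose_tendsto[OF k.diffeo l.diffeo arc_param_lim h]) (use top_order_lim assms in simp)
  let ?T = "\<lambda>k t v. inverse (arc_speed (\<sigma> k) (g k) (dk.inverse_map k t)) *\<^sub>R
      homotopy_acceleration (\<sigma> k) (g k) (g k (dk.inverse_map k t)) v"
  let ?T' = "\<lambda>t v. inverse (arc_speed \<sigma>' g' (dl.inverse_map t)) *\<^sub>R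
      homotopy_acceleration \<sigma>' g' (g' (dl.inverse_map t)) v"
  have bound: "norm (inverse p *\<^sub>R x) \<le> (B / m * l.K_lip) * norm v"
    if "m / B \<le> p" "norm x \<le> l.K_lip * norm v" for p and x v :: 'a
  proof -
    have pos: "0 < m / B" by (rule dl.c_pos)
    have "norm (inverse p *\<^sub>R x) = inverse p * norm x" using that pos by simp
    also have "\<dots> \<le> inverse (m / B) * (l.K_lip * norm v)"
    proof (rule mult_mono)
      show "inverse p \<le> inverse (m / B)" using that pos by (intro le_imp_inverse_le)
      show "0 \<le> inverse (m / B)" using pos by (simp only: inverse_nonnegative_iff_nonnegative less_imp_le)
    qed (use that in auto)
    also have "\<dots> = (B / m * l.K_lip) * norm v" by (simp only: inverse_divide mult.assoc)
    finally show ?thesis .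
  qed
  show ?thesis
  proof (rule L2_apply_tendsto[where T = ?T and T' = ?T' and K = "B / m * l.K_lip"])
    show "(\<lambda>t. h k (dk.inverse_map k t)) \<in> borel_measurable borel" for k by measurable
    show "?T k t (v - w) = ?T k t v - ?T k t w" for k t v w
      by (simp only: homotopy_acceleration_def rescale_deriv_diff scaleR_diff_right)
    show "norm (?T k t v) \<le> (B / m * l.K_lip) * norm v" for k t v
      by (rule bound[OF dk.lower k.norm_acceleration_le])
    show "norm (?T' t v) \<le> (B / m * l.K_lip) * norm v" for t v
      by (rule bound[OF dl.lower l.norm_acceleration_le])
    show "(\<lambda>k. ?T k t v) \<longlonglongrightarrow> ?T' t v" for t v
      using dl.derivative_pos[of "dl.inverse_map t"]
      by (intro tendsto_intros arc_speed_lim acceleration_lim inverse_lim) simp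
    show "(\<lambda>t. ?T k t (y t)) \<in> borel_measurable borel" if [measurable]: "y \<in> borel_measurable borel" for k and y :: "real \<Rightarrow> 'a"
      unfolding homotopy_acceleration_def rescale_deriv_def by measurable
    show "(\<lambda>t. ?T' t (y t)) \<in> borel_measurable borel" if [measurable]: "y \<in> borel_measurable borel" for y :: "real \<Rightarrow> 'a"
      unfolding homotopy_acceleration_def rescale_deriv_def by measurable
  qed (use y' ylim in auto)
qed

lemma homotopy_energy_lim:
  "(\<lambda>k. sobolev_energy s
     (\<lambda>t. unit_speed_homotopy (\<gamma> k) (\<sigma> k) t - unit_speed_homotopy \<gamma>' \<sigma>' t)
     (\<lambda>t. homotopy_velocity (\<sigma> k) (g k) (g k (dk.inverse_map k t)) - homotopy_velocity \<sigma>' g' (g' (dl.inverse_map t)))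
     (\<lambda>t. inverse (arc_speed (\<sigma> k) (g k) (dk.inverse_map k t)) *\<^sub>R
        homotopy_acceleration (\<sigma> k) (g k) (g k (dk.inverse_map k t)) (h k (dk.inverse_map k t))
      - inverse (arc_speed \<sigma>' g' (dl.inverse_map t)) *\<^sub>R
        homotopy_acceleration \<sigma>' g' (g' (dl.inverse_map t)) (h' (dl.inverse_map t)))) \<longlonglongrightarrow> 0"
proof (cases "s < 1")
  case True
  then show ?thesis
    using tendsto_add[OF tendsto_add[OF position_energy_lim velocity_energy_lim] velocity_gagliardo_lim]
    by (simp add: sobolev_energy_def)
next
  case False
  then show ?thesis
    using tendsto_add[OF tendsto_add[OF position_energy_lim velocity_energy_lim] acceleration_energy_lim]
    by (simp add: sobolev_energy_def)
qed

end

section \<open>The strong deformation retractions\<close>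

lemma (in Metric_space) limitin_sequentially_iff_tendsto:
  assumes "l \<in> M" "\<And>n. x n \<in> M"
  shows "limitin mtopology x l sequentially \<longleftrightarrow> (\<lambda>n. d (x n) l) \<longlonglongrightarrow> 0"
  unfolding limit_metric_sequentially LIMSEQ_def using assms by auto

text \<open>
  The product with a set of real numbers is metrizable, so continuity may be tested on sequences.
\<close>
lemma (in Metric_space) continuous_map_prod_sequentially:
  fixes T :: "real set" and F :: "'a \<times> real \<Rightarrow> 'a"
  assumes S: "S \<subseteq> M" and F: "\<And>p. p \<in> S \<times> T \<Longrightarrow> F p \<in> S"
    and seq: "\<And>x \<sigma> x' \<sigma>'. \<lbrakk>\<And>k::nat. x k \<in> S; \<And>k. \<sigma> k \<in> T; x' \<in> S; \<sigma>' \<in> T;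
        (\<lambda>k. d (x k) x') \<longlonglongrightarrow> 0; \<sigma> \<longlonglongrightarrow> \<sigma>'\<rbrakk> \<Longrightarrow> (\<lambda>k. d (F (x k, \<sigma> k)) (F (x', \<sigma>'))) \<longlonglongrightarrow> 0"
  shows "continuous_map (prod_topology (subtopology mtopology S) (top_of_set T)) (subtopology mtopology S) F"
proof -
  interpret S: Submetric M d S by unfold_locales (rule S)
  interpret T: Submetric "UNIV :: real set" dist T by unfold_locales auto
  interpret ST: Metric_space12 S d T dist ..
  interpret Q: Metric_space12 "S \<times> T" "prod_dist d dist" S d
    by (intro Metric_space12.intro ST.prod_metric S.sub.Metric_space_axioms)
  have topT: "T.sub.mtopology = top_of_set T"
    using T.mtopology_submetric by simp
  have topP: "ST.Prod_metric.mtopology = prod_topology (subtopology mtopology S) (top_of_set T)"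
    using ST.mtopology_prod_metric by (simp add: S.mtopology_submetric topT)
  have "continuous_map ST.Prod_metric.mtopology S.sub.mtopology F"
    unfolding continuous_map_atin
  proof
    fix p assume "p \<in> topspace ST.Prod_metric.mtopology"
    then have p: "p \<in> S \<times> T" by simp
    show "limitin S.sub.mtopology F (F p) (atin ST.Prod_metric.mtopology p)"
      unfolding Q.limit_atin_sequentially
    proof (intro conjI allI impI F p)
      fix q :: "nat \<Rightarrow> 'a \<times> real"
      assume q: "range q \<subseteq> S \<times> T - {p} \<and> limitin ST.Prod_metric.mtopology q p sequentially"
      then have q_in: "q k \<in> S \<times> T" for k by auto
      have "limitin S.sub.mtopology (fst \<circ> q) (fst p) sequentially"
        "limitin (top_of_set T) (snd \<circ> q) (snd p) sequentially"
        using q unfolding topP limitin_pairwise S.mtopology_submetric by auto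
      then have "(\<lambda>k. d (fst (q k)) (fst p)) \<longlonglongrightarrow> 0" "(\<lambda>k. snd (q k)) \<longlonglongrightarrow> snd p"
        using p q_in by (auto simp: S.sub.limitin_sequentially_iff_tendsto mem_Times_iff limitin_subtopology o_def)
      then have "(\<lambda>k. d (F (fst (q k), snd (q k))) (F (fst p, snd p))) \<longlonglongrightarrow> 0"
        using q_in p by (intro seq) (auto simp: mem_Times_iff)
      then show "limitin S.sub.mtopology (F \<circ> q) (F p) sequentially"
        using F p q_in by (subst S.sub.limitin_sequentially_iff_tendsto) auto
    qed
  qed
  then show ?thesis by (simp only: topP S.mtopology_submetric)
qed

lemma sobolev_regular_iff_jet:
  assumes s: "1 / 2 < s" "s \<le> 1"
  shows "\<gamma> \<in> sobolev_regular s \<longleftrightarrow> (\<exists>g h. sobolev_jet s \<gamma> g h \<and> (\<forall>u. g u \<noteq> 0))"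
proof
  assume "\<gamma> \<in> sobolev_regular s"
  then have "\<gamma> \<in> sobolev s" and v: "\<And>u. vector_derivative \<gamma> (at u) \<noteq> 0"
    by (auto simp: sobolev_regular_def)
  then obtain g h where j: "sobolev_jet s \<gamma> g h" using sobolev_iff_jet[OF s] by blast
  then show "\<exists>g h. sobolev_jet s \<gamma> g h \<and> (\<forall>u. g u \<noteq> 0)"
    using v sobolev_jetD(11)[OF j] by (intro exI[of _ g] exI[of _ h]) auto
next
  assume "\<exists>g h. sobolev_jet s \<gamma> g h \<and> (\<forall>u. g u \<noteq> 0)"
  then obtain g h where j: "sobolev_jet s \<gamma> g h" and nz: "\<And>u. g u \<noteq> 0" by blast
  then show "\<gamma> \<in> sobolev_regular s"
    using sobolev_iff_jet[OF s] sobolev_jetD(11)[OF j] by (auto simp: sobolev_regular_def)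
qed

text \<open>
  Convergence in the Sobolev metric entails uniform convergence of the velocities. So from some index on
  all speeds lie between half the minimum of the limit speed and its maximum plus the same amount.
\<close>
lemma unit_speed_homotopy_dist_tendsto:
  fixes \<gamma> :: "nat \<Rightarrow> real \<Rightarrow> 'a::euclidean_space"
  assumes s: "1 / 2 < s" "s \<le> 1" and reg: "\<And>k. \<gamma> k \<in> sobolev_regular s" "\<gamma>' \<in> sobolev_regular s"
    and \<sigma>: "\<And>k. \<sigma> k \<in> {0..1}" "\<sigma>' \<in> {0..1}"
    and lim: "(\<lambda>k. sobolev_dist s (\<gamma> k) \<gamma>') \<longlonglongrightarrow> 0" "\<sigma> \<longlonglongrightarrow> \<sigma>'"
  shows "(\<lambda>k. sobolev_dist s (unit_speed_homotopy (\<gamma> k) (\<sigma> k)) (unit_speed_homotopy \<gamma>' \<sigma>')) \<longlonglongrightarrow> 0"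
proof -
  have "\<forall>k. \<exists>g h. sobolev_jet s (\<gamma> k) g h" using reg(1) sobolev_regular_iff_jet[OF s] by blast
  then obtain g h where j: "\<And>k. sobolev_jet s (\<gamma> k) (g k) (h k)" by metis
  obtain g' h' where j': "sobolev_jet s \<gamma>' g' h'" and nz: "\<And>u. g' u \<noteq> 0"
    using reg(2) sobolev_regular_iff_jet[OF s] by blast
  note J = sobolev_jetD[OF j] and J' = sobolev_jetD[OF j']
  obtain m where m: "m > 0" "\<And>u. m \<le> norm (g' u)"
    by (rule periodic_bounded_below[OF J'(2,4) nz], rule that)
  obtain B where B: "B > 0" "\<And>u. norm (g' u) \<le> B"
    by (rule periodic_bounded[OF J'(2,4)], rule that)
  have close: "norm (g k u - g' u) \<le> sobolev_const s * sobolev_dist s (\<gamma> k) \<gamma>'" for k u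
    using sup_le_sobolev_energy(2)[OF s(1) sobolev_jet_diff[OF j j'], of k u]
    by (simp add: sobolev_dist_jet[OF j j'])
  have "(\<lambda>k. sobolev_const s * sobolev_dist s (\<gamma> k) \<gamma>') \<longlonglongrightarrow> 0"
    using tendsto_mult_left[OF lim(1), of "sobolev_const s"] by simp
  then have "\<forall>\<^sub>F k in sequentially. sobolev_const s * sobolev_dist s (\<gamma> k) \<gamma>' < m / 2"
    using m(1) by (intro order_tendstoD(2)) auto
  then obtain N where N: "\<And>k. k \<ge> N \<Longrightarrow> sobolev_const s * sobolev_dist s (\<gamma> k) \<gamma>' < m / 2"
    by (auto simp: eventually_sequentially)
  have near: "norm (g (k + N) u - g' u) \<le> m / 2" for k u
    using close[of "k + N" u] N[of "k + N"] by simp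
  have bk: "speed_bounds (g (k + N)) (m / 2) (B + m / 2) (\<sigma> (k + N))" for k
  proof (rule speed_bounds.intro)
    show "m / 2 \<le> norm (g (k + N) u)" for u
      using near[of k u] m(2)[of u] norm_triangle_ineq2[of "g' u" "g (k + N) u"] by (simp add: norm_minus_commute)
    show "norm (g (k + N) u) \<le> B + m / 2" for u
      using near[of k u] B(2)[of u] norm_triangle_ineq2[of "g (k + N) u" "g' u"] by simp
  qed (use J m \<sigma> in auto)
  have bl: "speed_bounds g' (m / 2) (B + m / 2) \<sigma>'"
  proof (rule speed_bounds.intro)
    show "m / 2 \<le> norm (g' u)" for u using m(1) m(2)[of u] by simp
    show "norm (g' u) \<le> B + m / 2" for u using m(1) B(2)[of u] by simp
  qed (use J' m \<sigma> in auto)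
  interpret H: homotopy_sequence s "\<lambda>k. \<gamma> (k + N)" "\<lambda>k. g (k + N)" "\<lambda>k. h (k + N)" \<gamma>' g' h'
    "\<lambda>k. \<sigma> (k + N)" \<sigma>' "m / 2" "B + m / 2"
  proof (rule homotopy_sequence.intro[OF s(1) j j' bk bl LIMSEQ_ignore_initial_segment[OF lim(2)]])
    show "(\<lambda>k. sobolev_energy s (\<lambda>u. \<gamma> (k + N) u - \<gamma>' u) (\<lambda>u. g (k + N) u - g' u) (\<lambda>u. h (k + N) u - h' u)) \<longlonglongrightarrow> 0"
      using lim(1) unfolding sobolev_dist_tendsto_iff[OF j j'] by (rule LIMSEQ_ignore_initial_segment)
  qed
  have s0: "s > 0" using s by simp
  have "(\<lambda>k. sobolev_dist s (unit_speed_homotopy (\<gamma> (k + N)) (\<sigma> (k + N))) (unit_speed_homotopy \<gamma>' \<sigma>')) \<longlonglongrightarrow> 0"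
    using H.homotopy_energy_lim
    unfolding sobolev_dist_tendsto_iff[OF sobolev_jet_homotopy[OF s0 H.j H.k.nonzero H.k.\<sigma>]
        sobolev_jet_homotopy[OF s0 H.j' H.l.nonzero H.l.\<sigma>]] .
  then show ?thesis by (rule LIMSEQ_offset)
qed

text \<open>
  For \<open>c = 1\<close> the base point is moved to \<open>z\<close> in the course of the homotopy; a curve of unit speed that
  starts at \<open>z\<close> is not moved. For \<open>c = 0\<close> this is \<open>unit_speed_homotopy\<close>.
\<close>
definition based_homotopy :: "real \<Rightarrow> 'a::euclidean_space \<Rightarrow> (real \<Rightarrow> 'a) \<times> real \<Rightarrow> real \<Rightarrow> 'a" where
  "based_homotopy c z p = (\<lambda>t. unit_speed_homotopy (fst p) (snd p) t
     + (c * snd p) *\<^sub>R (z - unit_speed_homotopy (fst p) (snd p) 0))"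

lemma sobolev_jet_add_const:
  assumes "sobolev_jet s \<gamma> g h"
  shows "sobolev_jet s (\<lambda>t. \<gamma> t + v) g h"
  using sobolev_jet_add[OF assms sobolev_jet_const[of s v]] by simp

lemma based_homotopy_dist_tendsto:
  fixes \<gamma> :: "nat \<Rightarrow> real \<Rightarrow> 'a::euclidean_space"
  assumes s: "1 / 2 < s" "s \<le> 1" and reg: "\<And>k. \<gamma> k \<in> sobolev_regular s" "\<gamma>' \<in> sobolev_regular s"
    and \<sigma>: "\<And>k. \<sigma> k \<in> {0..1}" "\<sigma>' \<in> {0..1}"
    and lim: "(\<lambda>k. sobolev_dist s (\<gamma> k) \<gamma>') \<longlonglongrightarrow> 0" "\<sigma> \<longlonglongrightarrow> \<sigma>'"
  shows "(\<lambda>k. sobolev_dist s (based_homotopy c z (\<gamma> k, \<sigma> k)) (based_homotopy c z (\<gamma>', \<sigma>'))) \<longlonglongrightarrow> 0"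
proof -
  have s0: "s > 0" using s by simp
  have "\<forall>k. \<exists>g h. sobolev_jet s (unit_speed_homotopy (\<gamma> k) (\<sigma> k)) g h"
    using reg(1) \<sigma>(1) sobolev_regular_iff_jet[OF s] sobolev_jet_homotopy[OF s0] by blast
  then obtain g h where j: "\<And>k. sobolev_jet s (unit_speed_homotopy (\<gamma> k) (\<sigma> k)) (g k) (h k)" by metis
  obtain g' h' where j': "sobolev_jet s (unit_speed_homotopy \<gamma>' \<sigma>') g' h'"
    using reg(2) \<sigma>(2) sobolev_regular_iff_jet[OF s] sobolev_jet_homotopy[OF s0] by blast
  define H where "H k = unit_speed_homotopy (\<gamma> k) (\<sigma> k)" for k
  define H' where "H' = unit_speed_homotopy \<gamma>' \<sigma>'"
  have j: "sobolev_jet s (H k) (g k) (h k)" and j': "sobolev_jet s H' g' h'" for k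
    using j j' by (auto simp: H_def H'_def)
  define v where "v k = (c * \<sigma> k) *\<^sub>R (z - H k 0)" for k
  define v' where "v' = (c * \<sigma>') *\<^sub>R (z - H' 0)"
  have dist: "(\<lambda>k. sobolev_dist s (H k) H') \<longlonglongrightarrow> 0"
    unfolding H_def H'_def by (rule unit_speed_homotopy_dist_tendsto[OF s reg \<sigma> lim])
  have "(\<lambda>k. H k 0 - H' 0) \<longlonglongrightarrow> 0"
  proof (rule Lim_null_comparison)
    show "\<forall>\<^sub>F k in sequentially. norm (H k 0 - H' 0) \<le> sobolev_const s * sobolev_dist s (H k) H'"
      using sup_le_sobolev_energy(1)[OF s(1) sobolev_jet_diff[OF j j'], of _ 0]
      by (simp add: sobolev_dist_jet[OF j j'])
    show "(\<lambda>k. sobolev_const s * sobolev_dist s (H k) H') \<longlonglongrightarrow> 0"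
      using tendsto_mult_left[OF dist, of "sobolev_const s"] by simp
  qed
  then have "(\<lambda>k. H k 0) \<longlonglongrightarrow> H' 0" by (rule LIM_zero_cancel)
  then have v_lim: "v \<longlonglongrightarrow> v'"
    unfolding v_def v'_def by (intro tendsto_intros lim)
  let ?E = "\<lambda>k. sobolev_energy s (\<lambda>u. H k u - H' u) (\<lambda>u. g k u - g' u) (\<lambda>u. h k u - h' u)"
  let ?F = "\<lambda>k. sobolev_energy s (\<lambda>u. v k - v') (\<lambda>u. 0) (\<lambda>u. 0)"
  have E: "?E \<longlonglongrightarrow> 0" using dist by (simp add: sobolev_dist_tendsto_iff[OF j j'])
  have F_eq: "?F k = ennreal ((norm (v k - v'))\<^sup>2)" for k
    by (simp add: sobolev_energy_def L2_norm_sq_def gagliardo_sq_def nn_integral_cmult)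
  have "(\<lambda>k. ennreal ((norm (v k - v'))\<^sup>2)) \<longlonglongrightarrow> ennreal ((norm (v' - v'))\<^sup>2)"
    by (intro tendsto_ennrealI tendsto_intros v_lim)
  then have F: "?F \<longlonglongrightarrow> 0" by (simp add: F_eq)
  have "(\<lambda>k. 2 * ?E k + 2 * ?F k) \<longlonglongrightarrow> 2 * 0 + 2 * 0"
    by (intro tendsto_add ennreal_tendsto_cmult E F) auto
  then have upper: "(\<lambda>k. 2 * ?E k + 2 * ?F k) \<longlonglongrightarrow> 0" by simp
  have "(\<lambda>k. sobolev_energy s (\<lambda>u. (H k u + v k) - (H' u + v')) (\<lambda>u. g k u - g' u) (\<lambda>u. h k u - h' u)) \<longlonglongrightarrow> 0"
  proof (rule tendsto_sandwich[OF _ _ tendsto_const upper])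
    show "\<forall>\<^sub>F k in sequentially. sobolev_energy s (\<lambda>u. (H k u + v k) - (H' u + v')) (\<lambda>u. g k u - g' u) (\<lambda>u. h k u - h' u)
      \<le> 2 * ?E k + 2 * ?F k"
    proof (intro always_eventually allI)
      fix k
      show "sobolev_energy s (\<lambda>u. (H k u + v k) - (H' u + v')) (\<lambda>u. g k u - g' u) (\<lambda>u. h k u - h' u)
        \<le> 2 * ?E k + 2 * ?F k"
        using sobolev_energy_add_le[OF sobolev_jet_diff[OF j[of k] j'] sobolev_jet_const[of s "v k - v'"], of 1]
        by (simp add: algebra_simps)
    qed
  qed simp
  then have "(\<lambda>k. sobolev_dist s (\<lambda>t. H k t + v k) (\<lambda>t. H' t + v')) \<longlonglongrightarrow> 0"
    by (simp add: sobolev_dist_tendsto_iff[OF sobolev_jet_add_const[OF j] sobolev_jet_add_const[OF j']])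
  then show ?thesis
    by (simp add: based_homotopy_def H_def H'_def v_def v'_def)
qed

lemma
  fixes \<gamma> :: "real \<Rightarrow> 'a::euclidean_space"
  assumes s: "1 / 2 < s" "s \<le> 1" and reg: "\<gamma> \<in> sobolev_regular s" and \<sigma>: "\<sigma> \<in> {0..1}"
  shows unit_speed_homotopy_regular: "unit_speed_homotopy \<gamma> \<sigma> \<in> sobolev_regular s"
    and unit_speed_homotopy_inj: "inj_on \<gamma> {0..<1} \<Longrightarrow> inj_on (unit_speed_homotopy \<gamma> \<sigma>) {0..<1}"
    and unit_speed_homotopy_one: "\<sigma> = 1 \<Longrightarrow> norm (vector_derivative (unit_speed_homotopy \<gamma> \<sigma>) (at t)) = 1"
proof -
  have s0: "s > 0" using s by simp
  obtain g h where j: "sobolev_jet s \<gamma> g h" and nz: "\<And>u. g u \<noteq> 0"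
    using reg sobolev_regular_iff_jet[OF s] by blast
  obtain m B where "speed_bounds g m B \<sigma>" by (rule speed_bounds_exist[OF j nz \<sigma>])
  then interpret speed_bounds g m B \<sigma> .
  interpret d: circle_diffeo "arc_param \<sigma> g" "arc_speed \<sigma> g" "m / B" "B / m" by (rule diffeo)
  note jh = sobolev_jet_homotopy[OF s0 j nz \<sigma>]
  have l: "homotopy_scale \<sigma> g > 0" using scale_lower c_low_pos by linarith
  have p: "(1 - \<sigma>) + \<sigma> / curve_length g * norm (g u) > 0" for u
    using speed_lower[of u] c_low_pos by linarith
  have "homotopy_velocity \<sigma> g (g u) \<noteq> 0" for u
    using l p[of u] nz[of u] by (simp add: homotopy_velocity_def rescale_def)
  then show "unit_speed_homotopy \<gamma> \<sigma> \<in> sobolev_regular s"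
    using jh sobolev_regular_iff_jet[OF s] by blast
  show "inj_on (unit_speed_homotopy \<gamma> \<sigma>) {0..<1}" if inj: "inj_on \<gamma> {0..<1}"
  proof (rule inj_onI)
    fix x y assume xy: "x \<in> {0..<1}" "y \<in> {0..<1}" "unit_speed_homotopy \<gamma> \<sigma> x = unit_speed_homotopy \<gamma> \<sigma> y"
    then have "\<gamma> (d.inverse_map x) = \<gamma> (d.inverse_map y)"
      using l by (simp add: unit_speed_homotopy_jet_eq[OF j])
    then have "d.inverse_map x = d.inverse_map y"
      using inj d.inverse_map_less_1 xy by (meson inj_onD)
    then show "x = y" by (metis d.inverse_map_right)
  qed
  show "norm (vector_derivative (unit_speed_homotopy \<gamma> \<sigma>) (at t)) = 1" if "\<sigma> = 1"
  proof -
    have "curve_length g > 0" using length(1) m by linarith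
    then show ?thesis
      unfolding sobolev_jetD(11)[OF jh]
      using that nz[of "d.inverse_map t"]
      by (simp add: homotopy_velocity_def rescale_def homotopy_scale_def)
  qed
qed

lemma unit_speed_homotopy_zero:
  fixes \<gamma> :: "real \<Rightarrow> 'b::euclidean_space"
  shows "unit_speed_homotopy \<gamma> 0 = \<gamma>"
proof -
  have "arc_param 0 g = id" for g :: "real \<Rightarrow> 'b::euclidean_space"
    by (simp add: fun_eq_iff arc_param_def)
  then have "inv (arc_param 0 g) t = t" for g :: "real \<Rightarrow> 'b::euclidean_space" and t
    by (simp only: inv_id id_apply)
  then show ?thesis
    by (simp add: fun_eq_iff unit_speed_homotopy_def homotopy_scale_def)
qed

lemma unit_speed_homotopy_fixes_arclength:
  fixes \<gamma> :: "real \<Rightarrow> 'a::euclidean_space"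
  assumes "\<And>u. norm (vector_derivative \<gamma> (at u)) = 1"
  shows "unit_speed_homotopy \<gamma> \<sigma> = \<gamma>"
proof -
  let ?g = "\<lambda>u. vector_derivative \<gamma> (at u)"
  have L: "curve_length ?g = 1" by (simp add: curve_length_def assms set_lebesgue_integral_def)
  have "(LBINT u=ereal 0..ereal t. norm (?g u)) = t" for t
  proof (cases "0 \<le> t")
    case True
    then show ?thesis by (simp add: assms interval_integral_Icc set_lebesgue_integral_def)
  next
    case False
    have "(LBINT u=ereal 0..ereal t. norm (?g u)) = - (LBINT u=ereal t..ereal 0. norm (?g u))"
      by (rule interval_integral_endpoints_reverse)
    also have "(LBINT u=ereal t..ereal 0. norm (?g u)) = - t"
      using False by (subst interval_integral_Icc) (auto simp: assms set_lebesgue_integral_def)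
    finally show ?thesis by simp
  qed
  then have "arc_param \<sigma> ?g = id"
    by (simp add: fun_eq_iff arc_param_def L algebra_simps)
  then have "inv (arc_param \<sigma> ?g) t = t" for t
    by (simp only: inv_id id_apply)
  then show ?thesis
    by (simp add: fun_eq_iff unit_speed_homotopy_def homotopy_scale_def L)
qed

lemma arclength_subset_regular:
  "arclength_curves s \<subseteq> (sobolev_regular s :: (real \<Rightarrow> 'a::euclidean_space) set)"
proof
  fix \<gamma> :: "real \<Rightarrow> 'a" assume "\<gamma> \<in> arclength_curves s"
  then have "\<gamma> \<in> sobolev s" "\<And>u. norm (vector_derivative \<gamma> (at u)) = 1"
    unfolding arclength_curves_def by blast+
  then show "\<gamma> \<in> sobolev_regular s"
    unfolding sobolev_regular_def by (simp only: mem_Collect_eq simp_thms zero_less_one)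
qed

lemma based_homotopy_regular:
  assumes s: "1 / 2 < s" "s \<le> 1" and reg: "\<gamma> \<in> sobolev_regular s" and \<sigma>: "\<sigma> \<in> {0..1}"
  shows "based_homotopy c z (\<gamma>, \<sigma>) \<in> sobolev_regular s"
proof -
  obtain g h where j: "sobolev_jet s (unit_speed_homotopy \<gamma> \<sigma>) g h" and nz: "\<forall>u. g u \<noteq> 0"
    using unit_speed_homotopy_regular[OF s reg \<sigma>] sobolev_regular_iff_jet[OF s] by blast
  have "sobolev_jet s (based_homotopy c z (\<gamma>, \<sigma>)) g h"
    unfolding based_homotopy_def fst_conv snd_conv by (rule sobolev_jet_add_const[OF j])
  with nz show ?thesis using sobolev_regular_iff_jet[OF s] by blast
qed

lemma based_homotopy_inj:
  assumes s: "1 / 2 < s" "s \<le> 1" and reg: "\<gamma> \<in> sobolev_regular s" and \<sigma>: "\<sigma> \<in> {0..1}"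
    and inj: "inj_on \<gamma> {0..<1}"
  shows "inj_on (based_homotopy c z (\<gamma>, \<sigma>)) {0..<1}"
  using unit_speed_homotopy_inj[OF s reg \<sigma> inj] by (simp add: based_homotopy_def inj_on_def)

lemma based_homotopy_one:
  fixes \<gamma> :: "real \<Rightarrow> 'a::euclidean_space"
  assumes s: "1 / 2 < s" "s \<le> 1" and reg: "\<gamma> \<in> sobolev_regular s"
  shows "based_homotopy c z (\<gamma>, 1) \<in> arclength_curves s"
proof -
  obtain g h where j: "sobolev_jet s (unit_speed_homotopy \<gamma> 1) g h"
  proof -
    have "unit_speed_homotopy \<gamma> 1 \<in> sobolev_regular s"
      by (rule unit_speed_homotopy_regular[OF s reg]) simp
    then show ?thesis using that sobolev_regular_iff_jet[OF s] by blast
  qed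
  have "norm (g u) = 1" for u
    using unit_speed_homotopy_one[OF s reg, of 1 u] sobolev_jetD(11)[OF j, of u] by simp
  moreover have j2: "sobolev_jet s (based_homotopy c z (\<gamma>, 1)) g h"
    unfolding based_homotopy_def fst_conv snd_conv by (rule sobolev_jet_add_const[OF j])
  ultimately show ?thesis
    using sobolev_iff_jet[OF s] sobolev_jetD(11)[OF j2] unfolding arclength_curves_def by auto
qed

text \<open>
  The four retractions differ only in the invariant set \<open>S\<close> of regular curves and in the choice of \<open>c\<close>.
\<close>
lemma strong_deformation_retraction:
  fixes S Y :: "(real \<Rightarrow> 'a::euclidean_space) set"
  assumes s: "1 / 2 < s" "s \<le> 1" and S: "S \<subseteq> sobolev_regular s"
    and inv: "\<And>\<gamma> \<sigma>. \<gamma> \<in> S \<Longrightarrow> \<sigma> \<in> {0..1} \<Longrightarrow> based_homotopy c z (\<gamma>, \<sigma>) \<in> S"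
    and Y: "Y \<subseteq> S" "Y \<subseteq> arclength_curves s" "\<And>\<gamma>. \<gamma> \<in> S \<Longrightarrow> based_homotopy c z (\<gamma>, 1) \<in> Y"
    and base: "\<And>\<gamma>. \<gamma> \<in> Y \<Longrightarrow> c \<noteq> 0 \<Longrightarrow> \<gamma> 0 = z"
  shows "strongly_deformation_retracts_onto (subtopology (sobolev_topology s) S) Y"
proof -
  interpret Metric_space "sobolev s :: (real \<Rightarrow> 'a) set" "sobolev_dist s" by (rule Metric_space_sobolev[OF s])
  have SM: "S \<subseteq> sobolev s" using S by (auto simp: sobolev_regular_def)
  have top: "topspace (subtopology (sobolev_topology s) S) = S"
    using SM by (simp add: topspace_sobolev_topology[OF s] inf_absorb2)
  have cont: "continuous_map (prod_topology (subtopology (sobolev_topology s) S) (top_of_set {0..1}))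
      (subtopology (sobolev_topology s) S) (based_homotopy c z)"
    unfolding sobolev_topology_eq
  proof (rule continuous_map_prod_sequentially[OF SM])
    show "based_homotopy c z p \<in> S" if "p \<in> S \<times> {0..1}" for p
      using that inv by (cases p) auto
    fix x \<sigma> x' \<sigma>'
    assume "\<And>k::nat. x k \<in> S" "\<And>k. \<sigma> k \<in> {0..1::real}" "x' \<in> S" "\<sigma>' \<in> {0..1}"
      "(\<lambda>k. sobolev_dist s (x k) x') \<longlonglongrightarrow> 0" "\<sigma> \<longlonglongrightarrow> \<sigma>'"
    then show "(\<lambda>k. sobolev_dist s (based_homotopy c z (x k, \<sigma> k)) (based_homotopy c z (x', \<sigma>'))) \<longlonglongrightarrow> 0"
      using S by (intro based_homotopy_dist_tendsto[OF s]) auto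
  qed
  have "based_homotopy c z (\<gamma>, 0) = \<gamma>" if "\<gamma> \<in> S" for \<gamma>
    using that S unit_speed_homotopy_zero[of \<gamma>] by (auto simp: based_homotopy_def)
  moreover have "based_homotopy c z (\<gamma>, \<sigma>) = \<gamma>" if "\<gamma> \<in> Y" for \<gamma> \<sigma>
  proof -
    have "unit_speed_homotopy \<gamma> \<sigma> = \<gamma>"
      using that Y(2) by (intro unit_speed_homotopy_fixes_arclength) (auto simp: arclength_curves_def)
    then show ?thesis using base[OF that] by (cases "c = 0") (auto simp: based_homotopy_def)
  qed
  ultimately show ?thesis
    unfolding strongly_deformation_retracts_onto_def top
    using Y(1,3) cont by (intro conjI exI[of _ "based_homotopy c z"]) auto
qed

theorem theorem3p7:
  fixes s :: real and z :: "real ^ 'n"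
  assumes "CARD('n) \<ge> 2" and "1/2 < s" and "s \<le> 1"
  shows "strongly_deformation_retracts_onto
           (subtopology (sobolev_topology s) (sobolev_regular s :: (real \<Rightarrow> real ^ 'n) set))
           (arclength_curves s)
       \<and> strongly_deformation_retracts_onto
           (subtopology (sobolev_topology s) (sobolev_regular s :: (real \<Rightarrow> real ^ 'n) set))
           (arclength_curves_at s z)
       \<and> strongly_deformation_retracts_onto
           (subtopology (sobolev_topology s) (sobolev_inj_regular s :: (real \<Rightarrow> real ^ 'n) set))
           (inj_arclength_curves s)
       \<and> strongly_deformation_retracts_onto
           (subtopology (sobolev_topology s) (sobolev_inj_regular s :: (real \<Rightarrow> real ^ 'n) set))
           (inj_arclength_curves_at s z)"
proof -
  note s = assms(2,3)
  note A = arclength_subset_regular[of s, where 'a = "real ^ 'n"]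
  have base: "based_homotopy 1 z (\<gamma>, 1) 0 = z" for \<gamma> :: "real \<Rightarrow> real ^ 'n"
    by (simp add: based_homotopy_def)
  show ?thesis
  proof (intro conjI)
    show "strongly_deformation_retracts_onto
        (subtopology (sobolev_topology s) (sobolev_regular s :: (real \<Rightarrow> real ^ 'n) set)) (arclength_curves s)"
      by (rule strong_deformation_retraction[OF s, where c = 0 and z = z])
        (use A in \<open>auto intro: based_homotopy_regular[OF s] based_homotopy_one[OF s]\<close>)
    show "strongly_deformation_retracts_onto
        (subtopology (sobolev_topology s) (sobolev_regular s :: (real \<Rightarrow> real ^ 'n) set)) (arclength_curves_at s z)"
      by (rule strong_deformation_retraction[OF s, where c = 1 and z = z])
        (use A base in \<open>auto simp: arclength_curves_at_def intro: based_homotopy_regular[OF s] based_homotopy_one[OF s]\<close>)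
    show "strongly_deformation_retracts_onto
        (subtopology (sobolev_topology s) (sobolev_inj_regular s :: (real \<Rightarrow> real ^ 'n) set)) (inj_arclength_curves s)"
      by (rule strong_deformation_retraction[OF s, where c = 0 and z = z])
        (use A in \<open>auto simp: sobolev_inj_regular_def inj_arclength_curves_def
            intro: based_homotopy_regular[OF s] based_homotopy_one[OF s] based_homotopy_inj[OF s]\<close>)
    show "strongly_deformation_retracts_onto
        (subtopology (sobolev_topology s) (sobolev_inj_regular s :: (real \<Rightarrow> real ^ 'n) set)) (inj_arclength_curves_at s z)"
      by (rule strong_deformation_retraction[OF s, where c = 1 and z = z])
        (use A base in \<open>auto simp: sobolev_inj_regular_def inj_arclength_curves_def inj_arclength_curves_at_def
            intro: based_homotopy_regular[OF s] based_homotopy_one[OF s] based_homotopy_inj[OF s]\<close>)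
  qed
qed

end
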